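(* Let $G=SL(2,\mathbb{R})$ and let $K$ be its subgroup of $2\times 2$ orthogonal matrices. Let $m$ be an admissible probability measure on $G$ and let $\rho$ be a $K$-invariant $m$-stationary mean on $G$. If $\rho(L)>0$ for a subset $L\subset G$, then for every $\epsilon>0$, every $k\ge 1$ and every compact set $Q\subset G$, there exist $a_0$ and $h$ in $G\setminus Q$ such that $$a_0,\ ha_0,\ \dots,\ h^ka_0\in L_\epsilon,$$ where $L_\epsilon=\{g\in G: d(g,L)<\epsilon\}$.
   Context: A probability measure $m$ on $G$ is admissible if (i) some convolution power $m^{*k}$, $k\ge1$, is absolutely continuous with respect to Haar measure, and (ii) the smallest closed subgroup of $G$ containing $\mathrm{supp}(m)$ is $G$. Here $d$ is a fixed right-invariant metric on $G$ compatible with its topology. $LUC(G)$ is the commutative $C^*$-algebra of bounded complex valued left uniformly continuous functions on $G$, where $f$ is left uniformly continuous if for every $\epsilon>0$ there is a neighborhood $V$ of the identity $e$ with $\sup_{g\in G}|f(vg)-f(g)|<\epsilon$ for every $v\in V$. A mean on $G$ is a positive linear functional $\rho$ on $LUC(G)$ with $\rho(\mathbf{1})=1$. For $f\in LUC(G)$ and $g\in G$ write $f_g(h)=f(gh)$. The mean $\rho$ is $m$-stationary if $m*\rho=\rho$, where $m*\rho(f)=\int_G\rho(f_g)\,dm(g)$; it is $K$-invariant if $\rho(f_k)=\rho(f)$ for all $k\in K$, $f\in LUC(G)$. Let $Z$ be the compact Hausdorff Gelfand space of $LUC(G)$, i.e. the space of nonzero continuous $C^*$-homomorphisms $LUC(G)\to\mathbb{C}$,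 and for $g\in G$ let $z_g\in Z$ be the evaluation $z_g(F)=F(g)$. Under the isomorphism $LUC(G)\cong C(Z)$, a mean $\rho$ corresponds by the Riesz theorem to a regular Borel probability measure $\mu_\rho$ on $Z$. For $L\subset G$, $\rho(L)$ denotes $\mu_\rho\big(\overline{\{z_g:g\in L\}}\big)$, and $\rho(L)>0$ means that this number is positive. *)

theory Defs
  imports "HOL-Probability.Probability"
begin

section \<open>Topological groups, written multiplicatively\<close>

class topological_group_mult = topological_space + monoid_mult + inverse +
  assumes left_inverse_mult: "inverse a * a = 1"
    and tendsto_mult_nhds: "LIM p (nhds a \<times>\<^sub>F nhds b). fst p * snd p :> nhds (a * b)"
    and tendsto_inverse_nhds: "LIM x (nhds a). inverse x :> nhds (inverse a)"

definition closed_subgroup :: "'g::topological_group_mult set \<Rightarrow> bool" where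
  "closed_subgroup H \<longleftrightarrow>
     closed H \<and> 1 \<in> H \<and> (\<forall>x\<in>H. \<forall>y\<in>H. x * y \<in> H) \<and> (\<forall>x\<in>H. inverse x \<in> H)"

definition haar_measure :: "'g::topological_group_mult measure \<Rightarrow> bool" where
  "haar_measure \<eta> \<longleftrightarrow>
     sets \<eta> = sets borel \<and>
     emeasure \<eta> UNIV \<noteq> 0 \<and>
     (\<forall>C. compact C \<longrightarrow> emeasure \<eta> C < \<infinity>) \<and>
     (\<forall>g. \<forall>A\<in>sets borel. emeasure \<eta> ((\<lambda>x. g * x) ` A) = emeasure \<eta> A) \<and>
     (\<forall>A\<in>sets borel. emeasure \<eta> A = (INF U\<in>{U. open U \<and> A \<subseteq> U}. emeasure \<eta> U)) \<and>
     (\<forall>U. open U \<longrightarrow> emeasure \<eta> U = (SUP C\<in>{C. compact C \<and> C \<subseteq> U}. emeasure \<eta> C))"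

definition mconvolution ::
    "'g::topological_group_mult measure \<Rightarrow> 'g measure \<Rightarrow> 'g measure" where
  "mconvolution m n = distr (m \<Otimes>\<^sub>M n) borel (\<lambda>(x, y). x * y)"

primrec mconvolution_power :: "'g::topological_group_mult measure \<Rightarrow> nat \<Rightarrow> 'g measure" where
  "mconvolution_power m 0 = return borel 1"
| "mconvolution_power m (Suc k) = mconvolution m (mconvolution_power m k)"

definition measure_support :: "'g::topological_space measure \<Rightarrow> 'g set" where
  "measure_support m = {x. \<forall>U. open U \<longrightarrow> x \<in> U \<longrightarrow> emeasure m U > 0}"

text \<open>Haar measure is unique up to a positive factor, so absolute continuity does not depend
  on which one is chosen.\<close>

definition admissible :: "'g::topological_group_mult measure \<Rightarrow> bool" where
  "admissible m \<longleftrightarrow>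
     (\<exists>k\<ge>1. \<exists>\<eta>. haar_measure \<eta> \<and> absolutely_continuous \<eta> (mconvolution_power m k)) \<and>
     \<Inter> {H. closed_subgroup H \<and> measure_support m \<subseteq> H} = UNIV"

section \<open>Left uniformly continuous functions and means\<close>

definition LUC :: "('g::topological_group_mult \<Rightarrow> complex) set" where
  "LUC = {f. bounded (range f) \<and>
             (\<forall>\<epsilon>>0. \<forall>\<^sub>F v in nhds 1. (SUP g. cmod (f (v * g) - f g)) < \<epsilon>)}"

definition ltranslate :: "'g::topological_group_mult \<Rightarrow> ('g \<Rightarrow> complex) \<Rightarrow> 'g \<Rightarrow> complex" where
  "ltranslate g f = (\<lambda>h. f (g * h))"

text \<open>A functional on \<^const>\<open>LUC\<close> is given by a function on all of
  \<^typ>\<open>'g \<Rightarrow> complex\<close>, whose values outside \<^const>\<open>LUC\<close> are irrelevant.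
  The set \<^term>\<open>\<real>\<^sub>\<ge>\<^sub>0\<close> consists of the nonnegative reals inside the complex numbers.\<close>

definition LUC_linear :: "(('g::topological_group_mult \<Rightarrow> complex) \<Rightarrow> complex) \<Rightarrow> bool" where
  "LUC_linear \<phi> \<longleftrightarrow>
     (\<forall>f\<in>LUC. \<forall>h\<in>LUC. \<phi> (\<lambda>x. f x + h x) = \<phi> f + \<phi> h) \<and>
     (\<forall>c. \<forall>f\<in>LUC. \<phi> (\<lambda>x. c * f x) = c * \<phi> f)"

definition is_mean :: "(('g::topological_group_mult \<Rightarrow> complex) \<Rightarrow> complex) \<Rightarrow> bool" where
  "is_mean \<rho> \<longleftrightarrow>
     LUC_linear \<rho> \<and>
     (\<forall>f\<in>LUC. (\<forall>x. f x \<in> \<real>\<^sub>\<ge>\<^sub>0) \<longrightarrow> \<rho> f \<in> \<real>\<^sub>\<ge>\<^sub>0) \<and>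
     \<rho> (\<lambda>x. 1) = 1"

definition stationary_mean ::
    "'g::topological_group_mult measure \<Rightarrow> (('g \<Rightarrow> complex) \<Rightarrow> complex) \<Rightarrow> bool" where
  "stationary_mean m \<rho> \<longleftrightarrow> (\<forall>f\<in>LUC. (\<integral>g. \<rho> (ltranslate g f) \<partial>m) = \<rho> f)"

definition invariant_mean ::
    "'g::topological_group_mult set \<Rightarrow> (('g \<Rightarrow> complex) \<Rightarrow> complex) \<Rightarrow> bool" where
  "invariant_mean K \<rho> \<longleftrightarrow> (\<forall>k\<in>K. \<forall>f\<in>LUC. \<rho> (ltranslate k f) = \<rho> f)"

section \<open>The Gelfand space and the measure attached to a mean\<close>

text \<open>Characters are made \<^const>\<open>extensional\<close>, i.e. constant outside \<^const>\<open>LUC\<close>, so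
  that two of them are equal as soon as they agree on \<^const>\<open>LUC\<close>.\<close>

definition LUC_characters :: "(('g::topological_group_mult \<Rightarrow> complex) \<Rightarrow> complex) set" where
  "LUC_characters = {\<phi> \<in> extensional LUC.
     LUC_linear \<phi> \<and>
     (\<forall>f\<in>LUC. \<forall>h\<in>LUC. \<phi> (\<lambda>x. f x * h x) = \<phi> f * \<phi> h) \<and>
     (\<forall>f\<in>LUC. \<phi> (\<lambda>x. cnj (f x)) = cnj (\<phi> f)) \<and>
     (\<exists>f\<in>LUC. \<phi> f \<noteq> 0) \<and>
     (\<forall>f\<in>LUC. \<forall>\<epsilon>>0. \<exists>\<delta>>0. \<forall>h\<in>LUC. (SUP x. cmod (h x - f x)) < \<delta> \<longrightarrow> cmod (\<phi> h - \<phi> f) < \<epsilon>)}"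

text \<open>The Gelfand topology is the topology of pointwise convergence on \<^const>\<open>LUC\<close>.\<close>

definition gelfand_topology ::
    "(('g::topological_group_mult \<Rightarrow> complex) \<Rightarrow> complex) topology" where
  "gelfand_topology = subtopology (product_topology (\<lambda>_. euclidean) LUC) LUC_characters"

definition point_character ::
    "'g::topological_group_mult \<Rightarrow> ('g \<Rightarrow> complex) \<Rightarrow> complex" where
  "point_character g = (\<lambda>F\<in>LUC. F g)"

definition regular_borel_prob :: "'a topology \<Rightarrow> 'a measure \<Rightarrow> bool" where
  "regular_borel_prob X \<mu> \<longleftrightarrow>
     prob_space \<mu> \<and>
     space \<mu> = topspace X \<and>
     sets \<mu> = sigma_sets (topspace X) {U. openin X U} \<and>
     (\<forall>A\<in>sets \<mu>. emeasure \<mu> A = (INF U\<in>{U. openin X U \<and> A \<subseteq> U}. emeasure \<mu> U)) \<and>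
     (\<forall>A\<in>sets \<mu>. emeasure \<mu> A = (SUP C\<in>{C. compactin X C \<and> C \<subseteq> A}. emeasure \<mu> C))"

text \<open>The Gelfand isomorphism sends \<open>f\<close> to \<open>\<lambda>z. z f\<close>. For a mean, existence and
  uniqueness of the measure are the Riesz representation theorem.\<close>

definition mean_measure ::
    "(('g::topological_group_mult \<Rightarrow> complex) \<Rightarrow> complex) \<Rightarrow>
     (('g \<Rightarrow> complex) \<Rightarrow> complex) measure" where
  "mean_measure \<rho> = (THE \<mu>. regular_borel_prob gelfand_topology \<mu> \<and>
                            (\<forall>f\<in>LUC. \<rho> f = (\<integral>z. z f \<partial>\<mu>)))"

definition mean_of_set ::
    "(('g::topological_group_mult \<Rightarrow> complex) \<Rightarrow> complex) \<Rightarrow> 'g set \<Rightarrow> real" where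
  "mean_of_set \<rho> L = measure (mean_measure \<rho>) (gelfand_topology closure_of (point_character ` L))"

section \<open>Invariant metrics\<close>

definition compatible_right_invariant_metric ::
    "('g::topological_group_mult \<Rightarrow> 'g \<Rightarrow> real) \<Rightarrow> bool" where
  "compatible_right_invariant_metric d \<longleftrightarrow>
     Metric_space UNIV d \<and>
     Metric_space.mtopology UNIV d = euclidean \<and>
     (\<forall>x y g. d (x * g) (y * g) = d x y)"

text \<open>The infimum is taken in \<^typ>\<open>ereal\<close>, so the distance to the empty set is infinite.\<close>

definition thickening :: "('g \<Rightarrow> 'g \<Rightarrow> real) \<Rightarrow> 'g set \<Rightarrow> real \<Rightarrow> 'g set" where
  "thickening d L \<epsilon> = {g. (INF l\<in>L. ereal (d g l)) < ereal \<epsilon>}"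

section \<open>The group SL(2,R)\<close>

typedef SL2R = "{A :: real^2^2. det A = 1}"
  morphisms mat_of SL2R_of
  by (rule exI[of _ "mat 1"]) simp

setup_lifting type_definition_SL2R

lemma matrix_inv_inverse:
  fixes A :: "real^'n^'n"
  assumes "det A \<noteq> 0"
  shows "A ** matrix_inv A = mat 1" "matrix_inv A ** A = mat 1"
proof -
  have "\<exists>B. A ** B = mat 1 \<and> B ** A = mat 1"
    using assms by (simp add: invertible_det_nz[symmetric] invertible_def)
  hence "A ** matrix_inv A = mat 1 \<and> matrix_inv A ** A = mat 1"
    unfolding matrix_inv_def by (rule someI_ex)
  thus "A ** matrix_inv A = mat 1" "matrix_inv A ** A = mat 1" by simp_all
qed

lemma det_matrix_inv_SL2:
  fixes A :: "real^2^2"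
  assumes "det A = 1"
  shows "det (matrix_inv A) = 1"
proof -
  have "det A * det (matrix_inv A) = 1"
    using arg_cong[OF matrix_inv_inverse(1)[of A], of det] assms by (simp add: det_mul)
  thus ?thesis using assms by simp
qed

instantiation SL2R :: monoid_mult
begin

lift_definition one_SL2R :: SL2R is "mat 1" by simp

lift_definition times_SL2R :: "SL2R \<Rightarrow> SL2R \<Rightarrow> SL2R" is "(**)" by (simp add: det_mul)

instance
  by standard (transfer; simp add: matrix_mul_assoc)+

end

instantiation SL2R :: inverse
begin

lift_definition inverse_SL2R :: "SL2R \<Rightarrow> SL2R" is matrix_inv
  by (rule det_matrix_inv_SL2)

definition divide_SL2R :: "SL2R \<Rightarrow> SL2R \<Rightarrow> SL2R" where
  "divide_SL2R g h = g * inverse h"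

instance ..

end

text \<open>The following metric, restricted from the space of matrices, only serves to equip the
  group with its topology. It is not right invariant.\<close>

instantiation SL2R :: metric_space
begin

lift_definition dist_SL2R :: "SL2R \<Rightarrow> SL2R \<Rightarrow> real" is dist .

definition uniformity_SL2R :: "(SL2R \<times> SL2R) filter" where
  "uniformity_SL2R = (INF e\<in>{0<..}. principal {(x, y). dist x y < e})"

definition open_SL2R :: "SL2R set \<Rightarrow> bool" where
  "open_SL2R U \<longleftrightarrow> (\<forall>x\<in>U. eventually (\<lambda>(x', y). x' = x \<longrightarrow> y \<in> U) uniformity)"

instance
proof
  fix x y z :: SL2R
  show "dist x y = 0 \<longleftrightarrow> x = y"
    by transfer simp
  show "dist x y \<le> dist x z + dist y z"
    by transfer (rule dist_triangle2)
qed (rule uniformity_SL2R_def open_SL2R_def)+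

end

lemma tendsto_SL2R_iff:
  "(f \<longlongrightarrow> a) F \<longleftrightarrow> ((\<lambda>x. mat_of (f x)) \<longlongrightarrow> mat_of a) F"
  by (simp add: tendsto_iff dist_SL2R.rep_eq)

lemma matrix_inv_SL2:
  fixes A :: "real^2^2"
  assumes "det A = 1"
  shows "matrix_inv A = vector [vector [A$2$2, - A$1$2], vector [- A$2$1, A$1$1]]"
    (is "_ = ?B")
proof -
  have "A ** ?B = mat 1"
    using assms
    by (simp add: vec_eq_iff matrix_matrix_mult_def mat_def forall_2 sum_2 det_2 algebra_simps)
  hence "matrix_inv A ** (A ** ?B) = matrix_inv A"
    by (simp only: matrix_mul_rid)
  moreover have "matrix_inv A ** (A ** ?B) = ?B"
    using assms by (simp only: matrix_mul_assoc matrix_inv_inverse matrix_mul_lid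
        one_neq_zero not_False_eq_True)
  ultimately show ?thesis by simp
qed

lemma tendsto_matrix_mult:
  fixes f :: "'a \<Rightarrow> real^'n^'m" and g :: "'a \<Rightarrow> real^'k^'n"
  assumes "(f \<longlongrightarrow> A) F" "(g \<longlongrightarrow> B) F"
  shows "((\<lambda>x. f x ** g x) \<longlongrightarrow> A ** B) F"
  unfolding matrix_matrix_mult_def
  by (intro tendsto_vec_lambda tendsto_sum tendsto_mult tendsto_vec_nth assms)

instance SL2R :: topological_group_mult
proof
  fix a b :: SL2R
  show "inverse a * a = 1"
    by transfer (simp add: matrix_inv_inverse)
  have "filterlim fst (nhds a) (nhds a \<times>\<^sub>F nhds b)" "filterlim snd (nhds b) (nhds a \<times>\<^sub>F nhds b)"
    by (rule filterlim_fst filterlim_snd)+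
  thus "LIM p (nhds a \<times>\<^sub>F nhds b). fst p * snd p :> nhds (a * b)"
    by (auto simp: tendsto_SL2R_iff times_SL2R.rep_eq intro!: tendsto_matrix_mult)
  have inv: "mat_of (inverse x) = vector [vector [mat_of x$2$2, - mat_of x$1$2],
      vector [- mat_of x$2$1, mat_of x$1$1]]" for x
    using mat_of[of x] by (simp add: inverse_SL2R.rep_eq matrix_inv_SL2)
  have "filterlim (\<lambda>x. x) (nhds a) (nhds a)"
    by (rule filterlim_ident)
  hence ent: "((\<lambda>x. mat_of x $ i $ j) \<longlongrightarrow> mat_of a $ i $ j) (nhds a)" for i j
    by (intro tendsto_vec_nth) (simp add: tendsto_SL2R_iff)
  show "LIM x (nhds a). inverse x :> nhds (inverse a)"
    unfolding tendsto_SL2R_iff inv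
  proof (intro vec_tendstoI)
    fix i j :: 2
    show "((\<lambda>x. (vector [vector [mat_of x$2$2, - mat_of x$1$2],
             vector [- mat_of x$2$1, mat_of x$1$1]] :: real^2^2) $ i $ j) \<longlongrightarrow>
           (vector [vector [mat_of a$2$2, - mat_of a$1$2],
             vector [- mat_of a$2$1, mat_of a$1$1]] :: real^2^2) $ i $ j) (nhds a)"
      using exhaust_2[of i] exhaust_2[of j] by (auto intro!: tendsto_minus ent)
  qed
qed

definition SO2 :: "SL2R set" where
  "SO2 = {k. orthogonal_matrix (mat_of k)}"

end

theory Submission
  imports Defs
begin

text \<open>Fix a left uniformly continuous \<open>f\<close> with \<open>0 \<le> f \<le> 1\<close> that equals \<open>1\<close> on \<open>L\<close> and is positive
only on the thickening of \<open>L\<close>; the distance to \<open>L\<close> provides one, because the metric is right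
invariant. Then \<open>c = \<rho> f\<close> is at least the mass of \<open>L\<close>, hence positive. Everything is read off from
the function \<open>\<phi> g = \<rho> (\<lambda>x. f (g * x))\<close>, which is continuous, bounded, has \<open>\<phi> 1 = c\<close>, and is harmonic:
\<open>\<phi> g\<close> is the integral of \<open>\<phi> (g * x)\<close> over \<open>m\<close>.

Harmonicity gives two things. First, \<open>\<phi> g \<ge> c\<close> for some \<open>g\<close> outside any given compact set
(\<open>harmonic_off_compact\<close>): otherwise \<open>\<phi>\<close> would attain its maximum, on a compact set \<open>S\<close>, and
\<open>{x. S x \<subseteq> S}\<close> would be a compact subgroup containing the support of \<open>m\<close>, that is, the whole group.
Second, \<open>\<phi> (g * u) - \<phi> g\<close> tends to \<open>0\<close> as \<open>u \<rightarrow> 1\<close>, uniformly in \<open>g\<close> (\<open>right_uniformly_continuous\<close>):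
\<open>\<phi>\<close> is also harmonic for a convolution power that is absolutely continuous with respect to Haar
measure, and translation is continuous in \<open>L\<^sup>1\<close>.

Now let \<open>g\<close> be far out with \<open>\<phi> g \<ge> c\<close>. A quarter turn from \<open>SO2\<close> on the right does not change \<open>\<phi> g\<close>
and exchanges the two columns of \<open>g\<close> up to sign, so the first column may be taken long. Conjugate the
unipotent matrix \<open>u\<close> with entry \<open>s\<close> in the corner, where \<open>s\<close> is a constant divided by the squared
length of that column: the power \<open>h ^ j\<close> of \<open>h = g * u * inverse g\<close> has norm at least a large multiple
of \<open>j\<close>, whereas \<open>h ^ j * g = g * u ^ j\<close> with \<open>u ^ j\<close> close to \<open>1\<close>. Hence \<open>\<phi> (h ^ j * g) \<ge> c / 2\<close> for all
\<open>j\<close> up to a bound \<open>T\<close> fixed in advance.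

Average \<open>f (h ^ sum_list w * g * x)\<close> over all words \<open>w\<close> of length \<open>n\<close> in the letters \<open>0, ..., k + 1\<close>.
Its mean in \<open>x\<close> is at least \<open>c / 2\<close>, so for some \<open>x\<close> the words with
\<open>h ^ sum_list w * g * x\<close> in the thickening have density at least \<open>c / 4\<close>. By the density
Hales-Jewett theorem (\<open>density_Hales_Jewett\<close>) they contain a combinatorial line, and \<open>sum_list\<close> maps
a line to an arithmetic progression. This is the required geometric progression, with one term to
spare; the spare term serves to leave \<open>Q\<close> when the first term happens to lie in \<open>Q\<close>.

The Hales-Jewett theorem is proved by a density increment, along the lines of the Polymath proof as
simplified by Dodos, Kanellopoulos and Tyros; the increment is \<open>DHJ_increment\<close>.

The mass of \<open>L\<close> is defined through the unique regular measure on the Gelfand space that represents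
\<open>\<rho>\<close>, so the inequality between this mass and \<open>\<rho> f\<close> (\<open>mean_of_set_le\<close>) rests on the existence and
uniqueness of that measure. It follows from a Riesz representation theorem for a vector lattice of
continuous functions with enough bump functions (\<open>Riesz_representation\<close>), applied to the Gelfand
transforms of real left uniformly continuous functions.\<close>

section \<open>Averages over words\<close>

definition words :: "nat \<Rightarrow> nat \<Rightarrow> nat list set" where
  "words k n = {w. set w \<subseteq> {..<k} \<and> length w = n}"

definition avg :: "nat \<Rightarrow> nat \<Rightarrow> (nat list \<Rightarrow> real) \<Rightarrow> real" where
  "avg k n f = (\<Sum>w\<in>words k n. f w) / real (k ^ n)"

abbreviation dens :: "nat \<Rightarrow> nat \<Rightarrow> nat list set \<Rightarrow> real" where
  "dens k n D \<equiv> avg k n (indicator D)"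

lemma finite_words [simp, intro]: "finite (words k n)"
  unfolding words_def by (rule finite_lists_length_eq) simp

lemma card_words [simp]: "card (words k n) = k ^ n"
  unfolding words_def using card_lists_length_eq[of "{..<k}" n] by simp

lemma words_ne: "k \<ge> 1 \<Longrightarrow> words k n \<noteq> {}"
proof -
  assume "k \<ge> 1"
  then have "replicate n 0 \<in> words k n" by (auto simp: words_def)
  then show ?thesis by blast
qed

lemma words_length: "w \<in> words k n \<Longrightarrow> length w = n"
  by (simp add: words_def)

lemma words_nth: "w \<in> words k n \<Longrightarrow> j < n \<Longrightarrow> w ! j < k"
  unfolding words_def by (auto simp: subset_iff)

lemma words_append: "u \<in> words k l \<Longrightarrow> z \<in> words k n \<Longrightarrow> u @ z \<in> words k (l + n)"
  by (auto simp: words_def)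

lemma words_mono: "k \<le> k' \<Longrightarrow> words k n \<subseteq> words k' n"
  by (auto simp: words_def)

lemma words_split: "bij_betw (\<lambda>(u, z). u @ z) (words k l \<times> words k n) (words k (l + n))"
proof (rule bij_betw_byWitness[where f' = "\<lambda>w. (take l w, drop l w)"])
  show "(\<lambda>w. (take l w, drop l w)) ` words k (l + n) \<subseteq> words k l \<times> words k n"
    by (auto simp: words_def dest: in_set_takeD in_set_dropD)
qed (auto simp: words_def)

lemma avg_append: "avg k (l + n) f = avg k l (\<lambda>u. avg k n (\<lambda>z. f (u @ z)))"
proof -
  have "(\<Sum>w\<in>words k (l + n). f w) = (\<Sum>(u, z)\<in>words k l \<times> words k n. f (u @ z))"
    using sum.reindex_bij_betw[OF words_split, of f k l n] by (simp add: case_prod_unfold)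
  then show ?thesis
    by (simp add: avg_def sum.cartesian_product[symmetric] sum_divide_distrib power_add field_simps)
qed

lemma avg_swap: "avg k l (\<lambda>u. avg k' n (\<lambda>z. f u z)) = avg k' n (\<lambda>z. avg k l (\<lambda>u. f u z))"
  unfolding avg_def
  by (simp add: sum_divide_distrib[symmetric] mult.commute)
    (intro disjI2 sum.swap)

lemma dens_append: "dens k (l + n) D = avg k l (\<lambda>u. dens k n {z. u @ z \<in> D})"
proof -
  have "(\<lambda>z. indicat_real D (u @ z)) = indicator {z. u @ z \<in> D}" for u by (auto simp: indicator_def)
  then show ?thesis by (simp add: avg_append)
qed

lemma dens_append2: "dens k (l + n) D = avg k n (\<lambda>z. dens k l {u. u @ z \<in> D})"
proof -
  have "(\<lambda>u. indicat_real D (u @ z)) = indicator {u. u @ z \<in> D}" for z by (auto simp: indicator_def)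
  then show ?thesis by (simp add: avg_append avg_swap[of k l])
qed

lemma avg_cong: "(\<And>w. w \<in> words k n \<Longrightarrow> f w = g w) \<Longrightarrow> avg k n f = avg k n g"
  by (simp add: avg_def)

lemma avg_mono: "(\<And>w. w \<in> words k n \<Longrightarrow> f w \<le> g w) \<Longrightarrow> avg k n f \<le> avg k n g"
  unfolding avg_def by (intro divide_right_mono sum_mono) auto

lemma avg_nonneg: "(\<And>w. w \<in> words k n \<Longrightarrow> 0 \<le> f w) \<Longrightarrow> 0 \<le> avg k n f"
  unfolding avg_def by (intro divide_nonneg_nonneg sum_nonneg) auto

lemma avg_const [simp]: "k \<ge> 1 \<Longrightarrow> avg k n (\<lambda>_. c) = c"
  by (simp add: avg_def)

lemma avg_add: "avg k n (\<lambda>w. f w + g w) = avg k n f + avg k n g"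
  by (simp add: avg_def sum.distrib add_divide_distrib)

lemma avg_diff: "avg k n (\<lambda>w. f w - g w) = avg k n f - avg k n g"
  by (simp add: avg_def sum_subtractf diff_divide_distrib)

lemma avg_cmult: "avg k n (\<lambda>w. c * f w) = c * avg k n f"
  by (simp add: avg_def sum_distrib_left[symmetric])

lemma avg_sum: "avg k n (\<lambda>w. \<Sum>i\<in>I. f i w) = (\<Sum>i\<in>I. avg k n (f i))"
  unfolding avg_def by (subst sum.swap) (simp add: sum_divide_distrib)

lemma avg_le_ex: "k \<ge> 1 \<Longrightarrow> c \<le> avg k n f \<Longrightarrow> \<exists>w\<in>words k n. c \<le> f w"
proof (rule ccontr)
  assume k: "k \<ge> 1" and c: "c \<le> avg k n f" and "\<not> (\<exists>w\<in>words k n. c \<le> f w)"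
  then have lt: "\<And>w. w \<in> words k n \<Longrightarrow> f w < c" by force
  have ne: "words k n \<noteq> {}" using words_ne[OF k] .
  have "(\<Sum>w\<in>words k n. f w) < (\<Sum>w\<in>words k n. c)"
    by (rule sum_strict_mono) (use ne lt in auto)
  then show False using c k by (simp add: avg_def field_simps)
qed

lemma dens_le_1: "k \<ge> 1 \<Longrightarrow> dens k n D \<le> 1"
  using avg_mono[of k n "indicator D" "\<lambda>_. 1"] by (simp add: indicator_def)

lemma dens_nonneg: "0 \<le> dens k n D"
  by (rule avg_nonneg) simp

lemma dens_mono: "(\<And>w. w \<in> words k n \<Longrightarrow> w \<in> A \<Longrightarrow> w \<in> B) \<Longrightarrow> dens k n A \<le> dens k n B"
  by (rule avg_mono) (auto simp: indicator_def)

text \<open>The converse of Markov's inequality for functions bounded by \<open>1\<close>: an average \<open>\<delta>\<close> forces the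
value \<open>\<delta> / 2\<close> on a set of density \<open>\<delta> / 2\<close>, since the rest contributes at most \<open>\<delta> / 2\<close>.\<close>

lemma dens_reverse_markov:
  assumes "k \<ge> 1" "\<And>w. w \<in> words k n \<Longrightarrow> f w \<le> 1" "\<delta> \<le> avg k n f" "\<delta> \<ge> 0"
  shows "\<delta> / 2 \<le> dens k n {w. \<delta> / 2 \<le> f w}"
proof -
  have "avg k n f \<le> avg k n (\<lambda>w. indicator {w. \<delta> / 2 \<le> f w} w + \<delta> / 2)"
    by (rule avg_mono) (use assms in \<open>auto simp: indicator_def intro: add_increasing2\<close>)
  then show ?thesis using assms by (simp add: avg_add)
qed

lemma dens_pigeonhole:
  fixes \<theta> :: real
  assumes "finite I" "\<And>w. w \<in> words k n \<Longrightarrow> w \<in> A \<Longrightarrow> \<exists>i\<in>I. w \<in> S i" "\<theta> * card I \<le> dens k n A" "\<theta> > 0"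
    "I \<noteq> {}"
  shows "\<exists>i\<in>I. \<theta> \<le> dens k n (S i)"
proof (rule ccontr)
  assume "\<not> ?thesis"
  then have lt: "\<And>i. i \<in> I \<Longrightarrow> dens k n (S i) < \<theta>" by force
  have "dens k n A \<le> avg k n (\<lambda>w. \<Sum>i\<in>I. indicator (S i) w)"
  proof (rule avg_mono)
    fix w assume w: "w \<in> words k n"
    show "indicator A w \<le> (\<Sum>i\<in>I. indicator (S i) w :: real)"
    proof (cases "w \<in> A")
      case True
      then obtain i where "i \<in> I" "w \<in> S i" using assms(2) w by blast
      then have "indicator (S i) w \<le> (\<Sum>i\<in>I. indicator (S i) w :: real)"
        by (intro member_le_sum) (use assms in auto)
      then show ?thesis using \<open>w \<in> S i\<close> True by (simp add: order_trans)
    qed (simp add: sum_nonneg)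
  qed
  also have "\<dots> = (\<Sum>i\<in>I. dens k n (S i))" by (rule avg_sum)
  also have "\<dots> < (\<Sum>i\<in>I. \<theta>)" by (rule sum_strict_mono) (use assms lt in auto)
  finally show False using assms(3) by (simp add: mult.commute)
qed

section \<open>Wildcards and combinatorial subspaces\<close>

text \<open>The letter \<open>k\<close> plays two roles: it is the wildcard of a variable word over \<open>{..<k}\<close>, and at the same
time the last letter of the alphabet \<open>{..<Suc k}\<close>. A variable word over \<open>k\<close> letters is thus just a
word over \<open>Suc k\<close> letters in which \<open>k\<close> occurs. The induction on the size of the alphabet lives on this
identification.\<close>

definition fill :: "nat \<Rightarrow> nat \<Rightarrow> nat list \<Rightarrow> nat list" where
  "fill k i w = map (\<lambda>a. if a = k then i else a) w"

lemma length_fill [simp]: "length (fill k i w) = length w" by (simp add: fill_def)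
lemma fill_append [simp]: "fill k i (u @ w) = fill k i u @ fill k i w" by (simp add: fill_def)
lemma fill_nth: "j < length w \<Longrightarrow> fill k i w ! j = (if w ! j = k then i else w ! j)" by (simp add: fill_def)
lemma fill_self [simp]: "fill k k w = w" by (simp add: fill_def map_idI)
lemma fill_fill: "fill k i (fill k a w) = fill k (if a = k then i else a) w" by (auto simp: fill_def)
lemma fill_words: "w \<in> words (Suc k) n \<Longrightarrow> i < k \<Longrightarrow> fill k i w \<in> words k n"
  by (auto simp: words_def fill_def subset_iff less_Suc_eq)
lemma fill_id: "w \<in> words k n \<Longrightarrow> fill k i w = w"
  by (auto simp: fill_def words_def intro!: map_idI)

text \<open>The density Hales-Jewett property for one word length \<open>n\<close>, with \<open>w\<close> the line. Asking for a single \<open>n\<close>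
is enough here, because each use is free to choose the word length, and it spares the step from \<open>n\<close> to
larger lengths.\<close>

definition DHJ :: "nat \<Rightarrow> real \<Rightarrow> bool" where
  "DHJ k \<delta> \<longleftrightarrow> (\<exists>n. \<forall>D. \<delta> \<le> dens k n D \<longrightarrow>
     (\<exists>w\<in>words (Suc k) n. k \<in> set w \<and> (\<forall>i<k. fill k i w \<in> D)))"

lemma DHJ_1: "\<delta> > 0 \<Longrightarrow> DHJ 1 \<delta>"
proof -
  assume "\<delta> > 0"
  have w: "words (Suc 0) (Suc 0) = {[0]}" by (auto simp: words_def length_Suc_conv)
  have "[0] \<in> D" if "\<delta> \<le> dens 1 1 D" for D
    using that \<open>\<delta> > 0\<close> by (cases "[0] \<in> D") (auto simp: avg_def w)
  then show ?thesis unfolding DHJ_def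
    by (intro exI[of _ 1] allI impI bexI[of _ "[1]"]) (auto simp: fill_def words_def)
qed

text \<open>A combinatorial subspace of dimension \<open>d\<close> over \<open>k\<close> letters is encoded by a template, in which an entry
below \<open>k\<close> is a fixed letter and the entry \<open>k + j\<close> stands for coordinate number \<open>j\<close>.\<close>

definition inst :: "nat \<Rightarrow> nat list \<Rightarrow> nat list \<Rightarrow> nat list" where
  "inst k t x = map (\<lambda>a. if a < k then a else x ! (a - k)) t"

definition is_template :: "nat \<Rightarrow> nat \<Rightarrow> nat \<Rightarrow> nat list \<Rightarrow> bool" where
  "is_template k d n t \<longleftrightarrow> length t = n \<and> set t \<subseteq> {..<k + d} \<and> {k..<k + d} \<subseteq> set t"

lemma length_inst [simp]: "length (inst k t x) = length t" by (simp add: inst_def)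
lemma inst_append: "inst k (s @ t) x = inst k s x @ inst k t x" by (simp add: inst_def)

lemma inst_words: "is_template k d n t \<Longrightarrow> x \<in> words k d \<Longrightarrow> inst k t x \<in> words k n"
  by (force simp: is_template_def inst_def words_def subset_iff)

lemma inst_const: "u \<in> words k n \<Longrightarrow> inst k u x = u"
  by (auto simp: inst_def words_def intro!: map_idI)

lemma subspace_inst:
  assumes "is_template k d n t" "is_template k e d s"
  shows "is_template k e n (inst k t s)"
proof -
  have l: "length s = d" "length t = n" using assms by (auto simp: is_template_def)
  have "set (inst k t s) \<subseteq> {..<k + e}"
    using assms unfolding is_template_def inst_def by (force simp: subset_iff)
  moreover have "{k..<k + e} \<subseteq> set (inst k t s)"
  proof
    fix b assume b: "b \<in> {k..<k + e}"
    then have "b \<in> set s" using assms by (auto simp: is_template_def)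
    then obtain j where j: "j < d" "s ! j = b" using l by (auto simp: in_set_conv_nth)
    then have "k + j \<in> set t" using assms(1) by (auto simp: is_template_def)
    then show "b \<in> set (inst k t s)" unfolding inst_def using j by force
  qed
  ultimately show ?thesis using l by (simp add: is_template_def)
qed

lemma inst_inst:
  assumes "is_template k d n t" "length s = d"
  shows "inst k (inst k t s) x = inst k t (inst k s x)"
  using assms unfolding inst_def is_template_def
  by (auto simp: subset_iff)

lemma subspace_line:
  assumes "is_template k d n t" "w \<in> words (Suc k) d" "k \<in> set w"
  shows "inst k t w \<in> words (Suc k) n" "k \<in> set (inst k t w)"
    "i < k \<Longrightarrow> fill k i (inst k t w) = inst k t (fill k i w)"
proof -
  have l: "length w = d" "length t = n" using assms by (auto simp: is_template_def words_def)
  show "inst k t w \<in> words (Suc k) n"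
    using assms l unfolding is_template_def inst_def words_def by (force simp: subset_iff)
  obtain j where j: "j < d" "w ! j = k" using assms(3) l by (auto simp: in_set_conv_nth)
  then have "k + j \<in> set t" using assms(1) by (auto simp: is_template_def)
  then show "k \<in> set (inst k t w)" unfolding inst_def using j by force
  show "i < k \<Longrightarrow> fill k i (inst k t w) = inst k t (fill k i w)"
    using assms(1) l unfolding inst_def is_template_def fill_def by (auto simp: subset_iff)
qed

lemma subspace_prefix:
  assumes "u \<in> words k l" "is_template k d n t" "z \<in> words k m"
  shows "is_template k d (l + n + m) (u @ t @ z)" "inst k (u @ t @ z) x = u @ inst k t x @ z"
  using assms unfolding is_template_def words_def by (force, auto simp: inst_append inst_const words_def)

text \<open>A subspace over \<open>k\<close> letters extends to one over \<open>Suc k\<close> letters; the coordinates are renumbered because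
\<open>k\<close> is now a letter. Filling \<open>k\<close> maps the larger subspace back onto the smaller one.\<close>

lemma subspace_shift:
  assumes "is_template k d n t"
  shows "is_template (Suc k) d n (map (\<lambda>a. if a < k then a else Suc a) t)" 
    "i < k \<Longrightarrow> x \<in> words (Suc k) d \<Longrightarrow> fill k i (inst (Suc k) (map (\<lambda>a. if a < k then a else Suc a) t) x) = inst k t (fill k i x)"
proof -
  have "{Suc k..<Suc k + d} \<subseteq> (\<lambda>a. if a < k then a else Suc a) ` set t"
  proof
    fix b assume "b \<in> {Suc k..<Suc k + d}"
    then obtain c where c: "b = Suc c" "k \<le> c" "c < k + d" by (cases b) auto
    then have "c \<in> set t" using assms by (auto simp: is_template_def)
    then show "b \<in> (\<lambda>a. if a < k then a else Suc a) ` set t" using c by (intro image_eqI[of _ _ c]) auto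
  qed
  then show "is_template (Suc k) d n (map (\<lambda>a. if a < k then a else Suc a) t)"
    using assms unfolding is_template_def by force
  show "i < k \<Longrightarrow> x \<in> words (Suc k) d \<Longrightarrow> fill k i (inst (Suc k) (map (\<lambda>a. if a < k then a else Suc a) t) x) = inst k t (fill k i x)"
    using assms unfolding is_template_def fill_def inst_def by (auto simp: subset_iff words_def)
qed

definition DHJ_subspaces :: "nat \<Rightarrow> nat \<Rightarrow> real \<Rightarrow> bool" where
  "DHJ_subspaces k d \<delta> \<longleftrightarrow> (\<exists>n. \<forall>D. \<delta> \<le> dens k n D \<longrightarrow>
     (\<exists>t. is_template k d n t \<and> (\<forall>x\<in>words k d. inst k t x \<in> D)))"

text \<open>Lines give subspaces of any dimension. Cut words in two. Many tails \<open>y\<close> have a dense set of heads, so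
each of them has a line of heads; there are only finitely many lines, so one line serves a dense set of
tails, and the induction hypothesis finds a subspace of dimension \<open>d\<close> among these tails.\<close>

lemma DHJ_subspaces_if_DHJ:
  assumes k: "k \<ge> 1" and dhj: "\<And>\<delta>. \<delta> > 0 \<Longrightarrow> DHJ k \<delta>"
  shows "\<delta> > 0 \<Longrightarrow> DHJ_subspaces k d \<delta>"
proof (induction d arbitrary: \<delta>)
  case 0
  have w: "words k 0 = {[]}" by (auto simp: words_def)
  have "[] \<in> D" if "\<delta> \<le> dens k 0 D" for D
    using that 0 by (cases "[] \<in> D") (auto simp: avg_def w)
  then show ?case unfolding DHJ_subspaces_def
    by (intro exI[of _ 0] allI impI exI[of _ "[]"]) (auto simp: is_template_def w inst_def)
next
  case (Suc d)
  obtain n1 where n1: "\<And>D. \<delta> / 2 \<le> dens k n1 D \<Longrightarrow>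
     (\<exists>w\<in>words (Suc k) n1. k \<in> set w \<and> (\<forall>i<k. fill k i w \<in> D))"
    using dhj[of "\<delta> / 2"] Suc.prems unfolding DHJ_def by auto
  define \<theta> where "\<theta> = \<delta> / 2 / real (Suc k ^ n1)"
  have \<theta>: "\<theta> > 0" using Suc.prems by (simp add: \<theta>_def)
  obtain n2 where n2: "\<And>D. \<theta> \<le> dens k n2 D \<Longrightarrow>
     (\<exists>t. is_template k d n2 t \<and> (\<forall>x\<in>words k d. inst k t x \<in> D))"
    using Suc.IH[OF \<theta>] unfolding DHJ_subspaces_def by auto
  show ?case unfolding DHJ_subspaces_def
  proof (rule exI[of _ "n1 + n2"], intro allI impI)
    fix D assume D: "\<delta> \<le> dens k (n1 + n2) D"
    define f where "f y = dens k n1 {u. u @ y \<in> D}" for y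
    have "\<delta> \<le> avg k n2 f"
      using D unfolding dens_append2 f_def .
    then have R: "\<delta> / 2 \<le> dens k n2 {y. \<delta> / 2 \<le> f y}"
      using dens_reverse_markov[of k n2 f \<delta>] k Suc.prems dens_le_1[OF k] by (auto simp: f_def)
    have "\<exists>w\<in>words (Suc k) n1. \<theta> \<le> dens k n2 {y. k \<in> set w \<and> (\<forall>i<k. fill k i w @ y \<in> D)}"
    proof (rule dens_pigeonhole[where A = "{y. \<delta> / 2 \<le> f y}"])
      show "\<exists>w\<in>words (Suc k) n1. y \<in> {y. k \<in> set w \<and> (\<forall>i<k. fill k i w @ y \<in> D)}"
        if "y \<in> {y. \<delta> / 2 \<le> f y}" for y
        using n1[of "{u. u @ y \<in> D}"] that by (auto simp: f_def)
      show "words (Suc k) n1 \<noteq> {}" using words_ne[of "Suc k"] by simp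
      show "\<theta> * real (card (words (Suc k) n1)) \<le> dens k n2 {y. \<delta> / 2 \<le> f y}"
        using R by (simp add: \<theta>_def)
    qed (use \<theta> in auto)
    then obtain w where w: "w \<in> words (Suc k) n1"
      "\<theta> \<le> dens k n2 {y. k \<in> set w \<and> (\<forall>i<k. fill k i w @ y \<in> D)}" by blast
    obtain t where t: "is_template k d n2 t"
      "\<forall>x\<in>words k d. inst k t x \<in> {y. k \<in> set w \<and> (\<forall>i<k. fill k i w @ y \<in> D)}"
      using n2[OF w(2)] by blast
    have "replicate d 0 \<in> words k d" using k by (auto simp: words_def)
    then have kw: "k \<in> set w" using t(2) by blast
    define s where "s = w @ map (\<lambda>a. if a < k then a else Suc a) t"
    have "is_template k (Suc d) (n1 + n2) s"
    proof -
      have "{k..<k + Suc d} \<subseteq> set s"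
      proof
        fix b assume b: "b \<in> {k..<k + Suc d}"
        show "b \<in> set s"
        proof (cases "b = k")
          case False
          then obtain c where c: "b = Suc c" "k \<le> c" "c < k + d" using b by (cases b) auto
          then have "c \<in> set t" using t(1) by (auto simp: is_template_def)
          then have "b \<in> (\<lambda>a. if a < k then a else Suc a) ` set t" using c by (intro image_eqI[of _ _ c]) auto
          then show ?thesis by (simp add: s_def)
        qed (use kw in \<open>simp add: s_def\<close>)
      qed
      moreover have "set s \<subseteq> {..<k + Suc d}"
        using w(1) t(1) by (fastforce simp: s_def words_def is_template_def subset_iff)
      ultimately show ?thesis using w(1) t(1) by (auto simp: is_template_def s_def words_def)
    qed
    moreover have "inst k s x \<in> D" if x: "x \<in> words k (Suc d)" for x
    proof -
      obtain i y where iy: "x = i # y" "i < k" "y \<in> words k d"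
        using x by (auto simp: words_def length_Suc_conv)
      have "inst k w x = fill k i w"
        using w(1) iy by (auto simp: inst_def fill_def words_def subset_iff less_Suc_eq)
      moreover have "inst k (map (\<lambda>a. if a < k then a else Suc a) t) x = inst k t y"
        using iy by (auto simp: inst_def Suc_diff_le)
      ultimately have "inst k s x = fill k i w @ inst k t y" by (simp add: s_def inst_append)
      then show ?thesis using t(2) iy by auto
    qed
    ultimately show "\<exists>t. is_template k (Suc d) (n1 + n2) t \<and> (\<forall>x\<in>words k (Suc d). inst k t x \<in> D)"
      by blast
  qed
qed

text \<open>After fixing a suitable prefix \<open>u\<close>, fixing any \<open>m\<close> further letters \<open>y\<close> hardly lowers the density. The
reason is an energy argument: the largest density \<open>s j\<close> over prefixes of length \<open>j * m\<close> increases with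
\<open>j\<close> and is at most \<open>1\<close>, so it is almost stationary at some \<open>j\<close>. There no extension of the best prefix is
much denser than average, and so none is much thinner.

This replaces all comparisons of measures on words: \<open>y\<close> may follow any distribution afterwards, for
instance that of words avoiding the letter \<open>k\<close>.\<close>

lemma uniform_prefix:
  assumes k: "k \<ge> 1" and \<epsilon>: "\<epsilon> > 0"
  shows "\<exists>T. \<forall>n\<ge>T. \<forall>D. \<exists>l u. l + m \<le> T \<and> u \<in> words k l \<and> dens k n D \<le> dens k (n - l) {z. u @ z \<in> D} \<and>
     (\<forall>y\<in>words k m. dens k (n - l) {z. u @ z \<in> D} - \<epsilon> \<le> dens k (n - (l + m)) {z. u @ y @ z \<in> D})"
proof -
  define N where "N = nat \<lceil>real (k ^ m) / \<epsilon>\<rceil> + 1"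
  have N: "real (k ^ m) \<le> \<epsilon> * N"
  proof -
    have "real (k ^ m) / \<epsilon> \<le> N" unfolding N_def by linarith
    then show ?thesis using \<epsilon> by (simp only: pos_divide_le_eq) (simp add: mult.commute)
  qed
  have N0: "N > 0" by (simp add: N_def)
  show ?thesis
  proof (rule exI[of _ "N * m"], intro allI impI)
    fix n D assume n: "N * m \<le> n"
    define g where "g j u = dens k (n - j * m) {z. u @ z \<in> D}" for j u
    define s where "s j = Max (g j ` words k (j * m))" for j
    have ne: "words k j \<noteq> {}" for j using words_ne[OF k] .
    have s_ub: "g j u \<le> s j" if "u \<in> words k (j * m)" for j u
      unfolding s_def using that by (intro Max_ge) auto
    have s_ex: "\<exists>u\<in>words k (j * m). g j u = s j" for j
    proof -
      have "s j \<in> g j ` words k (j * m)" unfolding s_def by (intro Max_in) (use ne in auto)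
      then show ?thesis by auto
    qed
    have s1: "s j \<le> 1" for j using s_ex[of j] dens_le_1[OF k] unfolding g_def by metis
    have s0: "dens k n D \<le> s 0" using s_ub[of "[]" 0] by (auto simp: g_def words_def)
    have split: "g j u = avg k m (\<lambda>y. g (Suc j) (u @ y))" if "j < N" for j u
    proof -
      have "Suc j * m \<le> N * m" using that by (intro mult_right_mono) auto
      then have "n - j * m = m + (n - Suc j * m)" using n by simp
      then show ?thesis unfolding g_def by (simp add: dens_append)
    qed
    have mono: "s j \<le> s (Suc j)" if "j < N" for j
    proof -
      obtain u where u: "u \<in> words k (j * m)" "g j u = s j" using s_ex by blast
      have "s j \<le> avg k m (\<lambda>y. g (Suc j) (u @ y))" using split[OF that, of u] u(2) by simp
      then obtain y where "y \<in> words k m" "s j \<le> g (Suc j) (u @ y)" using avg_le_ex[OF k] by blast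
      then show ?thesis using s_ub[of "u @ y" "Suc j"] words_append[OF u(1), of y m] by (simp add: add.commute)
    qed
    \<comment> \<open>Otherwise \<open>N\<close> increments larger than \<open>1 / N\<close> would push \<open>s\<close> above \<open>1\<close>.\<close>
    have "\<exists>j<N. s (Suc j) \<le> s j + 1 / N"
    proof (rule ccontr)
      assume "\<not> ?thesis"
      then have inc: "\<And>j. j < N \<Longrightarrow> s j + 1 / N < s (Suc j)" by force
      have "j \<le> N \<Longrightarrow> s 0 + j / N \<le> s j" for j
      proof (induction j)
        case (Suc j)
        then show ?case using inc[of j] by (simp add: add_divide_distrib)
      qed simp
      moreover have "s (Suc (N - 1)) > s (N - 1) + 1 / N" using inc[of "N - 1"] N0 by simp
      ultimately have "s 0 + (N - 1) / N + 1 / N < s N" using N0 by (smt (verit) Suc_diff_1 diff_le_self)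
      moreover have "(N - 1) / N + 1 / N = (1::real)" using N0 by (simp add: field_simps of_nat_diff)
      moreover have "s 0 \<ge> 0" using s0 dens_nonneg[of k n D] by linarith
      ultimately show False using s1[of N] by linarith
    qed
    then obtain j where j: "j < N" "s (Suc j) \<le> s j + 1 / N" by blast
    have s0j: "i \<le> N \<Longrightarrow> s 0 \<le> s i" for i
    proof (induction i)
      case (Suc i) then show ?case using mono[of i] by simp
    qed simp
    obtain u where u: "u \<in> words k (j * m)" "g j u = s j" using s_ex by blast
    have "g j u - \<epsilon> \<le> g (Suc j) (u @ y)" if y: "y \<in> words k m" for y
    proof -
      have ub: "g (Suc j) (u @ y') \<le> s j + 1 / N" if "y' \<in> words k m" for y'
        using s_ub[of "u @ y'" "Suc j"] words_append[OF u(1) that] j(2) by (simp add: add.commute)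
      have "s j * k ^ m = (\<Sum>y'\<in>words k m. g (Suc j) (u @ y'))"
        using split[OF j(1), of u] u(2) k by (simp add: avg_def)
      also have "\<dots> = g (Suc j) (u @ y) + (\<Sum>y'\<in>words k m - {y}. g (Suc j) (u @ y'))"
        using y by (simp add: sum.remove)
      also have "(\<Sum>y'\<in>words k m - {y}. g (Suc j) (u @ y')) \<le> (\<Sum>y'\<in>words k m - {y}. s j + 1 / N)"
        by (intro sum_mono ub) auto
      also have "\<dots> = (real (k ^ m) - 1) * (s j + 1 / N)"
        using y k by (simp add: card_Diff_singleton of_nat_diff)
      finally have "s j - (real (k ^ m) - 1) / N \<le> g (Suc j) (u @ y)" by (simp add: algebra_simps diff_divide_distrib)
      moreover have "(real (k ^ m) - 1) / N \<le> \<epsilon>" using N N0 by (simp add: field_simps)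
      ultimately show ?thesis using u(2) by linarith
    qed
    moreover have "j * m + m \<le> N * m" using j(1) mult_right_mono[of "Suc j" N m] by simp
    ultimately show "\<exists>l u. l + m \<le> N * m \<and> u \<in> words k l \<and> dens k n D \<le> dens k (n - l) {z. u @ z \<in> D} \<and>
     (\<forall>y\<in>words k m. dens k (n - l) {z. u @ z \<in> D} - \<epsilon> \<le> dens k (n - (l + m)) {z. u @ y @ z \<in> D})"
      using u s0 s0j[of j] j(1)
      by (intro exI[of _ "j * m"] exI[of _ u]) (auto simp: g_def add.commute)
  qed
qed

lemma inst_inj_on: "is_template k d n t \<Longrightarrow> inj_on (inst k t) (words k d)"
proof (rule inj_onI)
  fix x y assume t: "is_template k d n t" and x: "x \<in> words k d" and y: "y \<in> words k d" and eq: "inst k t x = inst k t y"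
  show "x = y"
  proof (rule nth_equalityI)
    fix j assume "j < length x"
    then have "j < d" using x by (simp add: words_def)
    then have "k + j \<in> set t" using t by (auto simp: is_template_def)
    then obtain p where p: "p < length t" "t ! p = k + j" by (auto simp: in_set_conv_nth)
    have "inst k t x ! p = inst k t y ! p" using eq by simp
    then show "x ! j = y ! j" using p by (simp add: inst_def)
  qed (use x y in \<open>simp add: words_def\<close>)
qed

lemma avg_on_subspace:
  assumes "k \<ge> 1" "is_template k d n t"
  shows "avg k n (\<lambda>v. G v * indicator (inst k t ` words k d) v) =
    real (k ^ d) / real (k ^ n) * avg k d (\<lambda>x. G (inst k t x))"
proof -
  have sub: "inst k t ` words k d \<subseteq> words k n" using inst_words[OF assms(2)] by auto
  have "(\<Sum>v\<in>words k n. G v * indicator (inst k t ` words k d) v) = (\<Sum>v\<in>inst k t ` words k d. G v)"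
    using sub by (intro sum.mono_neutral_cong_right) auto
  also have "\<dots> = (\<Sum>x\<in>words k d. G (inst k t x))"
    using inst_inj_on[OF assms(2)] by (simp add: sum.reindex)
  finally show ?thesis using assms(1) by (simp add: avg_def)
qed

section \<open>Insensitive sets\<close>

text \<open>A set with this property is determined by its words over \<open>k\<close> letters, and this is how the theorem for \<open>k\<close> letters is brought to bear on words over
\<open>Suc k\<close> letters.\<close>

definition insensitive :: "nat \<Rightarrow> nat \<Rightarrow> nat \<Rightarrow> nat list set \<Rightarrow> bool" where
  "insensitive k i n E \<longleftrightarrow> (\<forall>w\<in>words (Suc k) n. w \<in> E \<longleftrightarrow> fill k i w \<in> E)"

lemma fill_words_Suc: "w \<in> words (Suc k) n \<Longrightarrow> i < k \<Longrightarrow> fill k i w \<in> words (Suc k) n"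
  using fill_words[of w k n i] words_mono[of k "Suc k" n] by auto

lemma insensitiveD2:
  assumes "insensitive k i n E" "w \<in> words (Suc k) n" "w' \<in> words (Suc k) n" "fill k i w = fill k i w'"
  shows "w \<in> E \<longleftrightarrow> w' \<in> E"
  using assms unfolding insensitive_def by metis

lemma insensitive_subspace:
  assumes "insensitive k i n E" "is_template (Suc k) d n t" "i < k"
  shows "insensitive k i d {x. inst (Suc k) t x \<in> E}"
  unfolding insensitive_def mem_Collect_eq
proof (intro ballI insensitiveD2[OF assms(1)])
  fix x assume x: "x \<in> words (Suc k) d"
  show "inst (Suc k) t x \<in> words (Suc k) n" "inst (Suc k) t (fill k i x) \<in> words (Suc k) n"
    using inst_words[OF assms(2)] x fill_words_Suc[OF x assms(3)] by auto
  show "fill k i (inst (Suc k) t x) = fill k i (inst (Suc k) t (fill k i x))"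
    unfolding fill_def inst_def map_map
  proof (rule map_cong[OF refl])
    fix a assume "a \<in> set t"
    then have "a < Suc k + d" using assms(2) by (auto simp: is_template_def)
    then have "\<not> a < Suc k \<Longrightarrow> a - Suc k < length x" using x by (auto simp: words_def)
    then show "((\<lambda>a. if a = k then i else a) \<circ> (\<lambda>a. if a < Suc k then a else x ! (a - Suc k))) a =
      ((\<lambda>a. if a = k then i else a) \<circ> (\<lambda>a. if a < Suc k then a else map (\<lambda>a. if a = k then i else a) x ! (a - Suc k))) a"
      by simp
  qed
qed

lemma fill_inst_shift:
  assumes t: "is_template k d n t" and i: "i < k" and x: "x \<in> words (Suc k) d"
  shows "fill k i (inst (Suc k) (map (\<lambda>a. if a < k then a else Suc a) t) x) = fill k i (inst k t (fill k i x))"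
  using subspace_shift(2)[OF t i x] fill_id[OF inst_words[OF t fill_words[OF x i]]] by simp

text \<open>From a dense insensitive set \<open>E\<close> one can remove a part \<open>R\<close> of density bounded below that is a disjoint
union of \<open>d\<close>-dimensional subspaces, one for each tail \<open>z\<close> in a dense set; so a function whose average
over every subspace is at most \<open>e\<close> has average at most \<open>e\<close> over \<open>R\<close> too. The subspace chosen for \<open>z\<close>
depends only on which templates fit, hence not on turning \<open>k\<close> into \<open>i\<close> within \<open>z\<close>. Therefore what
remains is, for each fixed head \<open>v\<close>, again insensitive in the tail, and the removal can be repeated.\<close>

lemma insensitive_remove:
  assumes k: "k \<ge> 1" and M: "\<And>\<delta>. \<delta> > 0 \<Longrightarrow> DHJ_subspaces k d \<delta>" and \<eta>: "\<eta> > 0"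
  defines "K \<equiv> Suc k"
  shows "\<exists>c>0. \<exists>T. \<forall>n\<ge>T. \<forall>i<k. \<forall>E. insensitive k i n E \<longrightarrow> \<eta> \<le> dens K n E \<longrightarrow>
   (\<exists>l\<le>T. \<exists>R. (\<forall>w\<in>words K n. w \<in> R \<longrightarrow> w \<in> E) \<and>
     (\<forall>v\<in>words K l. insensitive k i (n - l) {z. v @ z \<in> E - R}) \<and> c \<le> dens K n R \<and>
     (\<forall>F e. (\<forall>t. is_template K d n t \<longrightarrow> avg K d (\<lambda>x. F (inst K t x)) \<le> e) \<longrightarrow>
        avg K n (\<lambda>w. F w * indicator R w) \<le> e * dens K n R))"
proof -
  have K: "K \<ge> 1" by (simp add: K_def)
  obtain m where m: "\<And>D. \<eta> / 4 \<le> dens k m D \<Longrightarrow> \<exists>t. is_template k d m t \<and> (\<forall>x\<in>words k d. inst k t x \<in> D)"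
    using M[of "\<eta> / 4"] \<eta> unfolding DHJ_subspaces_def by auto
  obtain T where T: "\<forall>n\<ge>T. \<forall>D. \<exists>l u. l + m \<le> T \<and> u \<in> words K l \<and> dens K n D \<le> dens K (n - l) {z. u @ z \<in> D} \<and>
     (\<forall>y\<in>words K m. dens K (n - l) {z. u @ z \<in> D} - \<eta> / 2 \<le> dens K (n - (l + m)) {z. u @ y @ z \<in> D})"
    using uniform_prefix[OF K half_gt_zero[OF \<eta>], of m] by blast
  define c where "c = \<eta> / 4 / real (K ^ T)"
  have c: "c > 0" using \<eta> K by (simp add: c_def)
  show ?thesis
  proof (rule exI[of _ c], rule conjI[OF c], rule exI[of _ T], intro allI impI)
    fix n i E assume n: "T \<le> n" and i: "i < k" and E: "insensitive k i n E" and dE: "\<eta> \<le> dens K n E"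
    obtain l0 u where l0: "l0 + m \<le> T" and u: "u \<in> words K l0" and d0: "\<eta> \<le> dens K (n - l0) {z. u @ z \<in> E}"
      and dy: "\<And>y. y \<in> words K m \<Longrightarrow> dens K (n - l0) {z. u @ z \<in> E} - \<eta> / 2 \<le> dens K (n - (l0 + m)) {z. u @ y @ z \<in> E}"
      using T[rule_format, OF n, of E] order_trans[OF dE] by blast
    define l where "l = l0 + m"
    have lT: "l \<le> T" "l \<le> n" using l0 n by (auto simp: l_def)
    define P where "P z t \<longleftrightarrow> is_template K d l t \<and> (\<forall>x\<in>words K d. inst K t x @ z \<in> E)" for z t
    define S where "S = {z. \<exists>t. P z t}"
    define \<tau> where "\<tau> z = (SOME t. P z t)" for z
    define R where "R = {w. drop l w \<in> S \<and> take l w \<in> inst K (\<tau> (drop l w)) ` words K d}"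
    have \<tau>: "P z (\<tau> z)" if "z \<in> S" for z
      using that unfolding S_def \<tau>_def by (auto intro: someI_ex)
    have Rapp: "v @ z \<in> R \<longleftrightarrow> z \<in> S \<and> v \<in> inst K (\<tau> z) ` words K d" if "v \<in> words K l" for v z
      using that by (simp add: R_def words_def)
    have Papp: "v @ z \<in> E" if "z \<in> S" "v \<in> inst K (\<tau> z) ` words K d" for v z
      using \<tau>[OF that(1)] that(2) by (auto simp: P_def)
    have nl: "n = l + (n - l)" using lT by simp
    \<comment> \<open>If the words over \<open>k\<close> letters between \<open>u\<close> and \<open>z\<close> meet \<open>E\<close> densely, they contain a subspace
      over \<open>k\<close> letters, and insensitivity extends it to one over \<open>Suc k\<close> letters.\<close>
    have SS: "z \<in> S" if z: "z \<in> words K (n - l)" and dz: "\<eta> / 4 \<le> dens k m {y. u @ y @ z \<in> E}" for z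
    proof -
      obtain t0 where t0: "is_template k d m t0" "\<And>x. x \<in> words k d \<Longrightarrow> u @ inst k t0 x @ z \<in> E"
        using m[OF dz] by auto
      define s where "s = map (\<lambda>a. if a < k then a else Suc a) t0"
      have s: "is_template K d m s" using subspace_shift(1)[OF t0(1)] by (simp add: s_def K_def)
      have us: "is_template K d l (u @ s)" "\<And>x. inst K (u @ s) x = u @ inst K s x"
        using subspace_prefix[OF u s, of "[]" 0] by (auto simp: words_def l_def)
      have "inst K (u @ s) x @ z \<in> E" if x: "x \<in> words K d" for x
      proof -
        have x': "fill k i x \<in> words k d" using fill_words x i by (simp add: K_def)
        have "u @ inst K s x @ z \<in> E \<longleftrightarrow> u @ inst k t0 (fill k i x) @ z \<in> E"
        proof (rule insensitiveD2[OF E])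
          have app: "u @ y @ z \<in> words (Suc k) n" if "y \<in> words K m" for y
            using words_append[OF u words_append[OF that z]] lT by (simp add: l_def K_def)
          show "u @ inst K s x @ z \<in> words (Suc k) n" by (intro app inst_words[OF s x])
          have "inst k t0 (fill k i x) \<in> words K m"
            using inst_words[OF t0(1) x'] words_mono[of k K m] by (auto simp: K_def)
          then show "u @ inst k t0 (fill k i x) @ z \<in> words (Suc k) n"
            by (rule app)
          show "fill k i (u @ inst K s x @ z) = fill k i (u @ inst k t0 (fill k i x) @ z)"
            using fill_inst_shift[OF t0(1) i, of x] x by (simp add: s_def K_def)
        qed
        then show ?thesis using t0(2)[OF x'] us(2) by simp
      qed
      then show ?thesis using us(1) by (auto simp: S_def P_def)
    qed
    have "\<eta> / 2 \<le> avg k m (\<lambda>y. dens K (n - l) {z. u @ y @ z \<in> E})"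
    proof -
      have "avg k m (\<lambda>y. \<eta> / 2) \<le> avg k m (\<lambda>y. dens K (n - l) {z. u @ y @ z \<in> E})"
      proof (rule avg_mono)
        fix y assume "y \<in> words k m"
        then have "y \<in> words K m" using words_mono[of k K m] by (auto simp: K_def)
        then show "\<eta> / 2 \<le> dens K (n - l) {z. u @ y @ z \<in> E}" using dy[of y] d0 by (simp add: l_def)
      qed
      then show ?thesis using k by simp
    qed
    also have "\<dots> = avg K (n - l) (\<lambda>z. dens k m {y. u @ y @ z \<in> E})"
    proof -
      have "avg k m (\<lambda>y. avg K (n - l) (\<lambda>z. indicator E (u @ y @ z))) = avg K (n - l) (\<lambda>z. avg k m (\<lambda>y. indicator E (u @ y @ z)))"
        by (rule avg_swap)
      moreover have "(\<lambda>z. indicat_real E (u @ y @ z)) = indicator {z. u @ y @ z \<in> E}" for y by (auto simp: indicator_def)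
      moreover have "(\<lambda>y. indicat_real E (u @ y @ z)) = indicator {y. u @ y @ z \<in> E}" for z by (auto simp: indicator_def)
      ultimately show ?thesis by simp
    qed
    finally have "\<eta> / 2 / 2 \<le> dens K (n - l) {z. \<eta> / 2 / 2 \<le> dens k m {y. u @ y @ z \<in> E}}"
      using dens_reverse_markov[OF K, of "n - l" "\<lambda>z. dens k m {y. u @ y @ z \<in> E}" "\<eta> / 2"] dens_le_1[OF k] \<eta> by simp
    also have "\<dots> \<le> dens K (n - l) S" by (rule dens_mono) (use SS in auto)
    finally have dS: "\<eta> / 4 \<le> dens K (n - l) S" by simp
    define \<kappa> where "\<kappa> = real (K ^ d) / real (K ^ l)"
    have avgR: "avg K n (\<lambda>w. F w * indicator R w) = avg K (n - l) (\<lambda>z. indicator S z * (\<kappa> * avg K d (\<lambda>x. F (inst K (\<tau> z) x @ z))))" for F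
    proof -
      have "avg K n (\<lambda>w. F w * indicator R w) = avg K (n - l) (\<lambda>z. avg K l (\<lambda>v. F (v @ z) * indicator R (v @ z)))"
        by (subst nl, subst avg_append, rule avg_swap)
      also have "\<dots> = avg K (n - l) (\<lambda>z. indicator S z * (\<kappa> * avg K d (\<lambda>x. F (inst K (\<tau> z) x @ z))))"
      proof (rule avg_cong)
        fix z assume z: "z \<in> words K (n - l)"
        have "avg K l (\<lambda>v. F (v @ z) * indicator R (v @ z)) = 
          avg K l (\<lambda>v. indicator S z * (F (v @ z) * indicator (inst K (\<tau> z) ` words K d) v))"
          by (rule avg_cong) (simp add: Rapp indicator_def)
        also have "\<dots> = indicator S z * avg K l (\<lambda>v. F (v @ z) * indicator (inst K (\<tau> z) ` words K d) v)"
          by (rule avg_cmult)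
        also have "\<dots> = indicator S z * (\<kappa> * avg K d (\<lambda>x. F (inst K (\<tau> z) x @ z)))"
        proof (cases "z \<in> S")
          case True
          then have "is_template K d l (\<tau> z)" using \<tau> by (auto simp: P_def)
          then show ?thesis using avg_on_subspace[OF K, of d l "\<tau> z" "\<lambda>v. F (v @ z)"] by (simp add: \<kappa>_def)
        qed simp
        finally show "avg K l (\<lambda>v. F (v @ z) * indicator R (v @ z)) = \<dots>" .
      qed
      finally show ?thesis .
    qed
    have densR: "dens K n R = \<kappa> * dens K (n - l) S"
      using avgR[of "\<lambda>_. 1"] K by (simp add: avg_cmult mult.commute)
    have "c \<le> dens K n R"
    proof -
      have "1 / real (K ^ T) \<le> 1 / real (K ^ l)" using lT K by (intro divide_left_mono) (auto intro: power_increasing)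
      also have "\<dots> \<le> \<kappa>" unfolding \<kappa>_def using K by (intro divide_right_mono) auto
      finally have "1 / real (K ^ T) * (\<eta> / 4) \<le> \<kappa> * dens K (n - l) S"
        using dS \<eta> by (intro mult_mono) (auto simp: \<kappa>_def)
      then show ?thesis by (simp add: densR c_def mult.commute)
    qed
    moreover have "\<forall>w\<in>words K n. w \<in> R \<longrightarrow> w \<in> E"
    proof (intro ballI impI)
      fix w assume "w \<in> words K n" "w \<in> R"
      then have "take l w @ drop l w \<in> E" by (intro Papp) (auto simp: R_def)
      then show "w \<in> E" by simp
    qed
    moreover have "\<forall>v\<in>words K l. insensitive k i (n - l) {z. v @ z \<in> E - R}"
    proof
      fix v assume v: "v \<in> words K l"
      have Eq: "v' @ z \<in> E \<longleftrightarrow> v' @ fill k i z \<in> E" if "z \<in> words K (n - l)" "v' \<in> words K l" for v' z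
        using that fill_words_Suc[of z k "n - l" i] i words_append[of v' K l z "n - l"] words_append[of v' K l "fill k i z" "n - l"] lT
        by (intro insensitiveD2[OF E]) (auto simp: K_def fill_fill)
      have PP: "P z = P (fill k i z)" if "z \<in> words K (n - l)" for z
        using Eq[OF that] inst_words[of K d l] by (auto simp: P_def fun_eq_iff)
      show "insensitive k i (n - l) {z. v @ z \<in> E - R}"
        unfolding insensitive_def
      proof
        fix z assume z: "z \<in> words (Suc k) (n - l)"
        then have "P z = P (fill k i z)" using PP by (simp add: K_def)
        then have "\<tau> z = \<tau> (fill k i z)" "z \<in> S \<longleftrightarrow> fill k i z \<in> S" by (auto simp: \<tau>_def S_def)
        then show "z \<in> {z. v @ z \<in> E - R} \<longleftrightarrow> fill k i z \<in> {z. v @ z \<in> E - R}"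
          using Eq[of z v] z v Rapp[OF v] by (simp add: K_def)
      qed
    qed
    moreover have "avg K n (\<lambda>w. F w * indicator R w) \<le> e * dens K n R"
      if F: "\<forall>t. is_template K d n t \<longrightarrow> avg K d (\<lambda>x. F (inst K t x)) \<le> e" for F e
    proof -
      have "avg K n (\<lambda>w. F w * indicator R w) \<le> avg K (n - l) (\<lambda>z. (e * \<kappa>) * indicator S z)"
        unfolding avgR
      proof (rule avg_mono)
        fix z assume z: "z \<in> words K (n - l)"
        show "indicator S z * (\<kappa> * avg K d (\<lambda>x. F (inst K (\<tau> z) x @ z))) \<le> e * \<kappa> * indicator S z"
        proof (cases "z \<in> S")
          case True
          then have s: "is_template K d l (\<tau> z)" using \<tau> by (auto simp: P_def)
          have "is_template K d n (\<tau> z @ z)" "\<And>x. inst K (\<tau> z @ z) x = inst K (\<tau> z) x @ z"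
            using subspace_prefix[OF _ s z, of "[]" 0] lT by (auto simp: words_def)
          then have "avg K d (\<lambda>x. F (inst K (\<tau> z) x @ z)) \<le> e" using F by force
          then have "\<kappa> * avg K d (\<lambda>x. F (inst K (\<tau> z) x @ z)) \<le> \<kappa> * e"
            by (intro mult_left_mono) (auto simp: \<kappa>_def)
          then show ?thesis using True by (simp add: mult.commute)
        qed simp
      qed
      also have "\<dots> = e * dens K n R" by (simp add: avg_cmult densR)
      finally show ?thesis .
    qed
    ultimately show "\<exists>l\<le>T. \<exists>R. (\<forall>w\<in>words K n. w \<in> R \<longrightarrow> w \<in> E) \<and>
     (\<forall>v\<in>words K l. insensitive k i (n - l) {z. v @ z \<in> E - R}) \<and> c \<le> dens K n R \<and>
     (\<forall>F e. (\<forall>t. is_template K d n t \<longrightarrow> avg K d (\<lambda>x. F (inst K t x)) \<le> e) \<longrightarrow>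
        avg K n (\<lambda>w. F w * indicator R w) \<le> e * dens K n R)"
      using lT by blast
  qed
qed

text \<open>Iterating \<open>insensitive_remove\<close> exhausts an insensitive set by disjoint subspaces up to a small rest:
each round shrinks what is left by the factor \<open>q < 1\<close>, unless its density is already below \<open>\<eta> / 2\<close>. The
statement speaks of averages instead of a partition, so that nothing has to be said about how the
pieces, which live over different heads, fit together.\<close>

lemma insensitive_avg:
  assumes k: "k \<ge> 1" and M: "\<And>\<delta>. \<delta> > 0 \<Longrightarrow> DHJ_subspaces k d \<delta>" and \<eta>: "\<eta> > 0"
  defines "K \<equiv> Suc k"
  shows "\<exists>N. \<forall>n\<ge>N. \<forall>i<k. \<forall>E F e. insensitive k i n E \<longrightarrow> (\<forall>w. F w \<le> 1) \<longrightarrow> 0 \<le> e \<longrightarrow>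
     (\<forall>t. is_template K d n t \<longrightarrow> avg K d (\<lambda>x. F (inst K t x)) \<le> e) \<longrightarrow>
     avg K n (\<lambda>w. F w * indicator E w) \<le> e + \<eta>"
proof -
  have K: "K \<ge> 1" by (simp add: K_def)
  obtain c T where c: "c > 0" and T: "\<forall>n\<ge>T. \<forall>i<k. \<forall>E. insensitive k i n E \<longrightarrow> \<eta> / 2 \<le> dens K n E \<longrightarrow>
   (\<exists>l\<le>T. \<exists>R. (\<forall>w\<in>words K n. w \<in> R \<longrightarrow> w \<in> E) \<and>
     (\<forall>v\<in>words K l. insensitive k i (n - l) {z. v @ z \<in> E - R}) \<and> c \<le> dens K n R \<and>
     (\<forall>F e. (\<forall>t. is_template K d n t \<longrightarrow> avg K d (\<lambda>x. F (inst K t x)) \<le> e) \<longrightarrow>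
        avg K n (\<lambda>w. F w * indicator R w) \<le> e * dens K n R))"
    using insensitive_remove[OF k M half_gt_zero[OF \<eta>]] unfolding K_def by blast
  define q where "q = max 0 (1 - c)"
  have q: "0 \<le> q" "q < 1" "1 - c \<le> q" using c by (auto simp: q_def)
  have le_dens: "avg K n (\<lambda>w. F w * indicator E w) \<le> dens K n E" if "\<And>w. F w \<le> 1" for n E F
    using that by (intro avg_mono) (auto simp: indicator_def)
  have claim: "avg K n (\<lambda>w. F w * indicator E w) \<le> e * dens K n E + \<eta> / 2 + q ^ s * dens K n E"
    if "s * T \<le> n" "i < k" "insensitive k i n E" "\<And>w. F w \<le> 1" "0 \<le> e"
      "\<And>t. is_template K d n t \<Longrightarrow> avg K d (\<lambda>x. F (inst K t x)) \<le> e" for s n i E F e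
    using that
  proof (induction s arbitrary: n E F)
    case 0
    have "0 \<le> e * dens K n E" using 0 dens_nonneg by simp
    then show ?case using le_dens[of F n E, OF 0(4)] \<eta> by simp
  next
    case (Suc s)
    have nn: "0 \<le> e * dens K n E" "0 \<le> q ^ Suc s * dens K n E" using Suc.prems q dens_nonneg[of K n E] by simp_all
    show ?case
    proof (cases "\<eta> / 2 \<le> dens K n E")
      case False
      then show ?thesis using le_dens[of F n E, OF Suc.prems(4)] nn by linarith
    next
      case True
      have "T \<le> n" using Suc.prems(1) by simp
      from T[rule_format, OF this Suc.prems(2,3) True] obtain l R where l: "l \<le> T"
        and RE: "\<forall>w\<in>words K n. w \<in> R \<longrightarrow> w \<in> E"
        and ins: "\<forall>v\<in>words K l. insensitive k i (n - l) {z. v @ z \<in> E - R}" and cR: "c \<le> dens K n R"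
        and FR0: "\<forall>F e. (\<forall>t. is_template K d n t \<longrightarrow> avg K d (\<lambda>x. F (inst K t x)) \<le> e) \<longrightarrow>
          avg K n (\<lambda>w. F w * indicator R w) \<le> e * dens K n R"
        by blast
      have FR: "avg K n (\<lambda>w. F w * indicator R w) \<le> e * dens K n R"
        by (rule FR0[rule_format]) (rule Suc.prems(6))
      have nl: "l + (n - l) = n" and sT: "s * T \<le> n - l" using l Suc.prems(1) \<open>T \<le> n\<close> by auto
      have split: "avg K n (\<lambda>w. G w * indicator E w) = avg K n (\<lambda>w. G w * indicator R w) + avg K n (\<lambda>w. G w * indicator (E - R) w)" for G
        unfolding avg_add[symmetric] by (rule avg_cong) (use RE in \<open>auto simp: indicator_def\<close>)
      have dE: "dens K n E = dens K n R + dens K n (E - R)" using split[of "\<lambda>_. 1"] by simp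
      have "avg K n (\<lambda>w. F w * indicator (E - R) w) = avg K l (\<lambda>v. avg K (n - l) (\<lambda>z. F (v @ z) * indicator {z. v @ z \<in> E - R} z))"
        by (subst nl[symmetric], subst avg_append) (simp add: indicator_def)
      also have "\<dots> \<le> avg K l (\<lambda>v. (e + q ^ s) * dens K (n - l) {z. v @ z \<in> E - R} + \<eta> / 2)"
      proof (rule avg_mono)
        fix v assume v: "v \<in> words K l"
        have "avg K (n - l) (\<lambda>z. F (v @ z) * indicator {z. v @ z \<in> E - R} z) \<le> e * dens K (n - l) {z. v @ z \<in> E - R} + \<eta> / 2 + q ^ s * dens K (n - l) {z. v @ z \<in> E - R}"
        proof (rule Suc.IH[OF sT Suc.prems(2) ins[rule_format, OF v] _ Suc.prems(5)])
          fix t assume t: "is_template K d (n - l) t"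
          have "is_template K d n (v @ t)" "\<And>x. inst K (v @ t) x = v @ inst K t x"
            using subspace_prefix[OF v t, of "[]" 0] nl by (auto simp: words_def)
          then show "avg K d (\<lambda>x. F (v @ inst K t x)) \<le> e" using Suc.prems(6) by force
        qed (use Suc.prems in auto)
        then show "avg K (n - l) (\<lambda>z. F (v @ z) * indicator {z. v @ z \<in> E - R} z) \<le> (e + q ^ s) * dens K (n - l) {z. v @ z \<in> E - R} + \<eta> / 2"
          by (simp add: algebra_simps)
      qed
      also have "\<dots> = (e + q ^ s) * dens K n (E - R) + \<eta> / 2"
        using K dens_append[of K l "n - l" "E - R"] nl by (simp add: avg_add avg_cmult)
      finally have 1: "avg K n (\<lambda>w. F w * indicator (E - R) w) \<le> (e + q ^ s) * dens K n (E - R) + \<eta> / 2" .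
      have "dens K n (E - R) \<le> q * dens K n E"
      proof -
        have "dens K n (E - R) \<le> dens K n E - c * 1" using dE cR by simp
        also have "\<dots> \<le> dens K n E - c * dens K n E" using c dens_le_1[OF K, of n E] by simp
        also have "\<dots> = (1 - c) * dens K n E" by (simp add: algebra_simps)
        also have "\<dots> \<le> q * dens K n E" using q dens_nonneg by (intro mult_right_mono)
        finally show ?thesis .
      qed
      then have "q ^ s * dens K n (E - R) \<le> q ^ s * (q * dens K n E)" using q by (intro mult_left_mono) auto
      then show ?thesis using 1 FR split[of F] dE by (simp add: algebra_simps)
    qed
  qed
  obtain s where s: "q ^ s < \<eta> / 2" using real_arch_pow_inv[of "\<eta> / 2" q] \<eta> q by auto
  show ?thesis
  proof (rule exI[of _ "s * T"], intro allI impI)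
    fix n i E F e assume a: "s * T \<le> n" "i < k" "insensitive k i n E" "\<forall>w. F w \<le> (1::real)" "0 \<le> (e::real)"
      "\<forall>t. is_template K d n t \<longrightarrow> avg K d (\<lambda>x. F (inst K t x)) \<le> e"
    have "avg K n (\<lambda>w. F w * indicator E w) \<le> e * dens K n E + \<eta> / 2 + q ^ s * dens K n E"
      using claim a by blast
    also have "\<dots> \<le> e * 1 + \<eta> / 2 + \<eta> / 2 * 1"
      using a(5) s q \<eta> dens_le_1[OF K, of n E] dens_nonneg[of K n E] by (intro add_mono mult_mono) auto
    finally show "avg K n (\<lambda>w. F w * indicator E w) \<le> e + \<eta>" by simp
  qed
qed

text \<open>For an intersection of sets insensitive to different letters the same holds, by induction on their
number. Cutting \<open>F\<close> down to the last set keeps its averages over subspaces of a large dimension \<open>d'\<close>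
small, by \<open>insensitive_avg\<close> inside each of them, because an insensitive set remains so when restricted
to a subspace. The induction hypothesis for \<open>d'\<close> then deals with the other sets.\<close>

lemma insensitive_Int_avg:
  assumes k: "k \<ge> 1" and M: "\<And>d \<delta>. \<delta> > 0 \<Longrightarrow> DHJ_subspaces k d \<delta>"
  defines "K \<equiv> Suc k"
  shows "j \<le> k \<Longrightarrow> \<eta> > 0 \<Longrightarrow> \<exists>N. \<forall>n\<ge>N. \<forall>C F e. (\<forall>i<j. insensitive k i n (C i)) \<longrightarrow> (\<forall>w. F w \<le> 1) \<longrightarrow> 0 \<le> e \<longrightarrow>
     (\<forall>t. is_template K d n t \<longrightarrow> avg K d (\<lambda>x. F (inst K t x)) \<le> e) \<longrightarrow>
     avg K n (\<lambda>w. F w * indicator (\<Inter>i<j. C i) w) \<le> e + \<eta>"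
proof (induction j arbitrary: d \<eta>)
  have K: "K \<ge> 1" by (simp add: K_def)
  case 0
  show ?case
  proof (rule exI[of _ d], intro allI impI)
    fix n and C :: "nat \<Rightarrow> nat list set" and F e assume n: "d \<le> n" and F: "\<forall>t. is_template K d n t \<longrightarrow> avg K d (\<lambda>x. F (inst K t x)) \<le> (e::real)"
    have "avg K n F = avg K (n - d) (\<lambda>v. avg K d (\<lambda>x. F (v @ x)))"
      using avg_append[of K "n - d" d F] n by simp
    also have "\<dots> \<le> avg K (n - d) (\<lambda>v. e)"
    proof (rule avg_mono)
      fix v assume v: "v \<in> words K (n - d)"
      have s: "is_template K d d [K..<K + d]" by (auto simp: is_template_def)
      have "is_template K d n (v @ [K..<K + d])" "\<And>x. inst K (v @ [K..<K + d]) x = v @ inst K [K..<K + d] x"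
        using subspace_prefix[OF v s, of "[]" 0] n by (auto simp: words_def)
      moreover have "inst K [K..<K + d] x = x" if "x \<in> words K d" for x
        using that by (auto simp: inst_def words_def intro!: nth_equalityI)
      ultimately show "avg K d (\<lambda>x. F (v @ x)) \<le> e"
        using F avg_cong[of K d "\<lambda>x. F (v @ x)" "\<lambda>x. F (inst K (v @ [K..<K + d]) x)"] by force
    qed
    finally show "avg K n (\<lambda>w. F w * indicator (\<Inter>i<0. C i) w) \<le> e + \<eta>" using K 0 by simp
  qed
next
  case (Suc j)
  have K: "K \<ge> 1" by (simp add: K_def)
  obtain d' where d': "\<forall>n\<ge>d'. \<forall>i<k. \<forall>E F e. insensitive k i n E \<longrightarrow> (\<forall>w. F w \<le> 1) \<longrightarrow> 0 \<le> e \<longrightarrow>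
     (\<forall>t. is_template K d n t \<longrightarrow> avg K d (\<lambda>x. F (inst K t x)) \<le> e) \<longrightarrow>
     avg K n (\<lambda>w. F w * indicator E w) \<le> e + \<eta> / 2"
    using insensitive_avg[OF k M half_gt_zero[OF Suc.prems(2)]] unfolding K_def by blast
  obtain N where N: "\<forall>n\<ge>N. \<forall>C F e. (\<forall>i<j. insensitive k i n (C i)) \<longrightarrow> (\<forall>w. F w \<le> 1) \<longrightarrow> 0 \<le> e \<longrightarrow>
     (\<forall>t. is_template K d' n t \<longrightarrow> avg K d' (\<lambda>x. F (inst K t x)) \<le> e) \<longrightarrow>
     avg K n (\<lambda>w. F w * indicator (\<Inter>i<j. C i) w) \<le> e + \<eta> / 2"
    using Suc.IH[OF _ half_gt_zero[OF Suc.prems(2)], of d'] Suc.prems(1) unfolding K_def by auto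
  show ?case
  proof (rule exI[of _ N], intro allI impI)
    fix n C F e assume n: "N \<le> n" and C: "\<forall>i<Suc j. insensitive k i n (C i)" and F1: "\<forall>w. F w \<le> (1::real)" and e: "0 \<le> (e::real)"
      and F: "\<forall>t. is_template K d n t \<longrightarrow> avg K d (\<lambda>x. F (inst K t x)) \<le> e"
    define G where "G w = F w * indicator (C j) w" for w
    have "avg K n (\<lambda>w. G w * indicator (\<Inter>i<j. C i) w) \<le> (e + \<eta> / 2) + \<eta> / 2"
    proof (rule N[rule_format, OF n])
      show "insensitive k i n (C i)" if "i < j" for i using C that by simp
      show "G w \<le> 1" for w using F1 by (simp add: G_def indicator_def)
      show "0 \<le> e + \<eta> / 2" using e Suc.prems by simp
      show "avg K d' (\<lambda>x. G (inst K t x)) \<le> e + \<eta> / 2" if t: "is_template K d' n t" for t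
      proof -
        have "avg K d' (\<lambda>x. F (inst K t x) * indicator {x. inst K t x \<in> C j} x) \<le> e + \<eta> / 2"
        proof (rule d'[rule_format, OF order_refl])
          show "j < k" using Suc.prems by simp
          then show "insensitive k j d' {x. inst K t x \<in> C j}"
            unfolding K_def by (intro insensitive_subspace[where n = n]) (use C t in \<open>auto simp: K_def\<close>)
          show "avg K d (\<lambda>x. F (inst K t (inst K s x))) \<le> e" if s: "is_template K d d' s" for s
          proof -
            have "length s = d'" using s by (simp add: is_template_def)
            then show "avg K d (\<lambda>x. F (inst K t (inst K s x))) \<le> e"
              using F[rule_format, OF subspace_inst[OF t s]] inst_inst[OF t, of s] by simp
          qed
        qed (use F1 e in auto)
        then show "avg K d' (\<lambda>x. G (inst K t x)) \<le> e + \<eta> / 2" by (simp add: G_def indicator_def)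
      qed
    qed
    moreover have "G w * indicator (\<Inter>i<j. C i) w = F w * indicator (\<Inter>i<Suc j. C i) w" for w
      by (auto simp: G_def indicator_def less_Suc_eq)
    ultimately show "avg K n (\<lambda>w. F w * indicator (\<Inter>i<Suc j. C i) w) \<le> e + \<eta>" by simp
  qed
qed

section \<open>The density Hales-Jewett theorem\<close>

text \<open>A word depending on a seed \<open>y\<close>, cut into pieces of length \<open>L\<close>, and on a word \<open>x\<close>: the block for position
\<open>j\<close> is its piece of the seed, with all letters \<open>k\<close> replaced by the letter of \<open>x\<close> at position \<open>j\<close>. So for
a fixed seed these words form a subspace with coordinate \<open>x\<close>. When \<open>x\<close> is a variable word with
wildcard at \<open>j\<close>, the block for \<open>j\<close> is the unchanged piece of the seed. The letter \<open>k\<close> appended to each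
piece guarantees that this variable word has a wildcard.\<close>

fun blocks :: "nat \<Rightarrow> nat \<Rightarrow> nat list \<Rightarrow> nat list \<Rightarrow> nat list \<Rightarrow> nat list" where
  "blocks k L [] y x = []"
| "blocks k L (j # js) y x = fill k (x ! j) (take L y @ [k]) @ blocks k L js (drop L y) x"

lemma blocks_append: "length y1 = length js1 * L \<Longrightarrow>
  blocks k L (js1 @ js2) (y1 @ y2) x = blocks k L js1 y1 x @ blocks k L js2 y2 x"
  by (induction js1 arbitrary: y1) auto

lemma blocks_words:
  assumes "x \<in> words n m" "n \<le> Suc k" "set js \<subseteq> {..<m}" "y \<in> words (Suc k) (length js * L)"
  shows "blocks k L js y x \<in> words (Suc k) (length js * Suc L)"
  using assms(3,4)
proof (induction js arbitrary: y)
  case (Cons j js)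
  have j: "x ! j < Suc k" using words_nth[OF assms(1), of j] assms(2) Cons.prems by auto
  have 1: "fill k (x ! j) (take L y @ [k]) \<in> words (Suc k) (Suc L)"
    using j Cons.prems by (auto simp: fill_def words_def dest!: in_set_takeD)
  have 2: "drop L y \<in> words (Suc k) (length js * L)"
    using Cons.prems by (auto simp: words_def dest!: in_set_dropD)
  show ?case using words_append[OF 1 Cons.IH[OF _ 2]] Cons.prems(1) by (simp add: ac_simps)
qed (simp add: words_def)

lemma fill_blocks: "set js \<subseteq> {..<length x} \<Longrightarrow> fill k i (blocks k L js y x) = blocks k L js y (fill k i x)"
  by (induction js arbitrary: y) (auto simp: fill_fill fill_nth, auto simp: fill_def)

lemma indicator_compl_INT:
  fixes n :: nat
  shows "indicat_real (- (\<Inter>i<n. A i)) v = (\<Sum>i<n. indicator ((\<Inter>j<i. A j) - A i) v)"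
proof (induction n)
  case (Suc n)
  have "indicat_real (- (\<Inter>i<Suc n. A i)) v = indicator (- (\<Inter>i<n. A i)) v + indicator ((\<Inter>j<n. A j) - A n) v"
    by (auto simp: indicator_def less_Suc_eq)
  then show ?case using Suc by simp
qed simp

text \<open>The density increment. Suppose \<open>D\<close> over \<open>Suc k\<close> letters has density \<open>\<delta>\<close> and no line. Reserve in a
block word one block for each variable word of length \<open>m\<close> over \<open>k\<close> letters, where \<open>m\<close> is a length for
which the theorem for \<open>k\<close> letters and density \<open>\<delta>0 / 4\<close> holds. For many seeds and tails some variable
word \<open>w\<close> gives a line over \<open>k\<close> letters inside \<open>D\<close>; fix a frequent \<open>w\<close>, all pieces of the seed except the
one of \<open>w\<close>, and a good tail \<open>z\<close>. What varies is the free piece \<open>v\<close>, and the block word \<open>W v\<close> is a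
variable word with \<open>v\<close> in it unchanged.

The sets \<open>A z i\<close> of those \<open>v\<close> for which \<open>W v\<close> with wildcards filled by \<open>i\<close> lies in \<open>D\<close> are insensitive
to \<open>k\<close> and \<open>i\<close>, and their intersection over \<open>i < k\<close> has density at least about \<open>\<theta>\<close>. As \<open>D\<close> has no line,
it misses this intersection, so it is denser than \<open>\<delta>\<close> on the complement. The complement splits into
\<open>k\<close> intersections of insensitive sets, which \<open>insensitive_Int_avg\<close> exhausts by subspaces; on one of
these \<open>D\<close> has density above \<open>\<delta> + \<gamma>\<close> and hence contains a line after all. The gain \<open>\<gamma>\<close> depends only on the lower bound \<open>\<delta>0\<close>.\<close>

lemma DHJ_increment:
  assumes k: "k \<ge> 1" and dhj: "\<And>\<delta>. \<delta> > 0 \<Longrightarrow> DHJ k \<delta>" and \<delta>0: "\<delta>0 > 0"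
  shows "\<exists>\<gamma>>0. \<forall>\<delta>\<ge>\<delta>0. DHJ (Suc k) (\<delta> + \<gamma>) \<longrightarrow> DHJ (Suc k) \<delta>"
proof -
  define K where "K = Suc k"
  have K: "K \<ge> 1" by (simp add: K_def)
  have M: "\<And>d \<delta>. \<delta> > 0 \<Longrightarrow> DHJ_subspaces k d \<delta>" using DHJ_subspaces_if_DHJ[OF k dhj] .
  have "\<delta>0 / 4 > 0" using \<delta>0 by simp
  from dhj[OF this] obtain m where m: "\<forall>D. \<delta>0 / 4 \<le> dens k m D \<longrightarrow>
     (\<exists>w\<in>words K m. k \<in> set w \<and> (\<forall>i<k. fill k i w \<in> D))"
    unfolding DHJ_def K_def by blast
  define \<theta> where "\<theta> = min 1 (\<delta>0 / 4) / real (K ^ m)"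
  have \<theta>: "\<theta> > 0" "\<theta> \<le> 1" "\<theta> * real (K ^ m) \<le> \<delta>0 / 4"
  proof -
    have "real (K ^ m) \<ge> 1" using K by simp
    then have "\<theta> \<le> 1 / 1" unfolding \<theta>_def by (intro frac_le) auto
    then show "\<theta> \<le> 1" by simp
    show "\<theta> > 0" "\<theta> * real (K ^ m) \<le> \<delta>0 / 4" using \<delta>0 K by (auto simp: \<theta>_def)
  qed
  define \<gamma> where "\<gamma> = \<delta>0 * \<theta> / 4"
  have \<gamma>: "\<gamma> > 0" "\<gamma> \<le> \<delta>0 / 4" using \<delta>0 \<theta> by (auto simp: \<gamma>_def mult_left_le)
  show ?thesis
  proof (rule exI[of _ \<gamma>], intro conjI allI impI \<gamma>)
    fix \<delta> assume \<delta>: "\<delta>0 \<le> \<delta>" and up: "DHJ (Suc k) (\<delta> + \<gamma>)"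
    then obtain d where d: "\<forall>D. \<delta> + \<gamma> \<le> dens K d D \<longrightarrow>
       (\<exists>w\<in>words (Suc K) d. K \<in> set w \<and> (\<forall>i<K. fill K i w \<in> D))"
      unfolding DHJ_def K_def by blast
    obtain Ls where Ls: "set Ls = {w \<in> words K m. k \<in> set w}" using finite_list[of "{w \<in> words K m. k \<in> set w}"] by auto
    define pos where "pos w = (SOME j. j < m \<and> w ! j = k)" for w :: "nat list"
    have pos: "pos w < m \<and> w ! pos w = k" if "w \<in> words K m" "k \<in> set w" for w
    proof -
      have "\<exists>j. j < m \<and> w ! j = k" using that by (auto simp: in_set_conv_nth words_def)
      then show ?thesis unfolding pos_def by (rule someI_ex)
    qed
    define js where "js = map pos Ls"
    have js: "set js \<subseteq> {..<m}" using pos Ls by (auto simp: js_def)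
    define \<eta> where "\<eta> = \<delta>0 * \<theta> / (8 * k)"
    have \<eta>: "\<eta> > 0" using \<delta>0 \<theta> k by (simp add: \<eta>_def)
    obtain L where "\<forall>n\<ge>L. \<forall>C F e. (\<forall>i<k. insensitive k i n (C i)) \<longrightarrow> (\<forall>w. F w \<le> 1) \<longrightarrow> 0 \<le> e \<longrightarrow>
     (\<forall>t. is_template K d n t \<longrightarrow> avg K d (\<lambda>x. F (inst K t x)) \<le> e) \<longrightarrow>
     avg K n (\<lambda>w. F w * indicator (\<Inter>i<k. C i) w) \<le> e + \<eta>"
      using insensitive_Int_avg[OF k M order_refl \<eta>, of d] unfolding K_def by blast
    note L = this[rule_format, OF order_refl]
    define Q where "Q = length js * L"
    define Mn where "Mn = length js * Suc L"
    obtain T where T: "\<forall>n\<ge>T. \<forall>D. \<exists>l u. l + Mn \<le> T \<and> u \<in> words K l \<and> dens K n D \<le> dens K (n - l) {z. u @ z \<in> D} \<and>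
     (\<forall>y\<in>words K Mn. dens K (n - l) {z. u @ z \<in> D} - \<gamma> \<le> dens K (n - (l + Mn)) {z. u @ y @ z \<in> D})"
      using uniform_prefix[OF K \<gamma>(1), of Mn] by blast
    have "\<exists>w\<in>words (Suc K) T. K \<in> set w \<and> (\<forall>i<K. fill K i w \<in> D)" if D: "\<delta> \<le> dens K T D" for D
    proof (rule ccontr)
      assume "\<not> ?thesis"
      then have noline: "\<And>w. w \<in> words (Suc K) T \<Longrightarrow> K \<in> set w \<Longrightarrow> \<forall>i<K. fill K i w \<in> D \<Longrightarrow> False" by blast
      obtain l u where l: "l + Mn \<le> T" and u: "u \<in> words K l" and du: "dens K T D \<le> dens K (T - l) {z. u @ z \<in> D}"
        and dy: "\<forall>y\<in>words K Mn. dens K (T - l) {z. u @ z \<in> D} - \<gamma> \<le> dens K (T - (l + Mn)) {z. u @ y @ z \<in> D}"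
        using T[rule_format, OF order_refl, of D] by blast
      define N where "N = T - (l + Mn)"
      have TN: "T = l + (Mn + N)" using l by (simp add: N_def)
      have dy: "\<delta> - \<gamma> \<le> dens K N {z. u @ y @ z \<in> D}" if "y \<in> words K Mn" for y
        using dy[rule_format, OF that] du D by (simp add: N_def)
      have small: "\<delta>0 / 2 \<le> \<delta> - \<gamma>" using \<delta> \<gamma> \<delta>0 by linarith
      \<comment> \<open>For a pair \<open>p\<close> of a seed and a tail, \<open>f p\<close> is the density of \<open>D\<close> on the subspace of block words
        over \<open>k\<close> letters. Its average is large because every single block word has a dense set of
        tails, by the choice of the prefix.\<close>
      define f where "f p = dens k m {x. u @ blocks k L js (take Q p) x @ drop Q p \<in> D}" for p
      have "\<delta>0 / 2 \<le> avg K (Q + N) f"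
      proof -
        have "avg K (Q + N) f = avg K Q (\<lambda>y. avg K N (\<lambda>z. f (y @ z)))" by (rule avg_append)
        also have "\<dots> = avg K Q (\<lambda>y. avg K N (\<lambda>z. avg k m (\<lambda>x. indicator D (u @ blocks k L js y x @ z))))"
        proof (intro avg_cong)
          fix y z assume "y \<in> words K Q"
          then have "take Q (y @ z) = y" "drop Q (y @ z) = z" by (auto simp: words_def)
          then show "f (y @ z) = avg k m (\<lambda>x. indicator D (u @ blocks k L js y x @ z))"
            unfolding f_def by (intro avg_cong) (auto simp: indicator_def)
        qed
        also have "\<dots> = avg K Q (\<lambda>y. avg k m (\<lambda>x. avg K N (\<lambda>z. indicator D (u @ blocks k L js y x @ z))))"
          by (intro avg_cong avg_swap)
        finally have eq: "avg K (Q + N) f = avg K Q (\<lambda>y. avg k m (\<lambda>x. avg K N (\<lambda>z. indicator D (u @ blocks k L js y x @ z))))" .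
        have "avg K Q (\<lambda>y. avg k m (\<lambda>x. \<delta>0 / 2)) \<le> avg K (Q + N) f"
          unfolding eq
        proof (intro avg_mono)
          fix y x assume y: "y \<in> words K Q" and x: "x \<in> words k m"
          have "blocks k L js y x \<in> words K Mn"
            using blocks_words[OF x _ js, of k y L] y by (simp add: K_def Q_def Mn_def)
          note dy[OF this]
          moreover have "dens K N {z. u @ blocks k L js y x @ z \<in> D} = avg K N (\<lambda>z. indicator D (u @ blocks k L js y x @ z))"
            by (rule avg_cong) (simp add: indicator_def)
          ultimately show "\<delta>0 / 2 \<le> avg K N (\<lambda>z. indicator D (u @ blocks k L js y x @ z))"
            using small by linarith
        qed
        then show ?thesis using K k by simp
      qed
      moreover have "f p \<le> 1" for p unfolding f_def by (rule dens_le_1[OF k])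
      ultimately have "\<delta>0 / 2 / 2 \<le> dens K (Q + N) {p. \<delta>0 / 2 / 2 \<le> f p}"
        using dens_reverse_markov[OF K, of "Q + N" f "\<delta>0 / 2"] \<delta>0 by simp
      then have R: "\<delta>0 / 4 \<le> dens K (Q + N) {p. \<delta>0 / 4 \<le> f p}" by simp
      have "\<exists>w\<in>words K m. \<theta> \<le> dens K (Q + N) {p. k \<in> set w \<and> (\<forall>i<k. u @ blocks k L js (take Q p) (fill k i w) @ drop Q p \<in> D)}"
      proof (rule dens_pigeonhole[where A = "{p. \<delta>0 / 4 \<le> f p}"])
        fix p assume "p \<in> {p. \<delta>0 / 4 \<le> f p}"
        then have "\<exists>w\<in>words K m. k \<in> set w \<and> (\<forall>i<k. fill k i w \<in> {x. u @ blocks k L js (take Q p) x @ drop Q p \<in> D})"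
          unfolding f_def by (intro m[rule_format]) simp
        then show "\<exists>w\<in>words K m. p \<in> {p. k \<in> set w \<and> (\<forall>i<k. u @ blocks k L js (take Q p) (fill k i w) @ drop Q p \<in> D)}"
          by simp
      next
        show "words K m \<noteq> {}" by (rule words_ne[OF K])
        show "\<theta> * real (card (words K m)) \<le> dens K (Q + N) {p. \<delta>0 / 4 \<le> f p}" using \<theta> R by simp
      qed (use \<theta> in auto)
      then obtain w where w: "w \<in> words K m" and
        dw: "\<theta> \<le> dens K (Q + N) {p. k \<in> set w \<and> (\<forall>i<k. u @ blocks k L js (take Q p) (fill k i w) @ drop Q p \<in> D)}"
        by blast
      have kw: "k \<in> set w"
      proof (rule ccontr)
        assume "k \<notin> set w"
        then show False using dw \<theta> by (simp add: avg_def)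
      qed
      define Gd where "Gd y z \<longleftrightarrow> (\<forall>i<k. u @ blocks k L js y (fill k i w) @ z \<in> D)" for y z
      have "w \<in> set Ls" using w kw Ls by simp
      then obtain Ls1 Ls2 where Lsp: "Ls = Ls1 @ w # Ls2" by (auto simp: in_set_conv_decomp)
      define js1 js2 where "js1 = map pos Ls1" and "js2 = map pos Ls2"
      have jsp: "js = js1 @ pos w # js2" by (simp add: js_def js1_def js2_def Lsp)
      define Q1 Q2 where "Q1 = length js1 * L" and "Q2 = length js2 * L"
      have Qp: "Q + N = Q1 + (L + (Q2 + N))" "Q = Q1 + (L + Q2)" by (auto simp: Q_def Q1_def Q2_def jsp algebra_simps)
      have "\<theta> \<le> avg K Q1 (\<lambda>y1. avg K L (\<lambda>v. avg K Q2 (\<lambda>y2. avg K N (\<lambda>z. of_bool (Gd (y1 @ v @ y2) z)))))"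
      proof -
        have "dens K (Q + N) {p. k \<in> set w \<and> (\<forall>i<k. u @ blocks k L js (take Q p) (fill k i w) @ drop Q p \<in> D)} =
           avg K (Q1 + (L + (Q2 + N))) (\<lambda>p. of_bool (Gd (take Q p) (drop Q p)))"
          unfolding Qp(1) by (rule avg_cong) (simp add: kw Gd_def indicator_def)
        also have "\<dots> = avg K Q1 (\<lambda>y1. avg K L (\<lambda>v. avg K Q2 (\<lambda>y2. avg K N (\<lambda>z. of_bool (Gd (y1 @ v @ y2) z)))))"
          unfolding avg_append by (intro avg_cong) (simp add: Qp(2) words_length)
        finally show ?thesis using dw by simp
      qed
      then obtain y1 where y1: "y1 \<in> words K Q1" and "\<theta> \<le> avg K L (\<lambda>v. avg K Q2 (\<lambda>y2. avg K N (\<lambda>z. of_bool (Gd (y1 @ v @ y2) z))))"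
        using avg_le_ex[OF K] by blast
      then have "\<theta> \<le> avg K Q2 (\<lambda>y2. avg K L (\<lambda>v. avg K N (\<lambda>z. of_bool (Gd (y1 @ v @ y2) z))))"
        by (subst avg_swap)
      then obtain y2 where y2: "y2 \<in> words K Q2" and "\<theta> \<le> avg K L (\<lambda>v. avg K N (\<lambda>z. of_bool (Gd (y1 @ v @ y2) z)))"
        using avg_le_ex[OF K] by blast
      then have fg: "\<theta> \<le> avg K N (\<lambda>z. avg K L (\<lambda>v. of_bool (Gd (y1 @ v @ y2) z)))"
        by (subst avg_swap)
      define B1 B2 where "B1 = blocks k L js1 y1 w" and "B2 = [k] @ blocks k L js2 y2 w"
      define W where "W v = B1 @ v @ B2" for v
      have Wb: "blocks k L js (y1 @ v @ y2) w = W v" if v: "v \<in> words K L" for v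
      proof -
        have "blocks k L js (y1 @ v @ y2) w = B1 @ blocks k L (pos w # js2) (v @ y2) w"
          unfolding jsp B1_def by (rule blocks_append) (use y1 in \<open>simp add: words_def Q1_def\<close>)
        also have "blocks k L (pos w # js2) (v @ y2) w = v @ B2"
          using v pos[OF w kw] by (simp add: words_def B2_def)
        finally show ?thesis by (simp add: W_def)
      qed
      have lw: "length w = m" using w by (simp add: words_def)
      have Wr: "blocks k L js (y1 @ v @ y2) (fill k i w) = fill k i (W v)" if v: "v \<in> words K L" for v i
        using fill_blocks[of js w k i L "y1 @ v @ y2"] js Wb[OF v] by (simp add: lw)
      have Ww: "W v \<in> words K Mn" if v: "v \<in> words K L" for v
      proof -
        have "y1 @ v @ y2 \<in> words K Q" using words_append[OF y1 words_append[OF v y2]] by (simp add: Qp)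
        then show ?thesis using blocks_words[OF w _ js, of k "y1 @ v @ y2" L] Wb[OF v] by (simp add: K_def Q_def Mn_def)
      qed
      have B12: "length B1 + (L + length B2) = Mn" "set B1 \<subseteq> {..<K}" "set B2 \<subseteq> {..<K}"
      proof -
        have "replicate L 0 \<in> words K L" by (auto simp: words_def K_def)
        from Ww[OF this] show "length B1 + (L + length B2) = Mn" "set B1 \<subseteq> {..<K}" "set B2 \<subseteq> {..<K}"
          by (auto simp: W_def words_def)
      qed
      define A where "A z i = {v. u @ fill k i (W v) @ z \<in> D}" for z i
      define B where "B z = {v. u @ W v @ z \<in> D}" for z
      define fz where "fz z = dens K L (\<Inter>i<k. A z i)" for z
      define gz where "gz z = dens K L (B z)" for z
      have f\<theta>: "\<theta> \<le> avg K N fz"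
      proof -
        have "avg K N fz = avg K N (\<lambda>z. avg K L (\<lambda>v. of_bool (Gd (y1 @ v @ y2) z)))"
          unfolding fz_def by (intro avg_cong) (auto simp: A_def Gd_def Wr indicator_def)
        then show ?thesis using fg by simp
      qed
      have g\<delta>: "\<delta> - \<gamma> \<le> avg K N gz"
      proof -
        have "avg K N gz = avg K N (\<lambda>z. avg K L (\<lambda>v. indicator D (u @ W v @ z)))"
          unfolding gz_def B_def by (intro avg_cong) (auto simp: indicator_def)
        also have "\<dots> = avg K L (\<lambda>v. dens K N {z. u @ W v @ z \<in> D})"
          by (subst avg_swap) (intro avg_cong, auto simp: indicator_def)
        finally have eq: "avg K N gz = avg K L (\<lambda>v. dens K N {z. u @ W v @ z \<in> D})" .
        have "avg K L (\<lambda>v. \<delta> - \<gamma>) \<le> avg K N gz" unfolding eq by (intro avg_mono dy Ww)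
        then show ?thesis using K by simp
      qed
      have "\<delta>0 * \<theta> / 2 \<le> avg K N (\<lambda>z. gz z - (\<delta> + \<gamma>) * (1 - fz z))"
      proof -
        have "avg K N (\<lambda>z. gz z - (\<delta> + \<gamma>) * (1 - fz z)) = avg K N gz - (\<delta> + \<gamma>) * (1 - avg K N fz)"
          using K by (simp add: avg_diff avg_cmult)
        also have "\<dots> \<ge> (\<delta> - \<gamma>) - (\<delta> + \<gamma>) * (1 - \<theta>)"
          using g\<delta> f\<theta> \<delta> \<delta>0 \<gamma> by (intro diff_mono mult_left_mono) auto
        also have "(\<delta> - \<gamma>) - (\<delta> + \<gamma>) * (1 - \<theta>) = \<delta> * \<theta> + \<gamma> * \<theta> - 2 * \<gamma>" by (simp add: algebra_simps)
        also have "\<dots> \<ge> \<delta>0 * \<theta> - 2 * \<gamma>" using \<delta> \<gamma> \<theta> by (simp add: add_increasing2 mult_right_mono)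
        also have "\<delta>0 * \<theta> - 2 * \<gamma> = \<delta>0 * \<theta> / 2" by (simp add: \<gamma>_def)
        finally show ?thesis .
      qed
      then obtain z where z: "z \<in> words K N" and gain: "\<delta>0 * \<theta> / 2 \<le> gz z - (\<delta> + \<gamma>) * (1 - fz z)"
        using avg_le_ex[OF K] by blast
      \<comment> \<open>A common element would make \<open>W v\<close> a line of \<open>D\<close> over \<open>Suc k\<close> letters, once its wildcard is
        renamed from \<open>k\<close> to \<open>K\<close>; the letters \<open>k\<close> in \<open>u\<close> and \<open>z\<close> are constants.\<close>
      have disj: "v \<notin> B z" if v: "v \<in> words K L" and vA: "v \<in> (\<Inter>i<k. A z i)" for v
      proof
        assume vB: "v \<in> B z"
        define t where "t = u @ fill k K (W v) @ z"
        show False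
        proof (rule noline)
          have "fill k K (W v) \<in> words (Suc K) Mn" using Ww[OF v] by (auto simp: words_def fill_def)
          then show "t \<in> words (Suc K) T"
            unfolding t_def TN using u z words_mono[of K "Suc K"] by (intro words_append) auto
          have "k \<in> set (W v)" by (simp add: W_def B2_def)
          then have "K \<in> set (fill k K (W v))" unfolding fill_def set_map by (rule image_eqI[rotated]) simp
          then show "K \<in> set t" by (simp add: t_def)
          show "\<forall>i<K. fill K i t \<in> D"
          proof (intro allI impI)
            fix i assume i: "i < K"
            have "fill K i (fill k K (W v)) = fill k i (W v)"
              using Ww[OF v] by (auto simp: fill_def words_def)
            then have t: "fill K i t = u @ fill k i (W v) @ z" using u z by (simp add: t_def fill_id)
            show "fill K i t \<in> D"
            proof (cases "i = k")
              case True then show ?thesis using vB t by (simp add: B_def)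
            next
              case False then show ?thesis using vA t i by (auto simp: A_def K_def)
            qed
          qed
        qed
      qed
      define F where "F v = indicator (B z) v - (\<delta> + \<gamma>)" for v
      have Fsub: "avg K d (\<lambda>x. F (inst K t x)) \<le> 0" if t: "is_template K d L t" for t
      proof (rule ccontr)
        assume "\<not> ?thesis"
        then have "\<delta> + \<gamma> \<le> avg K d (\<lambda>x. indicator (B z) (inst K t x))"
          using K by (simp add: F_def avg_diff)
        also have "\<dots> = dens K d {x. inst K t x \<in> B z}" by (intro avg_cong) (auto simp: indicator_def)
        finally obtain w' where w': "w' \<in> words (Suc K) d" "K \<in> set w'" "\<forall>i<K. fill K i w' \<in> {x. inst K t x \<in> B z}"
          using d by blast
        note sl = subspace_line[OF t w'(1,2)]
        define s where "s = u @ (B1 @ inst K t w' @ B2) @ z"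
        show False
        proof (rule noline)
          have "B1 @ inst K t w' @ B2 \<in> words (Suc K) Mn"
            using sl(1) B12 by (auto simp: words_def)
          then show "s \<in> words (Suc K) T"
            unfolding s_def TN using u z words_mono[of K "Suc K"] by (intro words_append) auto
          show "K \<in> set s" using sl(2) by (simp add: s_def)
          show "\<forall>i<K. fill K i s \<in> D"
          proof (intro allI impI)
            fix i assume i: "i < K"
            have "fill K i B1 = B1" "fill K i B2 = B2" "fill K i u = u" "fill K i z = z"
              using B12 u z fill_id[of _ K] by (auto simp: words_def)
            then have "fill K i s = u @ W (inst K t (fill K i w')) @ z"
              using sl(3)[OF i] by (simp add: s_def W_def)
            then show "fill K i s \<in> D" using w'(3) i by (simp add: B_def)
          qed
        qed
      qed
      have insA: "insensitive k i L (A z i)" if "i < k" for i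
        unfolding insensitive_def
        using that by (auto simp: A_def W_def fill_fill)
      have piece: "avg K L (\<lambda>v. F v * indicator ((\<Inter>j<i. A z j) - A z i) v) \<le> \<eta>" if i: "i < k" for i
      proof -
        define C where "C j = (if j < i then A z j else if j = i then - A z i else UNIV)" for j
        have "avg K L (\<lambda>v. F v * indicator (\<Inter>j<k. C j) v) \<le> 0 + \<eta>"
        proof (rule L)
          fix j assume "j < k"
          then show "insensitive k j L (C j)"
            using insA by (auto simp: C_def insensitive_def)
        next
          show "F v \<le> 1" for v using \<delta> \<delta>0 \<gamma> by (simp add: F_def indicator_def)
        qed (use Fsub in auto)
        moreover have "(\<Inter>j<k. C j) = (\<Inter>j<i. A z j) - A z i"
          using i by (auto simp: C_def split: if_splits)
        ultimately show ?thesis by simp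
      qed
      have "gz z - (\<delta> + \<gamma>) * (1 - fz z) = avg K L (\<lambda>v. F v * indicator (- (\<Inter>i<k. A z i)) v)"
      proof -
        have "avg K L (\<lambda>v. F v * indicator (- (\<Inter>i<k. A z i)) v) =
          avg K L (\<lambda>v. indicator (B z) v - (\<delta> + \<gamma>) * (1 - indicator (\<Inter>i<k. A z i) v))"
          by (rule avg_cong) (use disj in \<open>auto simp: F_def indicator_def\<close>)
        also have "\<dots> = gz z - (\<delta> + \<gamma>) * (1 - fz z)"
          using K by (simp add: avg_diff avg_cmult gz_def fz_def)
        finally show ?thesis by simp
      qed
      also have "\<dots> = (\<Sum>i<k. avg K L (\<lambda>v. F v * indicator ((\<Inter>j<i. A z j) - A z i) v))"
        by (simp only: indicator_compl_INT sum_distrib_left avg_sum)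
      also have "\<dots> \<le> (\<Sum>i<k. \<eta>)" by (intro sum_mono piece) auto
      also have "\<dots> = \<delta>0 * \<theta> / 8" using k by (simp add: \<eta>_def)
      finally have "\<delta>0 * \<theta> / 2 \<le> \<delta>0 * \<theta> / 8" using gain by linarith
      moreover have "\<delta>0 * \<theta> > 0" using \<delta>0 \<theta> by simp
      ultimately show False by linarith
    qed
    then show "DHJ (Suc k) \<delta>" unfolding DHJ_def K_def by blast
  qed
qed

text \<open>The increments of \<open>DHJ_increment\<close> are bounded below as long as the density stays above the initial
\<open>\<delta>\<close>, so finitely many of them lead beyond density \<open>1\<close>, where there is nothing to prove.\<close>

theorem density_Hales_Jewett:
  assumes "k \<ge> 1" "\<delta> > 0"
  shows "DHJ k \<delta>"
  using assms
proof (induction k arbitrary: \<delta> rule: dec_induct)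
  case base
  then show ?case using DHJ_1 by simp
next
  case (step k)
  obtain \<gamma> where \<gamma>: "\<gamma> > 0" "\<forall>\<delta>'\<ge>\<delta>. DHJ (Suc k) (\<delta>' + \<gamma>) \<longrightarrow> DHJ (Suc k) \<delta>'"
    using DHJ_increment[OF step.hyps(1) step.IH step.prems] by blast
  obtain J :: nat where J: "1 / \<gamma> < J" using reals_Archimedean2 by blast
  have "DHJ (Suc k) (\<delta> + real (J - i) * \<gamma>)" if "i \<le> J" for i
    using that
  proof (induction i)
    case 0
    have "1 < \<delta> + real J * \<gamma>" using J \<gamma> step.prems by (simp add: field_simps)
    then have "\<not> \<delta> + real J * \<gamma> \<le> dens (Suc k) 0 D" for D
      using dens_le_1[of "Suc k" 0 D] by simp
    then show ?case by (auto simp: DHJ_def)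
  next
    case (Suc i)
    have "J - i = Suc (J - Suc i)" using Suc.prems by simp
    then have "\<delta> + real (J - i) * \<gamma> = \<delta> + real (J - Suc i) * \<gamma> + \<gamma>"
      by (simp only: of_nat_Suc) (simp add: algebra_simps)
    then have "DHJ (Suc k) (\<delta> + real (J - Suc i) * \<gamma> + \<gamma>)"
      using Suc.IH[OF Suc_leD[OF Suc.prems]] by (simp only:)
    then show ?case by (rule \<gamma>(2)[rule_format, rotated]) (use \<gamma>(1) in simp)
  qed
  from this[of J] show ?case by simp
qed

section \<open>Riesz representation for a lattice of continuous functions\<close>

text \<open>The continuous functions in question form a vector lattice with constants that has bump functions at
points. Gelfand transforms of real functions are of this kind as they stand, before one knows whether
they exhaust the continuous functions. A value of \<open>\<Lambda>\<close> depends only on the values of the function on the space, by positivity.\<close>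

locale positive_functional =
  fixes X :: "'a topology" and A :: "('a \<Rightarrow> real) set" and \<Lambda> :: "('a \<Rightarrow> real) \<Rightarrow> real"
  assumes compact: "compact_space X"
    and cont: "f \<in> A \<Longrightarrow> continuous_map X euclideanreal f"
    and add: "f \<in> A \<Longrightarrow> g \<in> A \<Longrightarrow> (\<lambda>x. f x + g x) \<in> A"
    and scale: "f \<in> A \<Longrightarrow> (\<lambda>x. c * f x) \<in> A"
    and one: "(\<lambda>_. 1) \<in> A"
    and abs: "f \<in> A \<Longrightarrow> (\<lambda>x. \<bar>f x\<bar>) \<in> A"
    and bump: "openin X U \<Longrightarrow> x \<in> U \<Longrightarrow> \<exists>f\<in>A. (\<forall>y\<in>topspace X. 0 \<le> f y \<and> f y \<le> 1 \<and> (y \<notin> U \<longrightarrow> f y = 0)) \<and> f x = 1"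
    and \<Lambda>_add: "f \<in> A \<Longrightarrow> g \<in> A \<Longrightarrow> \<Lambda> (\<lambda>x. f x + g x) = \<Lambda> f + \<Lambda> g"
    and \<Lambda>_scale: "f \<in> A \<Longrightarrow> \<Lambda> (\<lambda>x. c * f x) = c * \<Lambda> f"
    and \<Lambda>_pos: "f \<in> A \<Longrightarrow> (\<And>x. x \<in> topspace X \<Longrightarrow> 0 \<le> f x) \<Longrightarrow> 0 \<le> \<Lambda> f"
    and \<Lambda>_one: "\<Lambda> (\<lambda>_. 1) = 1"
begin

abbreviation \<Omega> where "\<Omega> \<equiv> topspace X"

lemma const: "(\<lambda>_. c) \<in> A" using scale[OF one, of c] by simp
lemma \<Lambda>_const: "\<Lambda> (\<lambda>_. c) = c" using \<Lambda>_scale[OF one, of c] \<Lambda>_one by simp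
lemma diff: "f \<in> A \<Longrightarrow> g \<in> A \<Longrightarrow> (\<lambda>x. f x - g x) \<in> A"
  using add[of f "\<lambda>x. (-1) * g x"] scale[of g "-1"] by simp
lemma \<Lambda>_diff: "f \<in> A \<Longrightarrow> g \<in> A \<Longrightarrow> \<Lambda> (\<lambda>x. f x - g x) = \<Lambda> f - \<Lambda> g"
  using \<Lambda>_add[of f "\<lambda>x. (-1) * g x"] scale[of g "-1"] \<Lambda>_scale[of g "-1"] by simp
lemma max: "f \<in> A \<Longrightarrow> g \<in> A \<Longrightarrow> (\<lambda>x. max (f x) (g x)) \<in> A"
proof -
  assume f: "f \<in> A" and g: "g \<in> A"
  have "(\<lambda>x. (1/2) * ((f x + g x) + \<bar>f x - g x\<bar>)) \<in> A"
    by (intro scale add abs diff f g)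
  moreover have "(1/2) * ((f x + g x) + \<bar>f x - g x\<bar>) = max (f x) (g x)" for x by (simp add: max_def)
  ultimately show ?thesis by simp
qed
lemma min: "f \<in> A \<Longrightarrow> g \<in> A \<Longrightarrow> (\<lambda>x. min (f x) (g x)) \<in> A"
proof -
  assume f: "f \<in> A" and g: "g \<in> A"
  have "(\<lambda>x. (1/2) * ((f x + g x) - \<bar>f x - g x\<bar>)) \<in> A"
    by (intro scale add abs diff f g)
  moreover have "(1/2) * ((f x + g x) - \<bar>f x - g x\<bar>) = min (f x) (g x)" for x by (simp add: min_def)
  ultimately show ?thesis by simp
qed
lemma sum: "finite I \<Longrightarrow> (\<And>i. i \<in> I \<Longrightarrow> f i \<in> A) \<Longrightarrow> (\<lambda>x. \<Sum>i\<in>I. f i x) \<in> A \<and> \<Lambda> (\<lambda>x. \<Sum>i\<in>I. f i x) = (\<Sum>i\<in>I. \<Lambda> (f i))"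
  by (induction I rule: finite_induct) (auto simp: const \<Lambda>_const add \<Lambda>_add)

lemma \<Lambda>_mono: "f \<in> A \<Longrightarrow> g \<in> A \<Longrightarrow> (\<And>x. x \<in> \<Omega> \<Longrightarrow> f x \<le> g x) \<Longrightarrow> \<Lambda> f \<le> \<Lambda> g"
  using \<Lambda>_pos[OF diff, of g f] \<Lambda>_diff[of g f] by simp

lemma \<Lambda>_cong: "f \<in> A \<Longrightarrow> g \<in> A \<Longrightarrow> (\<And>x. x \<in> \<Omega> \<Longrightarrow> f x = g x) \<Longrightarrow> \<Lambda> f = \<Lambda> g"
  using \<Lambda>_mono[of f g] \<Lambda>_mono[of g f] by (simp add: order_antisym)

definition under :: "'a set \<Rightarrow> ('a \<Rightarrow> real) set" where
  "under U = {f \<in> A. \<forall>x\<in>\<Omega>. 0 \<le> f x \<and> f x \<le> 1 \<and> (x \<notin> U \<longrightarrow> f x = 0)}"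

text \<open>The content of an open set is the supremum of \<open>\<Lambda>\<close> over the functions below its indicator. These are
only required to vanish off the set. Compact support is recovered where it matters by lowering a
function by \<open>e\<close> and cutting it off at \<open>0\<close> (\<open>cut_off\<close>), which changes \<open>\<Lambda>\<close> by at most \<open>e\<close>.\<close>

definition vol :: "'a set \<Rightarrow> ennreal" where
  "vol U = (SUP f\<in>under U. ennreal (\<Lambda> f))"

definition outer :: "'a set \<Rightarrow> ennreal" where
  "outer E = (INF U\<in>{U. openin X U \<and> E \<subseteq> U}. vol U)"

lemma zero_under: "(\<lambda>_. 0) \<in> under U" by (simp add: under_def const)

lemma under_nonneg: "f \<in> under U \<Longrightarrow> 0 \<le> \<Lambda> f"
  by (rule \<Lambda>_pos) (auto simp: under_def)

lemma vol_mono: "U \<subseteq> V \<Longrightarrow> vol U \<le> vol V"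
  unfolding vol_def by (rule SUP_subset_mono) (auto simp: under_def)

lemma vol_upper: "f \<in> under U \<Longrightarrow> ennreal (\<Lambda> f) \<le> vol U"
  unfolding vol_def by (rule SUP_upper)

lemma vol_le_1: "vol U \<le> 1"
  unfolding vol_def
proof (rule SUP_least)
  fix f assume "f \<in> under U"
  then have "\<Lambda> f \<le> \<Lambda> (\<lambda>_. 1)" by (intro \<Lambda>_mono one) (auto simp: under_def)
  then show "ennreal (\<Lambda> f) \<le> 1" by (simp add: \<Lambda>_one)
qed

lemma vol_topspace: "vol \<Omega> = 1"
proof (rule antisym[OF vol_le_1])
  have "(\<lambda>_. 1) \<in> under \<Omega>" by (simp add: under_def one)
  from vol_upper[OF this] show "1 \<le> vol \<Omega>" by (simp add: \<Lambda>_one)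
qed

lemma vol_empty: "vol {} = 0"
proof -
  have "\<Lambda> f \<le> 0" if "f \<in> under {}" for f
    using \<Lambda>_mono[of f "\<lambda>_. 0"] that const \<Lambda>_const[of 0] by (auto simp: under_def)
  then have "vol {} \<le> 0" unfolding vol_def by (intro SUP_least) (simp add: ennreal_neg)
  then show ?thesis by simp
qed

lemma outer_open: "openin X U \<Longrightarrow> outer U = vol U"
  unfolding outer_def by (intro antisym INF_lower INF_greatest vol_mono) auto

lemma outer_mono: "E \<subseteq> F \<Longrightarrow> outer E \<le> outer F"
  unfolding outer_def by (rule INF_superset_mono) auto

lemma open_superlevel: "f \<in> A \<Longrightarrow> openin X {x \<in> \<Omega>. c < f x}"
  using openin_continuous_map_preimage[OF cont, of f "{c<..}"] by simp

lemma closed_superlevel: "f \<in> A \<Longrightarrow> closedin X {x \<in> \<Omega>. c \<le> f x}"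
  using closedin_continuous_map_preimage[OF cont, of f "{c..}"] by simp

text \<open>Cover the compact set by finitely many sets on which a bump function exceeds \<open>1 / 2\<close>, double the sum
of the bumps that belong to the same index, and truncate at \<open>1\<close>.\<close>

lemma partition_of_unity:
  assumes C: "compactin X C" and U: "\<And>i. i \<in> I \<Longrightarrow> openin X (U i)" and sub: "C \<subseteq> (\<Union>i\<in>I. U i)"
  shows "\<exists>J g. finite J \<and> J \<subseteq> I \<and> (\<forall>i\<in>J. g i \<in> under (U i)) \<and> (\<forall>x\<in>C. 1 \<le> (\<Sum>i\<in>J. g i x))"
proof -
  have "\<forall>x\<in>C. \<exists>i f. i \<in> I \<and> f \<in> under (U i) \<and> f x = 1"
  proof
    fix x assume "x \<in> C"
    then obtain i where i: "i \<in> I" "x \<in> U i" using sub by auto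
    then obtain f where "f \<in> A" "\<forall>y\<in>\<Omega>. 0 \<le> f y \<and> f y \<le> 1 \<and> (y \<notin> U i \<longrightarrow> f y = 0)" "f x = 1"
      using bump[OF U] by blast
    then show "\<exists>i f. i \<in> I \<and> f \<in> under (U i) \<and> f x = 1" using i by (auto simp: under_def)
  qed
  then obtain i f where i: "\<And>x. x \<in> C \<Longrightarrow> i x \<in> I" and f: "\<And>x. x \<in> C \<Longrightarrow> f x \<in> under (U (i x))" "\<And>x. x \<in> C \<Longrightarrow> f x x = 1"
    by metis
  have fA: "f x \<in> A" if "x \<in> C" for x using f[OF that] by (simp add: under_def)
  define V where "V x = {y \<in> \<Omega>. 1/2 < f x y}" for x
  have CO: "C \<subseteq> \<Omega>" using C compactin_subset_topspace by blast
  have "\<exists>S. finite S \<and> S \<subseteq> V ` C \<and> C \<subseteq> \<Union>S"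
  proof (rule compactinD[OF C])
    show "openin X W" if "W \<in> V ` C" for W
      using that open_superlevel[OF fA] unfolding V_def by blast
    show "C \<subseteq> \<Union> (V ` C)" using CO f(2) by (force simp: V_def)
  qed
  then obtain S where S: "finite S" "S \<subseteq> C" "C \<subseteq> (\<Union>x\<in>S. V x)"
    by (metis finite_subset_image)
  define g where "g j = (\<lambda>y. min 1 (2 * (\<Sum>x\<in>{x\<in>S. i x = j}. f x y)))" for j
  have gA: "g j \<in> A" for j
    unfolding g_def using S fA by (intro min one scale conjunct1[OF sum]) auto
  show ?thesis
  proof (intro exI[of _ "i ` S"] exI[of _ g] conjI ballI)
    show "finite (i ` S)" using S by simp
    show "i ` S \<subseteq> I" using S i by auto
    fix j assume "j \<in> i ` S"
    have "f x y = 0" if "x \<in> S" "i x = j" "y \<in> \<Omega>" "y \<notin> U j" for x y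
      using f(1)[of x] that S by (auto simp: under_def)
    moreover have "0 \<le> f x y" if "x \<in> S" "y \<in> \<Omega>" for x y
      using f(1)[of x] that S by (auto simp: under_def)
    ultimately show "g j \<in> under (U j)" using gA by (auto simp: under_def g_def intro!: sum_nonneg)
  next
    fix y assume y: "y \<in> C"
    then obtain x where x: "x \<in> S" "1/2 < f x y" using S by (auto simp: V_def)
    have nn: "0 \<le> f x y" if "x \<in> S" for x
      using f(1)[of x] that S y CO by (auto simp: under_def)
    have "f x y \<le> (\<Sum>x\<in>{x'\<in>S. i x' = i x}. f x y)"
      using x S nn by (intro member_le_sum) auto
    then have "1 \<le> g (i x) y" using x by (simp add: g_def)
    also have "\<dots> \<le> (\<Sum>i\<in>i ` S. g i y)"
      using x S nn by (intro member_le_sum) (auto simp: g_def intro!: sum_nonneg)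
    finally show "1 \<le> (\<Sum>i\<in>i ` S. g i y)" .
  qed
qed

lemma urysohn:
  assumes C: "compactin X C" and U: "openin X U" and sub: "C \<subseteq> U"
  shows "\<exists>f\<in>under U. \<forall>x\<in>C. f x = 1"
proof -
  obtain J g where J: "finite J" "J \<subseteq> {()}" "\<forall>i\<in>J. g i \<in> under U" "\<forall>x\<in>C. 1 \<le> (\<Sum>i\<in>J. g i x)"
    using partition_of_unity[OF C, of "{()}" "\<lambda>_. U"] U sub by auto
  have CO: "C \<subseteq> \<Omega>" using C compactin_subset_topspace by blast
  show ?thesis
  proof (cases "J = {}")
    case True then show ?thesis using J zero_under by auto
  next
    case False
    then have "J = {()}" using J by auto
    then have "g () \<in> under U" "\<forall>x\<in>C. 1 \<le> g () x" using J by auto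
    then show ?thesis using CO by (intro bexI[of _ "g ()"]) (auto simp: under_def intro!: antisym)
  qed
qed

lemma cut_off:
  assumes f: "f \<in> A" and e: "0 < e" and nn: "\<And>x. x \<in> \<Omega> \<Longrightarrow> 0 \<le> f x"
  shows "(\<lambda>x. max 0 (f x - e)) \<in> A" "\<Lambda> f \<le> \<Lambda> (\<lambda>x. max 0 (f x - e)) + e"
proof -
  show a: "(\<lambda>x. max 0 (f x - e)) \<in> A" by (intro max const diff f)
  have "\<Lambda> f \<le> \<Lambda> (\<lambda>x. max 0 (f x - e) + e)" by (intro \<Lambda>_mono f add a const) simp
  then show "\<Lambda> f \<le> \<Lambda> (\<lambda>x. max 0 (f x - e)) + e" by (simp add: \<Lambda>_add a const \<Lambda>_const)
qed

lemma closed_compact: "closedin X C \<Longrightarrow> compactin X C"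
  using compact closedin_compact_space by blast

text \<open>Where \<open>f\<close> is at least \<open>e\<close> finitely many of the open sets suffice, and a partition of unity for them
dominates \<open>f\<close> cut off at \<open>e\<close>.\<close>

lemma vol_UN:
  assumes U: "\<And>n::nat. openin X (U n)"
  shows "vol (\<Union>n. U n) \<le> (\<Sum>n. vol (U n))"
  unfolding vol_def[of "\<Union>n. U n"]
proof (rule SUP_least, rule ennreal_le_epsilon)
  fix f e assume f: "f \<in> under (\<Union>n. U n)" and e: "0 < (e::real)"
  have fA: "f \<in> A" and f0: "\<And>x. x \<in> \<Omega> \<Longrightarrow> 0 \<le> f x \<and> f x \<le> 1" using f by (auto simp: under_def)
  define C where "C = {x \<in> \<Omega>. e \<le> f x}"
  have C: "compactin X C" unfolding C_def by (intro closed_compact closed_superlevel fA)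
  have "C \<subseteq> (\<Union>n. U n)" using f e by (force simp: C_def under_def)
  then obtain J g where J: "finite J" "\<forall>i\<in>J. g i \<in> under (U i)" "\<forall>x\<in>C. 1 \<le> (\<Sum>i\<in>J. g i x)"
    using partition_of_unity[OF C, of UNIV U] U by auto
  have gA: "g i \<in> A" if "i \<in> J" for i using J that by (simp add: under_def)
  have "\<Lambda> (\<lambda>x. max 0 (f x - e)) \<le> \<Lambda> (\<lambda>x. \<Sum>i\<in>J. g i x)"
  proof (rule \<Lambda>_mono)
    fix x assume x: "x \<in> \<Omega>"
    show "max 0 (f x - e) \<le> (\<Sum>i\<in>J. g i x)"
    proof (cases "x \<in> C")
      case True then show ?thesis using J(3) f0[OF x] e by fastforce
    next
      case False then show ?thesis using J x by (auto simp: C_def under_def intro!: sum_nonneg)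
    qed
  qed (use cut_off[OF fA e] f0 sum[OF J(1), of g] gA in auto)
  then have "\<Lambda> f \<le> (\<Sum>i\<in>J. \<Lambda> (g i)) + e" using cut_off[OF fA e] f0 sum[OF J(1), of g] gA by auto
  then have "ennreal (\<Lambda> f) \<le> ennreal ((\<Sum>i\<in>J. \<Lambda> (g i)) + e)" by (rule ennreal_leI)
  also have "\<dots> = (\<Sum>i\<in>J. ennreal (\<Lambda> (g i))) + ennreal e"
  proof -
    have nn: "0 \<le> \<Lambda> (g i)" if "i \<in> J" for i using J under_nonneg that by blast
    then show ?thesis using e by (simp add: sum_nonneg sum_ennreal)
  qed
  also have "(\<Sum>i\<in>J. ennreal (\<Lambda> (g i))) \<le> (\<Sum>i\<in>J. vol (U i))" by (intro sum_mono vol_upper) (use J in auto)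
  also have "\<dots> \<le> (\<Sum>n. vol (U n))" using J by (intro sum_le_suminf) auto
  finally show "ennreal (\<Lambda> f) \<le> (\<Sum>n. vol (U n)) + ennreal e" by (simp add: add_right_mono)
qed

lemma outer_le_1: "E \<subseteq> \<Omega> \<Longrightarrow> outer E \<le> 1"
  unfolding outer_def using vol_topspace by (intro INF_lower2[of \<Omega>]) auto

lemma outer_approx:
  assumes "E \<subseteq> \<Omega>" "e > 0"
  shows "\<exists>U. openin X U \<and> E \<subseteq> U \<and> vol U \<le> outer E + ennreal e"
proof -
  have "outer E < outer E + ennreal e" using outer_le_1[OF assms(1)] assms(2)
    by (cases "outer E") (auto simp flip: ennreal_plus simp: top_unique ennreal_less_iff)
  then have "\<exists>U\<in>{U. openin X U \<and> E \<subseteq> U}. vol U < outer E + ennreal e"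
    unfolding outer_def[of E] INF_less_iff .
  then show ?thesis by (auto intro: less_imp_le)
qed

lemma outer_measure: "outer_measure_space (Pow \<Omega>) outer"
  unfolding outer_measure_space_def
proof (intro conjI)
  show "positive (Pow \<Omega>) outer" unfolding positive_def by (simp add: outer_open vol_empty)
  show "increasing (Pow \<Omega>) outer" unfolding increasing_def by (auto intro: outer_mono)
  show "countably_subadditive (Pow \<Omega>) outer" unfolding countably_subadditive_def
  proof (intro allI impI, rule ennreal_le_epsilon)
    fix E :: "nat \<Rightarrow> 'a set" and e :: real assume E: "range E \<subseteq> Pow \<Omega>" and e: "0 < e"
    have "\<forall>n. \<exists>U. openin X U \<and> E n \<subseteq> U \<and> vol U \<le> outer (E n) + ennreal (e * (1/2) ^ Suc n)"
      using E e by (intro allI outer_approx) auto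
    then obtain U where U: "\<And>n. openin X (U n)" "\<And>n. E n \<subseteq> U n"
      "\<And>n. vol (U n) \<le> outer (E n) + ennreal (e * (1/2) ^ Suc n)" by metis
    have "outer (\<Union>n. E n) \<le> outer (\<Union>n. U n)" using U by (intro outer_mono) auto
    also have "\<dots> = vol (\<Union>n. U n)" using U by (intro outer_open) auto
    also have "\<dots> \<le> (\<Sum>n. vol (U n))" by (rule vol_UN[OF U(1)])
    also have "\<dots> \<le> (\<Sum>n. outer (E n) + ennreal (e * (1/2) ^ Suc n))" by (intro suminf_le U(3)) auto
    also have "\<dots> = (\<Sum>n. outer (E n)) + (\<Sum>n. ennreal (e * (1/2) ^ Suc n))" by (rule suminf_add[symmetric]) auto
    also have "(\<Sum>n. ennreal (e * (1/2) ^ Suc n)) = ennreal e"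
      using e sums_mult[OF power_half_series, of e] by (intro suminf_ennreal_eq) auto
    finally show "outer (\<Union>n. E n) \<le> (\<Sum>n. outer (E n)) + ennreal e" .
  qed
qed

text \<open>A function below \<open>W \<inter> U\<close>, cut off at \<open>e\<close>, and a function below the open set of points of \<open>W\<close> where the
first one is less than \<open>e\<close> have disjoint supports, so their sum is below \<open>W\<close>.\<close>

lemma open_split:
  assumes U: "openin X U" and W: "openin X W"
  shows "vol (W \<inter> U) + outer (W - U) \<le> vol W"
proof -
  have "ennreal (\<Lambda> f) + outer (W - U) \<le> vol W" if f: "f \<in> under (W \<inter> U)" for f
  proof (rule ennreal_le_epsilon)
    fix e :: real assume e: "0 < e"
    have fA: "f \<in> A" and f0: "\<And>x. x \<in> \<Omega> \<Longrightarrow> 0 \<le> f x \<and> f x \<le> 1" using f by (auto simp: under_def)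
    define C where "C = {x \<in> \<Omega>. e \<le> f x}"
    have C: "closedin X C" unfolding C_def by (intro closed_superlevel fA)
    define h where "h = (\<lambda>x. max 0 (f x - e))"
    have h: "h \<in> A" "\<Lambda> f \<le> \<Lambda> h + e" using cut_off[OF fA e] f0 by (auto simp: h_def)
    have h0: "0 \<le> \<Lambda> h" by (rule \<Lambda>_pos[OF h(1)]) (simp add: h_def)
    have CU: "C \<subseteq> W \<inter> U" using f e by (force simp: C_def under_def)
    have "outer (W - U) \<le> outer (W - C)" using CU by (intro outer_mono) auto
    also have "\<dots> = vol (W - C)" using W C by (intro outer_open openin_diff)
    finally have 1: "outer (W - U) \<le> vol (W - C)" .
    have "ennreal (\<Lambda> h) + vol (W - C) = (SUP g\<in>under (W - C). ennreal (\<Lambda> h) + ennreal (\<Lambda> g))"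
      unfolding vol_def using zero_under by (intro ennreal_SUP_add_right) auto
    also have "\<dots> \<le> vol W"
    proof (rule SUP_least)
      fix g assume g: "g \<in> under (W - C)"
      have gA: "g \<in> A" using g by (simp add: under_def)
      have "(\<lambda>x. h x + g x) \<in> under W"
        unfolding under_def mem_Collect_eq
      proof (intro conjI ballI impI)
        show "(\<lambda>x. h x + g x) \<in> A" by (intro add h gA)
        fix x assume x: "x \<in> \<Omega>"
        show "0 \<le> h x + g x" using g x by (simp add: h_def under_def)
        show "h x + g x \<le> 1" using g x f0[OF x] e by (cases "x \<in> C") (auto simp: h_def under_def C_def)
        assume "x \<notin> W"
        then show "h x + g x = 0" using g f x e by (auto simp: h_def under_def)
      qed
      from vol_upper[OF this] show "ennreal (\<Lambda> h) + ennreal (\<Lambda> g) \<le> vol W"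
        using h0 under_nonneg[OF g] by (simp add: \<Lambda>_add h gA)
    qed
    finally have 2: "ennreal (\<Lambda> h) + vol (W - C) \<le> vol W" .
    have "ennreal (\<Lambda> f) \<le> ennreal (\<Lambda> h) + ennreal e"
      using h h0 e by (simp flip: ennreal_plus add: ennreal_leI)
    then have "ennreal (\<Lambda> f) + outer (W - U) \<le> (ennreal (\<Lambda> h) + ennreal e) + vol (W - C)"
      by (rule add_mono[OF _ 1])
    also have "\<dots> = (ennreal (\<Lambda> h) + vol (W - C)) + ennreal e" by (simp add: ac_simps)
    also have "\<dots> \<le> vol W + ennreal e" using 2 by (rule add_right_mono)
    finally show "ennreal (\<Lambda> f) + outer (W - U) \<le> vol W + ennreal e" .
  qed
  moreover have "vol (W \<inter> U) + outer (W - U) = (SUP f\<in>under (W \<inter> U). ennreal (\<Lambda> f) + outer (W - U))"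
    unfolding vol_def using zero_under by (intro ennreal_SUP_add_left[symmetric]) auto
  ultimately show ?thesis by (auto intro: SUP_least)
qed

abbreviation "Bor \<equiv> sigma_sets \<Omega> {U. openin X U}"

definition "\<mu> = measure_of \<Omega> Bor outer"

lemma open_in_lambda:
  assumes U: "openin X U"
  shows "U \<in> lambda_system \<Omega> (Pow \<Omega>) outer"
proof -
  interpret P: sigma_algebra \<Omega> "Pow \<Omega>" by (rule sigma_algebra_Pow)
  have UO: "U \<subseteq> \<Omega>" using U openin_subset by blast
  have le: "outer (E \<inter> U) + outer (E - U) \<le> outer E" if E: "E \<subseteq> \<Omega>" for E
  proof (rule ennreal_le_epsilon)
    fix e :: real assume "0 < e"
    then obtain W where W: "openin X W" "E \<subseteq> W" "vol W \<le> outer E + ennreal e" using outer_approx[OF E] by blast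
    have "outer (E \<inter> U) + outer (E - U) \<le> outer (W \<inter> U) + outer (W - U)"
      using W by (intro add_mono outer_mono) auto
    also have "\<dots> = vol (W \<inter> U) + outer (W - U)" using W U by (simp add: outer_open openin_Int)
    also have "\<dots> \<le> vol W" by (rule open_split[OF U W(1)])
    finally show "outer (E \<inter> U) + outer (E - U) \<le> outer E + ennreal e" using W(3) by simp
  qed
  have ge: "outer E \<le> outer (E \<inter> U) + outer (E - U)" if E: "E \<subseteq> \<Omega>" for E
  proof -
    have "outer ((E \<inter> U) \<union> (E - U)) \<le> outer (E \<inter> U) + outer (E - U)"
    proof -
      have "subadditive (Pow \<Omega>) outer"
        using outer_measure unfolding outer_measure_space_def
        by (intro P.countably_subadditive_subadditive) simp_all
      then have "\<forall>x\<in>Pow \<Omega>. \<forall>y\<in>Pow \<Omega>. x \<inter> y = {} \<longrightarrow> outer (x \<union> y) \<le> outer x + outer y"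
        by (simp only: subadditive_def)
      moreover have "E \<inter> U \<in> Pow \<Omega>" "E - U \<in> Pow \<Omega>" "(E \<inter> U) \<inter> (E - U) = {}" using E by auto
      ultimately show ?thesis by (simp only:)
    qed
    moreover have "(E \<inter> U) \<union> (E - U) = E" by auto
    ultimately show ?thesis by simp
  qed
  show ?thesis unfolding P.lambda_system_eq using UO le ge by (auto intro!: antisym)
qed

lemma measure_space_outer: "measure_space \<Omega> Bor outer"
proof -
  interpret P: sigma_algebra \<Omega> "Pow \<Omega>" by (rule sigma_algebra_Pow)
  have L: "measure_space \<Omega> (lambda_system \<Omega> (Pow \<Omega>) outer) outer"
    by (rule P.caratheodory_lemma[OF outer_measure])
  then interpret L: sigma_algebra \<Omega> "lambda_system \<Omega> (Pow \<Omega>) outer" by (simp add: measure_space_def)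
  have "Bor \<subseteq> lambda_system \<Omega> (Pow \<Omega>) outer"
    by (rule L.sigma_sets_subset) (use open_in_lambda in auto)
  then show ?thesis
    by (rule measure_down[OF L, rotated]) (rule sigma_algebra_sigma_sets, use openin_subset in auto)
qed

lemma openP: "{U. openin X U} \<subseteq> Pow \<Omega>" using openin_subset by auto

lemma sets_\<mu>: "sets \<mu> = Bor" and space_\<mu>: "space \<mu> = \<Omega>"
proof -
  interpret S: sigma_algebra \<Omega> Bor by (rule sigma_algebra_sigma_sets[OF openP])
  show "sets \<mu> = Bor" "space \<mu> = \<Omega>" unfolding \<mu>_def by (auto simp: S.sets_measure_of_eq S.space_measure_of_eq)
qed

lemma emeasure_\<mu>: "B \<in> Bor \<Longrightarrow> emeasure \<mu> B = outer B"
  using measure_space_outer unfolding \<mu>_def measure_space_def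
  by (intro emeasure_measure_of_sigma) auto

lemma open_Bor: "openin X U \<Longrightarrow> U \<in> Bor" by auto

lemma prob_\<mu>: "prob_space \<mu>"
  by (rule prob_spaceI) (simp add: space_\<mu> emeasure_\<mu> open_Bor outer_open vol_topspace)

lemma regular_\<mu>: "regular_borel_prob X \<mu>"
  unfolding regular_borel_prob_def
proof (intro conjI ballI prob_\<mu> space_\<mu> sets_\<mu>)
  interpret prob_space \<mu> by (rule prob_\<mu>)
  have outer': "emeasure \<mu> B = (INF U\<in>{U. openin X U \<and> B \<subseteq> U}. emeasure \<mu> U)" if B: "B \<in> sets \<mu>" for B
  proof -
    have "(INF U\<in>{U. openin X U \<and> B \<subseteq> U}. emeasure \<mu> U) = (INF U\<in>{U. openin X U \<and> B \<subseteq> U}. vol U)"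
      by (intro INF_cong) (auto simp: emeasure_\<mu> outer_open)
    then show ?thesis using B by (simp add: emeasure_\<mu> sets_\<mu> outer_def)
  qed
  show "emeasure \<mu> B = (INF U\<in>{U. openin X U \<and> B \<subseteq> U}. emeasure \<mu> U)" if "B \<in> sets \<mu>" for B by (rule outer'[OF that])
  show "emeasure \<mu> B = (SUP C\<in>{C. compactin X C \<and> C \<subseteq> B}. emeasure \<mu> C)" if B: "B \<in> sets \<mu>" for B
  proof (rule antisym)
    show "(SUP C\<in>{C. compactin X C \<and> C \<subseteq> B}. emeasure \<mu> C) \<le> emeasure \<mu> B"
      by (rule SUP_least) (use B in \<open>auto intro: emeasure_mono\<close>)
    show "emeasure \<mu> B \<le> (SUP C\<in>{C. compactin X C \<and> C \<subseteq> B}. emeasure \<mu> C)"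
    proof (rule ennreal_le_epsilon)
      fix e :: real assume e: "0 < e"
      have BO: "B \<subseteq> \<Omega>" using sets.sets_into_space[OF B] by (simp add: space_\<mu>)
      obtain U where U: "openin X U" "\<Omega> - B \<subseteq> U" "vol U \<le> outer (\<Omega> - B) + ennreal e"
        using outer_approx[of "\<Omega> - B" e] e by auto
      have Us: "U \<in> sets \<mu>" "\<Omega> - B \<in> sets \<mu>"
        using open_Bor[OF U(1)] sets.compl_sets[OF B] by (simp_all add: space_\<mu> sets_\<mu>)
      have eU: "emeasure \<mu> U \<le> emeasure \<mu> (\<Omega> - B) + ennreal e"
        using U Us by (simp add: emeasure_\<mu> sets_\<mu> outer_open)
      then have mU: "measure \<mu> U \<le> measure \<mu> (\<Omega> - B) + e"
        using e by (simp add: emeasure_eq_measure flip: ennreal_plus)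
      define C where "C = \<Omega> - U"
      have C: "compactin X C" "C \<subseteq> B"
        using U(2) closed_compact[OF closedin_diff[OF closedin_topspace U(1)]] by (auto simp: C_def)
      have "measure \<mu> C = 1 - measure \<mu> U" "measure \<mu> (\<Omega> - B) = 1 - measure \<mu> B"
        using prob_compl[OF Us(1)] prob_compl[OF B] by (simp_all add: C_def space_\<mu>)
      then have "measure \<mu> B \<le> measure \<mu> C + e" using mU by simp
      then have "emeasure \<mu> B \<le> emeasure \<mu> C + ennreal e"
        using e by (simp add: emeasure_eq_measure flip: ennreal_plus)
      also have "emeasure \<mu> C \<le> (SUP C\<in>{C. compactin X C \<and> C \<subseteq> B}. emeasure \<mu> C)"
        using C by (intro SUP_upper) auto
      finally show "emeasure \<mu> B \<le> (SUP C\<in>{C. compactin X C \<and> C \<subseteq> B}. emeasure \<mu> C) + ennreal e"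
        by (simp add: add_right_mono)
    qed
  qed
qed

lemma integrable_A:
  assumes "prob_space M" "sets M = Bor" "space M = \<Omega>" "f \<in> A"
  shows "integrable M f"
proof -
  interpret prob_space M by fact
  have m: "f \<in> borel_measurable M"
  proof (rule borel_measurableI)
    fix S :: "real set" assume "open S"
    then have "openin X {x \<in> \<Omega>. f x \<in> S}" using openin_continuous_map_preimage[OF cont[OF assms(4)], of S] by simp
    moreover have "f -` S \<inter> space M = {x \<in> \<Omega>. f x \<in> S}" using assms(3) by auto
    ultimately show "f -` S \<inter> space M \<in> sets M" using assms(2) by auto
  qed
  have "compact (f ` \<Omega>)"
    using image_compactin[OF _ cont[OF assms(4)], of \<Omega>] compact by (simp add: compact_space_def)
  then have "bounded (f ` \<Omega>)" by (rule compact_imp_bounded)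
  then obtain b where "\<forall>x\<in>\<Omega>. norm (f x) \<le> b" by (auto simp: bounded_iff)
  then show ?thesis using assms(3) m by (intro integrable_const_bound[of _ b]) auto
qed

lemma slice_sum:
  fixes y :: real assumes "0 \<le> y" "n > 0"
  shows "(\<Sum>i<m. min (1 / real n) (max 0 (y - real i / n))) = min y (real m / n)"
proof (induction m)
  case 0 then show ?case using assms by simp
next
  case (Suc m)
  have *: "min y a + min b (max 0 (y - a)) = min y (a + b)" if "0 < b" for a b :: real
    using that by auto
  have "real (Suc m) / n = real m / n + 1 / n" by (simp add: add_divide_distrib)
  then show ?case using *[of "1 / real n" "real m / n"] assms unfolding sum.lessThan_Suc Suc by simp
qed

text \<open>Cut \<open>f\<close> into \<open>n\<close> horizontal slices \<open>h i\<close> of height \<open>1 / n\<close>. Both \<open>\<Lambda> (h i)\<close> and the integral of \<open>h i\<close> lie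
between \<open>p (Suc i) / n\<close> and \<open>p i / n\<close>, where \<open>p i\<close> is the measure of the set where \<open>f\<close> exceeds \<open>i / n\<close>. These
bounds telescope, so the two functionals differ by at most \<open>1 / n\<close> at \<open>f\<close>.\<close>

lemma integral_eq_\<Lambda>_unit:
  assumes f: "f \<in> under \<Omega>"
  shows "\<Lambda> f = (\<integral>x. f x \<partial>\<mu>)"
proof -
  interpret prob_space \<mu> by (rule prob_\<mu>)
  have fA: "f \<in> A" and f0: "\<And>x. x \<in> \<Omega> \<Longrightarrow> 0 \<le> f x \<and> f x \<le> 1" using f by (auto simp: under_def)
  have int: "g \<in> A \<Longrightarrow> integrable \<mu> g" for g by (rule integrable_A[OF prob_\<mu> sets_\<mu> space_\<mu>])
  have lev: "{x \<in> \<Omega>. c < f x} \<in> sets \<mu>" for c using open_superlevel[OF fA] by (simp add: sets_\<mu> open_Bor)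
  have key: "\<bar>\<Lambda> f - (\<integral>x. f x \<partial>\<mu>)\<bar> \<le> 1 / real n" if n: "n > 0" for n :: nat
  proof -
    define h where "h i = (\<lambda>x. min (1 / real n) (max 0 (f x - real i / n)))" for i
    have hA: "h i \<in> A" for i unfolding h_def by (intro min max const diff fA)
    have hsum: "(\<Sum>i<n. h i x) = f x" if "x \<in> \<Omega>" for x
      using slice_sum[of "f x" n n] f0[OF that] n by (simp add: h_def)
    define p where "p i = measure \<mu> {x \<in> \<Omega>. real i / n < f x}" for i :: nat
    have bd: "p (Suc i) / n \<le> \<Lambda> (h i) \<and> \<Lambda> (h i) \<le> p i / n \<and> p (Suc i) / n \<le> (\<integral>x. h i x \<partial>\<mu>) \<and> (\<integral>x. h i x \<partial>\<mu>) \<le> p i / n" for i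
    proof -
      have nh: "(\<lambda>x. n * h i x) \<in> under {x \<in> \<Omega>. real i / n < f x}"
        unfolding under_def mem_Collect_eq
      proof (intro conjI ballI impI)
        show "(\<lambda>x. n * h i x) \<in> A" by (intro scale hA)
      next
        fix x assume "x \<in> \<Omega>"
        show "0 \<le> n * h i x" by (simp add: h_def)
        have "real n * h i x \<le> real n * (1 / real n)" by (intro mult_left_mono) (auto simp: h_def)
        then show "real n * h i x \<le> 1" using n by simp
        assume "\<not> (x \<in> \<Omega> \<and> real i / n < f x)"
        then show "n * h i x = 0" using \<open>x \<in> \<Omega>\<close> by (simp add: h_def)
      qed
      have "ennreal (\<Lambda> (\<lambda>x. n * h i x)) \<le> ennreal (p i)"
        using vol_upper[OF nh] open_superlevel[OF fA, of "real i / n"]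
        by (simp add: p_def emeasure_eq_measure[symmetric] emeasure_\<mu> outer_open open_Bor)
      then have u1: "n * \<Lambda> (h i) \<le> p i" by (simp add: \<Lambda>_scale hA p_def)
      have one: "n * h i x = 1" if "real (Suc i) / n < f x" for x
      proof -
        have "real (Suc i) / n = real i / n + 1 / n" by (simp add: add_divide_distrib)
        then have "h i x = 1 / n" using that by (simp add: h_def)
        then show ?thesis using n by simp
      qed
      have "vol {x \<in> \<Omega>. real (Suc i) / n < f x} \<le> ennreal (n * \<Lambda> (h i))"
        unfolding vol_def
      proof (rule SUP_least)
        fix g assume g: "g \<in> under {x \<in> \<Omega>. real (Suc i) / n < f x}"
        have "\<Lambda> g \<le> \<Lambda> (\<lambda>x. n * h i x)"
        proof (rule \<Lambda>_mono)
          fix x assume x: "x \<in> \<Omega>"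
          show "g x \<le> n * h i x"
          proof (cases "real (Suc i) / n < f x")
            case True then show ?thesis using one[OF True] g x by (simp add: under_def)
          next
            case False
            then have "g x = 0" using g x by (auto simp: under_def)
            then show ?thesis by (simp add: h_def)
          qed
        qed (use g in \<open>auto simp: under_def intro: scale hA\<close>)
        then show "ennreal (\<Lambda> g) \<le> ennreal (n * \<Lambda> (h i))" by (simp add: \<Lambda>_scale hA ennreal_leI)
      qed
      then have "ennreal (p (Suc i)) \<le> ennreal (n * \<Lambda> (h i))"
        using open_superlevel[OF fA, of "real (Suc i) / n"]
        by (simp add: p_def emeasure_eq_measure[symmetric] emeasure_\<mu> outer_open open_Bor)
      moreover have "0 \<le> n * \<Lambda> (h i)" using \<Lambda>_pos[OF hA, of i] by (simp add: h_def)
      ultimately have l1: "p (Suc i) \<le> n * \<Lambda> (h i)" by simp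
      have pi: "p j = (\<integral>x. indicator {x \<in> \<Omega>. real j / n < f x} x \<partial>\<mu>)" for j
        using lev[of "real j / n"] by (simp add: p_def)
      have ii: "integrable \<mu> (indicat_real {x \<in> \<Omega>. real j / n < f x})" for j
        using lev[of "real j / n"] by (simp add: integrable_real_indicator emeasure_eq_measure)
      have "(\<integral>x. n * h i x \<partial>\<mu>) \<le> p i" unfolding pi
        by (intro integral_mono ii integrable_mult_right int hA)
          (use nh in \<open>auto simp: under_def indicator_def space_\<mu>\<close>)
      then have u2: "n * (\<integral>x. h i x \<partial>\<mu>) \<le> p i" by simp
      have "p (Suc i) \<le> (\<integral>x. n * h i x \<partial>\<mu>)" unfolding pi
        by (intro integral_mono ii integrable_mult_right int hA)
          (use one in \<open>auto simp: indicator_def h_def simp del: of_nat_Suc\<close>)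
      then have l2: "p (Suc i) \<le> n * (\<integral>x. h i x \<partial>\<mu>)" by simp
      show ?thesis using u1 l1 u2 l2 n by (simp add: field_simps)
    qed
    have "\<Lambda> f = \<Lambda> (\<lambda>x. \<Sum>i<n. h i x)" by (intro \<Lambda>_cong fA conjunct1[OF sum] hA) (auto simp: hsum)
    also have "\<dots> = (\<Sum>i<n. \<Lambda> (h i))" by (intro conjunct2[OF sum] hA) auto
    finally have 1: "\<Lambda> f = (\<Sum>i<n. \<Lambda> (h i))" .
    have "(\<integral>x. f x \<partial>\<mu>) = (\<integral>x. (\<Sum>i<n. h i x) \<partial>\<mu>)" by (rule Bochner_Integration.integral_cong) (auto simp: hsum space_\<mu>)
    also have "\<dots> = (\<Sum>i<n. (\<integral>x. h i x \<partial>\<mu>))" by (rule Bochner_Integration.integral_sum) (intro int hA)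
    finally have 2: "(\<integral>x. f x \<partial>\<mu>) = (\<Sum>i<n. (\<integral>x. h i x \<partial>\<mu>))" .
    have "\<bar>\<Lambda> f - (\<integral>x. f x \<partial>\<mu>)\<bar> \<le> (\<Sum>i<n. \<bar>\<Lambda> (h i) - (\<integral>x. h i x \<partial>\<mu>)\<bar>)"
      unfolding 1 2 sum_subtractf[symmetric] by (rule sum_abs)
    also have "\<dots> \<le> (\<Sum>i<n. p i / n - p (Suc i) / n)"
    proof (rule sum_mono)
      fix i show "\<bar>\<Lambda> (h i) - (\<integral>x. h i x \<partial>\<mu>)\<bar> \<le> p i / n - p (Suc i) / n" using bd[of i] by linarith
    qed
    also have "\<dots> = p 0 / n - p n / n" by (rule sum_lessThan_telescope')
    also have "\<dots> \<le> 1 / n"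
    proof -
      have "p 0 \<le> 1" "0 \<le> p n" by (auto simp: p_def)
      then have "p 0 / n \<le> 1 / n" "0 \<le> p n / n" by (auto intro: divide_right_mono)
      then show ?thesis by linarith
    qed
    finally show ?thesis .
  qed
  have "\<bar>\<Lambda> f - (\<integral>x. f x \<partial>\<mu>)\<bar> \<le> 0"
  proof (rule ccontr)
    assume "\<not> ?thesis"
    then have "0 < \<bar>\<Lambda> f - (\<integral>x. f x \<partial>\<mu>)\<bar>" by simp
    then obtain n where "0 < n" "1 / real n < \<bar>\<Lambda> f - (\<integral>x. f x \<partial>\<mu>)\<bar>"
      by (rule ex_inverse_of_nat_less[THEN exE]) (auto simp: inverse_eq_divide)
    then show False using key[of n] by simp
  qed
  then show ?thesis by simp
qed

lemma integral_eq_\<Lambda>: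
  assumes f: "f \<in> A"
  shows "\<Lambda> f = (\<integral>x. f x \<partial>\<mu>)"
proof -
  interpret prob_space \<mu> by (rule prob_\<mu>)
  have int: "g \<in> A \<Longrightarrow> integrable \<mu> g" for g by (rule integrable_A[OF prob_\<mu> sets_\<mu> space_\<mu>])
  have "compact (f ` \<Omega>)"
    using image_compactin[OF _ cont[OF f], of \<Omega>] compact by (simp add: compact_space_def)
  then have "bounded (f ` \<Omega>)" by (rule compact_imp_bounded)
  then obtain b where b: "b > 0" "\<forall>x\<in>\<Omega>. norm (f x) \<le> b" by (auto simp: bounded_pos)
  define g where "g = (\<lambda>x. (1 / (2 * b)) * (f x + b))"
  have gA: "g \<in> A" unfolding g_def by (intro scale add const f)
  have "g \<in> under \<Omega>"
    using gA b by (auto simp: under_def g_def field_simps abs_le_iff)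
  then have "\<Lambda> g = (\<integral>x. g x \<partial>\<mu>)" by (rule integral_eq_\<Lambda>_unit)
  moreover have "\<Lambda> g = (1 / (2 * b)) * (\<Lambda> f + b)"
    unfolding g_def by (simp only: \<Lambda>_scale add const f \<Lambda>_add \<Lambda>_const)
  moreover have "(\<integral>x. g x \<partial>\<mu>) = (1 / (2 * b)) * ((\<integral>x. f x \<partial>\<mu>) + b)"
    unfolding g_def using int[OF f] by (simp add: prob_space)
  ultimately show ?thesis using b by simp
qed

text \<open>This gives uniqueness: inner regularity and Urysohn functions determine the measure on open sets, and
outer regularity on all others.\<close>

lemma emeasure_open_eq_vol:
  assumes reg: "regular_borel_prob X M" and rep: "\<And>f. f \<in> A \<Longrightarrow> \<Lambda> f = (\<integral>x. f x \<partial>M)" and U: "openin X U"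
  shows "emeasure M U = vol U"
proof -
  have M: "prob_space M" "sets M = Bor" "space M = \<Omega>" using reg by (auto simp: regular_borel_prob_def)
  interpret prob_space M by fact
  have UM: "U \<in> sets M" using U M by auto
  have ind: "B \<in> sets M \<Longrightarrow> integrable M (indicat_real B)" for B
    by (simp add: integrable_real_indicator emeasure_eq_measure)
  show ?thesis
  proof (rule antisym)
    have "emeasure M U = (SUP C\<in>{C. compactin X C \<and> C \<subseteq> U}. emeasure M C)"
      using reg UM unfolding regular_borel_prob_def by blast
    also have "\<dots> \<le> vol U"
    proof (rule SUP_least)
      fix C assume "C \<in> {C. compactin X C \<and> C \<subseteq> U}"
      then obtain f where f: "f \<in> under U" "\<forall>x\<in>C. f x = 1" using urysohn[OF _ U] by blast
      show "emeasure M C \<le> vol U"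
      proof (cases "C \<in> sets M")
        case True
        have "measure M C = (\<integral>x. indicator C x \<partial>M)" using True by simp
        also have "\<dots> \<le> (\<integral>x. f x \<partial>M)"
          using f True M by (intro integral_mono ind integrable_A) (auto simp: under_def indicator_def)
        also have "\<dots> = \<Lambda> f" using rep f by (simp add: under_def)
        finally show ?thesis using vol_upper[OF f(1)] ennreal_leI[of "measure M C" "\<Lambda> f"]
          by (simp add: emeasure_eq_measure)
      qed (simp add: emeasure_notin_sets)
    qed
    finally show "emeasure M U \<le> vol U" .
    show "vol U \<le> emeasure M U"
      unfolding vol_def
    proof (rule SUP_least)
      fix f assume f: "f \<in> under U"
      have "\<Lambda> f = (\<integral>x. f x \<partial>M)" using rep f by (simp add: under_def)
      also have "\<dots> \<le> (\<integral>x. indicator U x \<partial>M)"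
        using f UM M by (intro integral_mono ind integrable_A) (auto simp: under_def indicator_def)
      also have "\<dots> = measure M U" using UM by simp
      finally show "ennreal (\<Lambda> f) \<le> emeasure M U" by (simp add: emeasure_eq_measure ennreal_leI)
    qed
  qed
qed

theorem Riesz_representation:
  "\<exists>!M. regular_borel_prob X M \<and> (\<forall>f\<in>A. \<Lambda> f = (\<integral>x. f x \<partial>M))"
proof (rule ex_ex1I)
  show "\<exists>M. regular_borel_prob X M \<and> (\<forall>f\<in>A. \<Lambda> f = (\<integral>x. f x \<partial>M))"
    using regular_\<mu> integral_eq_\<Lambda> by blast
next
  fix M N
  assume M: "regular_borel_prob X M \<and> (\<forall>f\<in>A. \<Lambda> f = (\<integral>x. f x \<partial>M))"
    and N: "regular_borel_prob X N \<and> (\<forall>f\<in>A. \<Lambda> f = (\<integral>x. f x \<partial>N))"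
  show "M = N"
  proof (rule measure_eqI)
    show s: "sets M = sets N" using M N by (simp add: regular_borel_prob_def)
    fix B assume B: "B \<in> sets M"
    have "emeasure M B = (INF U\<in>{U. openin X U \<and> B \<subseteq> U}. emeasure M U)"
      using M B unfolding regular_borel_prob_def by blast
    also have "\<dots> = (INF U\<in>{U. openin X U \<and> B \<subseteq> U}. emeasure N U)"
      by (intro INF_cong) (use M N in \<open>auto simp: emeasure_open_eq_vol\<close>)
    also have "\<dots> = emeasure N B"
    proof -
      have "\<forall>B\<in>sets N. emeasure N B = (INF U\<in>{U. openin X U \<and> B \<subseteq> U}. emeasure N U)"
        using N unfolding regular_borel_prob_def by blast
      from this[rule_format, of B] show ?thesis using B s by simp
    qed
    finally show "emeasure M B = emeasure N B" .
  qed
qed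

end

section \<open>Left uniformly continuous functions\<close>

text \<open>For a single \<open>v\<close> the supremum may reach the bound that all its terms stay below, which is why one
direction passes through \<open>\<epsilon> / 2\<close>.\<close>

lemma LUC_iff:
  "f \<in> LUC \<longleftrightarrow> bounded (range f) \<and> (\<forall>\<epsilon>>0. \<forall>\<^sub>F v in nhds 1. \<forall>g. cmod (f (v * g) - f g) < \<epsilon>)"
proof -
  have bdd: "bdd_above (range (\<lambda>g. cmod (f (v * g) - f g)))" if b: "bounded (range f)" for v
  proof -
    obtain B where "\<forall>x. cmod (f x) \<le> B" using b by (auto simp: bounded_iff)
    then have "cmod (f (v * g) - f g) \<le> B + B" for g
      by (intro order_trans[OF norm_triangle_ineq4] add_mono) auto
    then show ?thesis by (intro bdd_aboveI[of _ "B + B"]) auto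
  qed
  have 1: "\<forall>g. cmod (f (v * g) - f g) < \<epsilon>" if "bounded (range f)" "(SUP g. cmod (f (v * g) - f g)) < \<epsilon>" for v \<epsilon>
  proof
    fix g
    have "cmod (f (v * g) - f g) \<le> (SUP g. cmod (f (v * g) - f g))"
      by (rule cSUP_upper[OF _ bdd[OF that(1)]]) simp
    then show "cmod (f (v * g) - f g) < \<epsilon>" using that(2) by simp
  qed
  have 2: "(SUP g. cmod (f (v * g) - f g)) \<le> \<epsilon>" if "\<forall>g. cmod (f (v * g) - f g) < \<epsilon>" for v \<epsilon>
    by (rule cSUP_least) (use that in \<open>auto intro: less_imp_le\<close>)
  show ?thesis
  proof
    assume f: "f \<in> LUC"
    show "bounded (range f) \<and> (\<forall>\<epsilon>>0. \<forall>\<^sub>F v in nhds 1. \<forall>g. cmod (f (v * g) - f g) < \<epsilon>)"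
    proof (intro conjI allI impI)
      show b: "bounded (range f)" using f by (simp add: LUC_def)
      fix \<epsilon> :: real assume "\<epsilon> > 0"
      then have "\<forall>\<^sub>F v in nhds 1. (SUP g. cmod (f (v * g) - f g)) < \<epsilon>" using f by (simp add: LUC_def)
      then show "\<forall>\<^sub>F v in nhds 1. \<forall>g. cmod (f (v * g) - f g) < \<epsilon>"
        by (rule eventually_mono) (rule 1[OF b])
    qed
  next
    assume f: "bounded (range f) \<and> (\<forall>\<epsilon>>0. \<forall>\<^sub>F v in nhds 1. \<forall>g. cmod (f (v * g) - f g) < \<epsilon>)"
    have "\<forall>\<^sub>F v in nhds 1. (SUP g. cmod (f (v * g) - f g)) < \<epsilon>" if e: "\<epsilon> > 0" for \<epsilon>
    proof -
      have "\<forall>\<^sub>F v in nhds 1. \<forall>g. cmod (f (v * g) - f g) < \<epsilon> / 2" using f half_gt_zero[OF e] by blast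
      then show ?thesis
      proof (rule eventually_mono)
        fix v assume "\<forall>g. cmod (f (v * g) - f g) < \<epsilon> / 2"
        from 2[OF this] show "(SUP g. cmod (f (v * g) - f g)) < \<epsilon>" using e by simp
      qed
    qed
    then show "f \<in> LUC" using f by (simp add: LUC_def)
  qed
qed

lemma LUC_bounded: "f \<in> LUC \<Longrightarrow> \<exists>B>0. \<forall>x. cmod (f x) \<le> B"
  by (auto simp: LUC_iff bounded_pos)

text \<open>The values of \<open>f\<close> and \<open>h\<close> stay in a compact set, on which \<open>P\<close> is uniformly continuous. All closure
properties of left uniformly continuous functions are instances.\<close>

lemma LUC_comp:
  assumes f: "f \<in> LUC" and h: "h \<in> LUC" and P: "continuous_on UNIV (\<lambda>(a, b). P a b)"
  shows "(\<lambda>x. P (f x) (h x)) \<in> LUC"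
proof -
  obtain R1 where R1: "\<And>x. cmod (f x) \<le> R1" using LUC_bounded[OF f] by blast
  obtain R2 where R2: "\<And>x. cmod (h x) \<le> R2" using LUC_bounded[OF h] by blast
  define C where "C = cball (0::complex) R1 \<times> cball (0::complex) R2"
  have C: "compact C" unfolding C_def by (intro compact_Times compact_cball)
  have inC: "(f x, h x) \<in> C" for x using R1 R2 by (simp add: C_def)
  have PC: "continuous_on C (\<lambda>(a, b). P a b)" using P continuous_on_subset by blast
  have "bounded ((\<lambda>(a, b). P a b) ` C)" using C PC by (intro compact_imp_bounded compact_continuous_image)
  moreover have "range (\<lambda>x. P (f x) (h x)) \<subseteq> (\<lambda>(a, b). P a b) ` C" using inC by force
  ultimately have b: "bounded (range (\<lambda>x. P (f x) (h x)))" by (rule bounded_subset)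
  have uc: "uniformly_continuous_on C (\<lambda>(a, b). P a b)" by (rule compact_uniformly_continuous[OF PC C])
  show ?thesis unfolding LUC_iff
  proof (intro conjI b allI impI)
    fix \<epsilon> :: real assume "\<epsilon> > 0"
    then obtain d where d: "d > 0" "\<And>p q. p \<in> C \<Longrightarrow> q \<in> C \<Longrightarrow> dist q p < d \<Longrightarrow> dist ((\<lambda>(a, b). P a b) q) ((\<lambda>(a, b). P a b) p) < \<epsilon>"
      using uc unfolding uniformly_continuous_on_def by metis
    have "\<forall>\<^sub>F v in nhds 1. \<forall>g. cmod (f (v * g) - f g) < d / 2" "\<forall>\<^sub>F v in nhds 1. \<forall>g. cmod (h (v * g) - h g) < d / 2"
      using f h half_gt_zero[OF d(1)] unfolding LUC_iff by blast+
    then show "\<forall>\<^sub>F v in nhds 1. \<forall>g. cmod (P (f (v * g)) (h (v * g)) - P (f g) (h g)) < \<epsilon>"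
    proof eventually_elim
      case (elim v)
      show ?case
      proof
        fix g
        have "dist (f (v * g), h (v * g)) (f g, h g) \<le> dist (f (v * g)) (f g) + dist (h (v * g)) (h g)"
          unfolding dist_Pair_Pair by (rule sqrt_sum_squares_le_sum) auto
        also have "\<dots> < d" using elim by (smt (verit) dist_norm field_sum_of_halves)
        finally show "cmod (P (f (v * g)) (h (v * g)) - P (f g) (h g)) < \<epsilon>"
          using d(2)[OF inC inC] by (fastforce simp: dist_norm)
      qed
    qed
  qed
qed

lemma LUC_const: "(\<lambda>_. c) \<in> LUC" by (simp add: LUC_iff)

lemma LUC_add: "f \<in> LUC \<Longrightarrow> h \<in> LUC \<Longrightarrow> (\<lambda>x. f x + h x) \<in> LUC"
  by (rule LUC_comp) (auto simp: case_prod_unfold intro!: continuous_intros)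
lemma LUC_mult: "f \<in> LUC \<Longrightarrow> h \<in> LUC \<Longrightarrow> (\<lambda>x. f x * h x) \<in> LUC"
  by (rule LUC_comp) (auto simp: case_prod_unfold intro!: continuous_intros)
lemma LUC_cnj: "f \<in> LUC \<Longrightarrow> (\<lambda>x. cnj (f x)) \<in> LUC"
  by (rule LUC_comp[of f f "\<lambda>a b. cnj a"]) (auto simp: case_prod_unfold intro!: continuous_intros)
lemma LUC_sum: "finite S \<Longrightarrow> (\<And>s. s \<in> S \<Longrightarrow> F s \<in> LUC) \<Longrightarrow> (\<lambda>x. \<Sum>s\<in>S. F s x) \<in> LUC"
  by (induction S rule: finite_induct) (auto simp: LUC_const LUC_add)

definition LUCR :: "('g::topological_group_mult \<Rightarrow> real) set" where
  "LUCR = {f. (\<lambda>x. complex_of_real (f x)) \<in> LUC}"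

lemma LUCR_comp:
  assumes "f \<in> LUCR" "h \<in> LUCR" "continuous_on UNIV (\<lambda>(a, b). P a b)"
  shows "(\<lambda>x. P (f x) (h x)) \<in> LUCR"
proof -
  have "(\<lambda>x. (\<lambda>a b. complex_of_real (P (Re a) (Re b))) (complex_of_real (f x)) (complex_of_real (h x))) \<in> LUC"
  proof (rule LUC_comp[where P = "\<lambda>a b. complex_of_real (P (Re a) (Re b))"])
    have "continuous_on UNIV (\<lambda>p. (\<lambda>(a, b). P a b) (Re (fst p), Re (snd p)))"
      by (rule continuous_on_compose2[OF assms(3)]) (auto intro!: continuous_intros)
    then show "continuous_on UNIV (\<lambda>(a, b). complex_of_real (P (Re a) (Re b)))"
      by (auto simp: case_prod_unfold intro!: continuous_intros)
  qed (use assms in \<open>auto simp: LUCR_def\<close>)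
  then show ?thesis by (simp add: LUCR_def)
qed

lemma LUCR_const: "(\<lambda>_. c) \<in> LUCR" by (simp add: LUCR_def LUC_const)
lemma LUCR_Re: "f \<in> LUC \<Longrightarrow> (\<lambda>x. Re (f x)) \<in> LUCR"
  unfolding LUCR_def mem_Collect_eq
  by (rule LUC_comp[of f f "\<lambda>a b. complex_of_real (Re a)"]) (auto simp: case_prod_unfold intro!: continuous_intros)
lemma LUCR_Im: "f \<in> LUC \<Longrightarrow> (\<lambda>x. Im (f x)) \<in> LUCR"
  unfolding LUCR_def mem_Collect_eq
  by (rule LUC_comp[of f f "\<lambda>a b. complex_of_real (Im a)"]) (auto simp: case_prod_unfold intro!: continuous_intros)
lemma LUCR_sum: "finite S \<Longrightarrow> (\<And>s. s \<in> S \<Longrightarrow> F s \<in> LUCR) \<Longrightarrow> (\<lambda>x. \<Sum>s\<in>S. F s x) \<in> LUCR"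
  unfolding LUCR_def by (simp add: LUC_sum)

section \<open>The Gelfand space\<close>

text \<open>A functional in the closure of the point evaluations, with respect to pointwise convergence. Such
functionals commute with continuous operations on functions, by passing to the limit along points
(\<open>pointlike_comp\<close>), and turn out to be exactly the characters.\<close>

definition pointlike :: "(('g::topological_group_mult \<Rightarrow> complex) \<Rightarrow> complex) \<Rightarrow> bool" where
  "pointlike z \<longleftrightarrow> (\<forall>S \<epsilon>. finite S \<longrightarrow> S \<subseteq> LUC \<longrightarrow> \<epsilon> > 0 \<longrightarrow> (\<exists>g. \<forall>f\<in>S. cmod (z f - f g) < \<epsilon>))"

lemma pointlike_seq:
  assumes "pointlike z" "finite S" "S \<subseteq> LUC"
  shows "\<exists>g::nat \<Rightarrow> 'g::topological_group_mult. \<forall>f\<in>S. (\<lambda>n. f (g n)) \<longlonglongrightarrow> z f"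
proof -
  have "\<forall>n::nat. \<exists>g. \<forall>f\<in>S. cmod (z f - f g) < 1 / Suc n"
    using assms by (simp add: pointlike_def)
  then obtain g where g: "\<And>n f. f \<in> S \<Longrightarrow> cmod (z f - f (g n)) < 1 / Suc n" by metis
  have "(\<lambda>n. f (g n)) \<longlonglongrightarrow> z f" if "f \<in> S" for f
  proof -
    have "(\<lambda>n. f (g n) - z f) \<longlonglongrightarrow> 0"
    proof (rule Lim_null_comparison)
      show "\<forall>\<^sub>F n in sequentially. norm (f (g n) - z f) \<le> 1 / Suc n"
        using g[OF that] by (intro always_eventually allI) (simp add: norm_minus_commute less_imp_le)
      show "(\<lambda>n. 1 / real (Suc n)) \<longlonglongrightarrow> 0" by (rule LIMSEQ_Suc[OF lim_1_over_n])
    qed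
    then show ?thesis by (simp add: LIM_zero_iff)
  qed
  then show ?thesis by blast
qed

lemma pointlike_comp:
  assumes z: "pointlike z" and f: "f \<in> LUC" "h \<in> LUC" and P: "continuous_on UNIV (\<lambda>(a, b). P a b)"
  shows "z (\<lambda>x. P (f x) (h x)) = P (z f) (z h)"
proof -
  have "\<exists>g. \<forall>k\<in>{f, h, \<lambda>x. P (f x) (h x)}. (\<lambda>n. k (g n)) \<longlonglongrightarrow> z k"
    using f LUC_comp[OF f P] by (intro pointlike_seq[OF z]) auto
  then obtain g where g: "(\<lambda>n. f (g n)) \<longlonglongrightarrow> z f" "(\<lambda>n. h (g n)) \<longlonglongrightarrow> z h" "(\<lambda>n. P (f (g n)) (h (g n))) \<longlonglongrightarrow> z (\<lambda>x. P (f x) (h x))"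
    by auto
  have "(\<lambda>n. (\<lambda>(a, b). P a b) (f (g n), h (g n))) \<longlonglongrightarrow> (\<lambda>(a, b). P a b) (z f, z h)"
    by (rule continuous_on_tendsto_compose[OF P tendsto_Pair[OF g(1,2)]]) auto
  then show ?thesis using g(3) LIMSEQ_unique by auto
qed

lemma pointlike_sum:
  assumes z: "pointlike z" and S: "finite S" "\<And>s. s \<in> S \<Longrightarrow> F s \<in> LUC"
  shows "z (\<lambda>x. \<Sum>s\<in>S. F s x) = (\<Sum>s\<in>S. z (F s))"
  using S
proof (induction S rule: finite_induct)
  case empty
  then show ?case using pointlike_comp[OF z LUC_const LUC_const, of "\<lambda>_ _. 0" 0 0] by simp
next
  case (insert s S)
  then show ?case
    using pointlike_comp[OF z, of "F s" "\<lambda>x. \<Sum>s\<in>S. F s x" "(+)"] LUC_sum[of S F]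
    by (simp add: case_prod_unfold continuous_on_add continuous_on_fst continuous_on_snd)
qed

lemma pointlike_norm_le:
  assumes z: "pointlike z" and f: "f \<in> LUC" and B: "\<And>x. cmod (f x) \<le> B"
  shows "cmod (z f) \<le> B"
proof -
  obtain g where "(\<lambda>n. f (g n)) \<longlonglongrightarrow> z f" using pointlike_seq[OF z, of "{f}"] f by auto
  then show ?thesis using B by (intro LIMSEQ_le_const2[OF tendsto_norm]) auto
qed

lemma point_character_apply: "f \<in> LUC \<Longrightarrow> point_character g f = f g"
  by (simp add: point_character_def)

lemma pointlike_point_character: "pointlike (point_character g)"
  unfolding pointlike_def
proof (intro allI impI exI[of _ g] ballI)
  fix S \<epsilon> and f :: "'a \<Rightarrow> complex" assume "S \<subseteq> LUC" "(0::real) < \<epsilon>" "f \<in> S"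
  then show "cmod (point_character g f - f g) < \<epsilon>" using point_character_apply[of f g] by auto
qed

text \<open>If no point approximated \<open>z\<close> on the finite set \<open>S\<close>, the sum of the \<open>\<bar>f - z f\<bar>\<^sup>2\<close> over \<open>f \<in> S\<close> would be
bounded away from \<open>0\<close>, so its reciprocal would be left uniformly continuous as well; but \<open>z\<close>
annihilates this sum, being multiplicative and compatible with conjugation.\<close>

lemma character_pointlike:
  assumes z: "z \<in> LUC_characters"
  shows "pointlike z"
  unfolding pointlike_def
proof (intro allI impI, rule ccontr)
  fix S :: "('a \<Rightarrow> complex) set" and \<epsilon> :: real
  assume S: "finite S" "S \<subseteq> LUC" and e: "\<epsilon> > 0" and no: "\<not> (\<exists>g. \<forall>f\<in>S. cmod (z f - f g) < \<epsilon>)"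
  have zadd: "z (\<lambda>x. f x + h x) = z f + z h" if "f \<in> LUC" "h \<in> LUC" for f h
    using z that by (simp add: LUC_characters_def LUC_linear_def)
  have zscale: "z (\<lambda>x. c * f x) = c * z f" if "f \<in> LUC" for c f
    using z that by (simp add: LUC_characters_def LUC_linear_def)
  have zmult: "z (\<lambda>x. f x * h x) = z f * z h" if "f \<in> LUC" "h \<in> LUC" for f h
    using z that by (simp add: LUC_characters_def)
  obtain f0 where f0: "f0 \<in> LUC" "z f0 \<noteq> 0" using z by (auto simp: LUC_characters_def)
  have z1: "z (\<lambda>_. 1) = 1" using zmult[OF f0(1) LUC_const, of 1] f0 by simp
  have zc: "z (\<lambda>_. c) = c" for c using zscale[OF LUC_const, of c 1] z1 by simp
  define p where "p f = (\<lambda>x. f x + - z f)" for f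
  have pL: "p f \<in> LUC" if "f \<in> LUC" for f unfolding p_def by (intro LUC_add that LUC_const)
  have zp: "z (p f) = 0" if "f \<in> LUC" for f
    unfolding p_def using zadd[OF that LUC_const, of "- z f"] zc[of "- z f"] by simp
  define F where "F = (\<lambda>x. \<Sum>f\<in>S. p f x * cnj (p f x))"
  have FS: "(\<lambda>x. \<Sum>f\<in>S'. p f x * cnj (p f x)) \<in> LUC \<and> z (\<lambda>x. \<Sum>f\<in>S'. p f x * cnj (p f x)) = 0" if "S' \<subseteq> S" for S'
    using finite_subset[OF that S(1)] that
  proof (induction S' rule: finite_induct)
    case empty then show ?case using zc[of 0] by (simp add: LUC_const)
  next
    case (insert f S')
    then have fL: "f \<in> LUC" using S by auto
    have "(\<lambda>x. p f x * cnj (p f x)) \<in> LUC" "z (\<lambda>x. p f x * cnj (p f x)) = 0"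
      using LUC_mult[OF pL[OF fL] LUC_cnj[OF pL[OF fL]]] zmult[OF pL[OF fL] LUC_cnj[OF pL[OF fL]]] zp[OF fL] by auto
    then show ?case using insert zadd[of "\<lambda>x. p f x * cnj (p f x)" "\<lambda>x. \<Sum>f\<in>S'. p f x * cnj (p f x)"]
      by (simp add: LUC_add)
  qed
  then have F: "F \<in> LUC" "z F = 0" by (auto simp: F_def)
  have Fr: "F x = complex_of_real (\<Sum>f\<in>S. (cmod (p f x))\<^sup>2)" for x
    by (simp add: F_def complex_norm_square del: of_real_power)
  have Flow: "\<epsilon>\<^sup>2 \<le> Re (F x)" for x
  proof -
    obtain f where f: "f \<in> S" "\<epsilon> \<le> cmod (z f - f x)" using no[unfolded not_ex, rule_format, of x] by (auto simp: not_less)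
    have "\<epsilon>\<^sup>2 \<le> (cmod (p f x))\<^sup>2" using f e by (intro power_mono) (auto simp: p_def norm_minus_commute)
    also have "\<dots> \<le> (\<Sum>f\<in>S. (cmod (p f x))\<^sup>2)" using f S by (intro member_le_sum) auto
    finally show ?thesis by (simp add: Fr)
  qed
  \<comment> \<open>The maximum does not change the value, but makes this a continuous function of \<open>F x\<close>.\<close>
  define H where "H = (\<lambda>x. complex_of_real (1 / max (\<epsilon>\<^sup>2) (Re (F x))))"
  have "H \<in> LUC" unfolding H_def
  proof (rule LUC_comp[OF F(1) F(1), of "\<lambda>a b. complex_of_real (1 / max (\<epsilon>\<^sup>2) (Re a))"])
    have "max (\<epsilon>\<^sup>2) (Re a) \<noteq> 0" for a using e by (smt (verit) zero_less_power)
    then show "continuous_on UNIV (\<lambda>(a::complex, b::complex). complex_of_real (1 / max (\<epsilon>\<^sup>2) (Re a)))"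
      by (auto simp: case_prod_unfold intro!: continuous_intros)
  qed
  moreover have "F x * H x = 1" for x
  proof -
    have "Re (F x) > 0" using Flow[of x] e by (smt (verit) zero_less_power)
    moreover have "F x = complex_of_real (Re (F x))" by (simp add: Fr)
    ultimately show ?thesis unfolding H_def using Flow[of x]
      by (metis max.absorb2 mult.commute nonzero_divide_eq_eq of_real_1 of_real_mult less_irrefl)
  qed
  ultimately have "z (\<lambda>_. 1) = z F * z H" using zmult[OF F(1), of H] by simp
  then show False using z1 F(2) by simp
qed

lemma pointlike_character:
  assumes z: "pointlike z" and ext: "z \<in> extensional LUC"
  shows "z \<in> LUC_characters"
  unfolding LUC_characters_def LUC_linear_def mem_Collect_eq
proof (intro conjI ballI allI impI ext)
  show "z (\<lambda>x. f x + h x) = z f + z h" if "f \<in> LUC" "h \<in> LUC" for f h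
    by (rule pointlike_comp[OF z that, of "(+)"]) (auto simp: case_prod_unfold intro!: continuous_intros)
  show "z (\<lambda>x. f x * h x) = z f * z h" if "f \<in> LUC" "h \<in> LUC" for f h
    by (rule pointlike_comp[OF z that, of "(*)"]) (auto simp: case_prod_unfold intro!: continuous_intros)
  show "z (\<lambda>x. c * f x) = c * z f" if "f \<in> LUC" for c f
    by (rule pointlike_comp[OF z that that, of "\<lambda>a b. c * a"]) (auto simp: case_prod_unfold intro!: continuous_intros)
  show "z (\<lambda>x. cnj (f x)) = cnj (z f)" if "f \<in> LUC" for f
    by (rule pointlike_comp[OF z that that, of "\<lambda>a b. cnj a"]) (auto simp: case_prod_unfold intro!: continuous_intros)
  have "z (\<lambda>_. 1) = 1" by (rule pointlike_comp[OF z LUC_const LUC_const, of "\<lambda>a b. 1" 0 0]) auto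
  then show "\<exists>f\<in>LUC. z f \<noteq> 0" using LUC_const[of 1] by (intro bexI[of _ "\<lambda>_. 1"]) auto
  fix f :: "'a \<Rightarrow> complex" and \<epsilon> :: real assume f: "f \<in> LUC" and e: "0 < \<epsilon>"
  show "\<exists>\<delta>>0. \<forall>h\<in>LUC. (SUP x. cmod (h x - f x)) < \<delta> \<longrightarrow> cmod (z h - z f) < \<epsilon>"
  proof (intro exI[of _ \<epsilon>] conjI e ballI impI)
    fix h assume h: "h \<in> LUC" and s: "(SUP x. cmod (h x - f x)) < \<epsilon>"
    have d: "(\<lambda>x. h x - f x) \<in> LUC"
      by (rule LUC_comp[OF h f]) (auto simp: case_prod_unfold intro!: continuous_intros)
    obtain B where "\<And>x. cmod (h x - f x) \<le> B" using LUC_bounded[OF d] by blast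
    then have "bdd_above (range (\<lambda>x. cmod (h x - f x)))" by (intro bdd_aboveI[of _ B]) auto
    then have "cmod (h x - f x) \<le> (SUP x. cmod (h x - f x))" for x by (intro cSUP_upper) auto
    then have "cmod (z (\<lambda>x. h x - f x)) \<le> (SUP x. cmod (h x - f x))" by (rule pointlike_norm_le[OF z d])
    moreover have "z (\<lambda>x. h x - f x) = z h - z f"
      by (rule pointlike_comp[OF z h f]) (auto simp: case_prod_unfold intro!: continuous_intros)
    ultimately show "cmod (z h - z f) < \<epsilon>" using s by simp
  qed
qed

lemma point_character_in: "point_character g \<in> LUC_characters"
  by (rule pointlike_character[OF pointlike_point_character]) (simp add: point_character_def)

abbreviation (input) "prodtop \<equiv> product_topology (\<lambda>_. euclidean) LUC"

lemma LUC_characters_ext: "LUC_characters \<subseteq> topspace prodtop"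
  by (auto simp: LUC_characters_def PiE_def)

lemma topspace_gelfand: "topspace gelfand_topology = LUC_characters"
  using LUC_characters_ext by (auto simp: gelfand_topology_def)

lemma openin_cylinder:
  assumes "finite S" "S \<subseteq> LUC"
  shows "openin prodtop {z \<in> extensional LUC. \<forall>f\<in>S. cmod (z f - c f) < \<epsilon>}"
proof -
  have "openin prodtop (\<Pi>\<^sub>E f\<in>LUC. if f \<in> S then ball (c f) \<epsilon> else UNIV)"
    by (rule openin_PiE_gen[THEN iffD2]) (use assms in \<open>auto intro: finite_subset\<close>)
  moreover have "(\<Pi>\<^sub>E f\<in>LUC. if f \<in> S then ball (c f) \<epsilon> else UNIV) = {z \<in> extensional LUC. \<forall>f\<in>S. cmod (z f - c f) < \<epsilon>}"
    using assms(2) by (auto simp: PiE_def Pi_def dist_norm norm_minus_commute split: if_splits)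
  ultimately show ?thesis by simp
qed

text \<open>The characters lie in a product of discs, compact by Tychonoff's theorem, and form a closed subset of
it, because a limit of pointlike functionals is pointlike.\<close>

lemma compact_gelfand: "compact_space (gelfand_topology :: (('g::topological_group_mult \<Rightarrow> complex) \<Rightarrow> complex) topology)"
proof -
  let ?P = "product_topology (\<lambda>_. euclidean) LUC :: (('g \<Rightarrow> complex) \<Rightarrow> complex) topology"
  have "\<forall>f\<in>LUC. \<exists>B. \<forall>x::'g. cmod (f x) \<le> B" using LUC_bounded by blast
  then obtain B where B: "\<And>f x::'g. f \<in> LUC \<Longrightarrow> cmod (f x) \<le> B f" by metis
  have "compactin ?P (\<Pi>\<^sub>E f\<in>LUC. cball 0 (B f))" by (subst compactin_PiE) auto
  moreover have sub: "LUC_characters \<subseteq> (\<Pi>\<^sub>E f\<in>LUC. cball (0::complex) (B f))"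
  proof
    fix z :: "('g \<Rightarrow> complex) \<Rightarrow> complex" assume z: "z \<in> LUC_characters"
    have "cmod (z f) \<le> B f" if "f \<in> LUC" for f
      using pointlike_norm_le[OF character_pointlike[OF z] that B[OF that]] .
    then show "z \<in> (\<Pi>\<^sub>E f\<in>LUC. cball (0::complex) (B f))"
      using z by (auto simp: PiE_def LUC_characters_def)
  qed
  moreover have "closedin ?P LUC_characters"
  proof -
    have "?P closure_of LUC_characters \<subseteq> LUC_characters"
    proof
      fix z assume z: "z \<in> ?P closure_of LUC_characters"
      then have ext: "z \<in> extensional LUC" by (auto simp: in_closure_of PiE_def)
      have "pointlike z" unfolding pointlike_def
      proof (intro allI impI)
        fix S :: "('g \<Rightarrow> complex) set" and \<epsilon> :: real assume S: "finite S" "S \<subseteq> LUC" and e: "\<epsilon> > 0"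
        have "openin ?P {z' \<in> extensional LUC. \<forall>f\<in>S. cmod (z' f - z f) < \<epsilon> / 2}" by (rule openin_cylinder[OF S])
        moreover have "z \<in> {z' \<in> extensional LUC. \<forall>f\<in>S. cmod (z' f - z f) < \<epsilon> / 2}" using ext e by simp
        ultimately have "\<exists>z'. z' \<in> LUC_characters \<and> z' \<in> {z' \<in> extensional LUC. \<forall>f\<in>S. cmod (z' f - z f) < \<epsilon> / 2}"
          using z[unfolded in_closure_of, THEN conjunct2] by (simp only: simp_thms)
        then obtain z' where z': "z' \<in> LUC_characters" "\<forall>f\<in>S. cmod (z' f - z f) < \<epsilon> / 2" by auto
        obtain g where g: "\<forall>f\<in>S. cmod (z' f - f g) < \<epsilon> / 2"
          using character_pointlike[OF z'(1)] S e unfolding pointlike_def by (meson half_gt_zero)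
        have "cmod (z f - f g) < \<epsilon>" if "f \<in> S" for f
        proof -
          have "cmod (z f - f g) \<le> cmod (z f - z' f) + cmod (z' f - f g)"
            using norm_triangle_ineq[of "z f - z' f" "z' f - f g"] by simp
          then show ?thesis using g z' that by (smt (verit) norm_minus_commute field_sum_of_halves)
        qed
        then show "\<exists>g. \<forall>f\<in>S. cmod (z f - f g) < \<epsilon>" by blast
      qed
      then show "z \<in> LUC_characters" using ext by (rule pointlike_character)
    qed
    then show ?thesis using closure_of_subset_eq LUC_characters_ext by blast
  qed
  ultimately have "compactin ?P LUC_characters" by (rule closed_compactin)
  then show ?thesis unfolding gelfand_topology_def by (rule compact_space_subtopology)
qed

lemma continuous_map_eval: "f \<in> LUC \<Longrightarrow> continuous_map gelfand_topology euclidean (\<lambda>z. z f)"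
  unfolding gelfand_topology_def
  by (intro continuous_map_from_subtopology continuous_map_product_projection)

text \<open>The Gelfand transform of a real function, as a real function on the space of characters.\<close>

definition hat :: "('g::topological_group_mult \<Rightarrow> real) \<Rightarrow> (('g \<Rightarrow> complex) \<Rightarrow> complex) \<Rightarrow> real" where
  "hat f z = Re (z (\<lambda>x. complex_of_real (f x)))"

lemma hat_point: "f \<in> LUCR \<Longrightarrow> hat f (point_character g) = f g"
  by (simp add: hat_def LUCR_def point_character_apply)

lemma of_real_hat: "z \<in> LUC_characters \<Longrightarrow> f \<in> LUCR \<Longrightarrow> z (\<lambda>x. complex_of_real (f x)) = complex_of_real (hat f z)"
proof -
  assume z: "z \<in> LUC_characters" and f: "f \<in> LUCR"
  have "z (\<lambda>x. complex_of_real (f x)) = cnj (z (\<lambda>x. complex_of_real (f x)))"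
    using pointlike_comp[OF character_pointlike[OF z], of "\<lambda>x. complex_of_real (f x)" "\<lambda>x. complex_of_real (f x)" "\<lambda>a b. cnj a"] f
    by (simp add: LUCR_def case_prod_unfold continuous_on_cnj continuous_on_fst)
  then show ?thesis unfolding hat_def by (metis Reals_cnj_iff of_real_Re)
qed

lemma hat_comp:
  assumes "z \<in> LUC_characters" "f \<in> LUCR" "h \<in> LUCR" "continuous_on UNIV (\<lambda>(a, b). P a b)"
  shows "hat (\<lambda>x. P (f x) (h x)) z = P (hat f z) (hat h z)"
proof -
  have "z (\<lambda>x. (\<lambda>a b. complex_of_real (P (Re a) (Re b))) (complex_of_real (f x)) (complex_of_real (h x))) =
    complex_of_real (P (Re (z (\<lambda>x. complex_of_real (f x)))) (Re (z (\<lambda>x. complex_of_real (h x)))))"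
  proof (rule pointlike_comp[OF character_pointlike[OF assms(1)], where P = "\<lambda>a b. complex_of_real (P (Re a) (Re b))"])
    have "continuous_on UNIV (\<lambda>p. (\<lambda>(a, b). P a b) (Re (fst p), Re (snd p)))"
      by (rule continuous_on_compose2[OF assms(4)]) (auto intro!: continuous_intros)
    then show "continuous_on UNIV (\<lambda>(a, b). complex_of_real (P (Re a) (Re b)))"
      by (auto simp: case_prod_unfold intro!: continuous_intros)
  qed (use assms in \<open>auto simp: LUCR_def\<close>)
  then show ?thesis by (simp add: hat_def)
qed

lemma continuous_map_hat: "f \<in> LUCR \<Longrightarrow> continuous_map gelfand_topology euclideanreal (hat f)"
  unfolding hat_def LUCR_def
  using continuous_map_compose[OF continuous_map_eval, of "\<lambda>x. complex_of_real (f x)" euclidean Re]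
  by (simp add: o_def continuous_on_Re)

text \<open>A neighbourhood of \<open>z0\<close> contains all characters that are \<open>\<epsilon>\<close>-close to \<open>z0\<close> on a finite set \<open>S\<close>; with
\<open>F\<close> the sum of the \<open>\<bar>f - z0 f\<bar>\<^sup>2\<close> over \<open>f \<in> S\<close>, the transform of the positive part of
\<open>1 - F / \<epsilon>\<^sup>2\<close> vanishes off this neighbourhood.\<close>

lemma gelfand_bump:
  assumes U: "openin gelfand_topology U" and z0: "z0 \<in> U"
  shows "\<exists>f\<in>LUCR. (\<forall>z\<in>LUC_characters. 0 \<le> hat f z \<and> hat f z \<le> 1 \<and> (z \<notin> U \<longrightarrow> hat f z = 0)) \<and> hat f z0 = 1"
proof -
  have z0c: "z0 \<in> LUC_characters" using U z0 openin_subset topspace_gelfand by blast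
  obtain V where V: "openin prodtop V" "U = V \<inter> LUC_characters"
    using U unfolding gelfand_topology_def openin_subtopology by blast
  then obtain W where W: "finite {i \<in> LUC. W i \<noteq> UNIV}" "\<forall>i\<in>LUC. open (W i)" "z0 \<in> Pi\<^sub>E LUC W" "Pi\<^sub>E LUC W \<subseteq> V"
    using z0 unfolding openin_product_topology_alt by auto
  define S where "S = {i \<in> LUC. W i \<noteq> UNIV}"
  have S: "finite S" "S \<subseteq> LUC" using W by (auto simp: S_def)
  have "\<forall>f\<in>S. \<exists>e>0. ball (z0 f) e \<subseteq> W f"
    using W by (auto simp: S_def PiE_def Pi_def open_contains_ball)
  then obtain e where e: "\<And>f. f \<in> S \<Longrightarrow> e f > 0 \<and> ball (z0 f) (e f) \<subseteq> W f" by metis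
  define \<epsilon> where "\<epsilon> = Min (insert 1 (e ` S))"
  have eps: "\<epsilon> > 0" using S e by (auto simp: \<epsilon>_def)
  have eps_le: "\<epsilon> \<le> e f" if "f \<in> S" for f using S that by (auto simp: \<epsilon>_def)
  define F where "F = (\<lambda>x. \<Sum>f\<in>S. (cmod (f x - z0 f))\<^sup>2)"
  have Ff: "(\<lambda>x. (cmod (f x - z0 f))\<^sup>2) \<in> LUCR" if "f \<in> S" for f
    unfolding LUCR_def mem_Collect_eq
    by (rule LUC_comp[of f f "\<lambda>a b. complex_of_real ((cmod (a - z0 f))\<^sup>2)"])
      (use S that in \<open>auto simp: case_prod_unfold intro!: continuous_intros\<close>)
  have F: "F \<in> LUCR" unfolding F_def by (rule LUCR_sum[OF S(1) Ff])
  have hatF: "hat F z = (\<Sum>f\<in>S. (cmod (z f - z0 f))\<^sup>2)" if z: "z \<in> LUC_characters" for z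
  proof -
    have "z (\<lambda>x. \<Sum>f\<in>S. complex_of_real ((cmod (f x - z0 f))\<^sup>2)) = (\<Sum>f\<in>S. z (\<lambda>x. complex_of_real ((cmod (f x - z0 f))\<^sup>2)))"
      by (rule pointlike_sum[OF character_pointlike[OF z] S(1)]) (use Ff in \<open>simp add: LUCR_def\<close>)
    also have "\<dots> = (\<Sum>f\<in>S. complex_of_real ((cmod (z f - z0 f))\<^sup>2))"
    proof (rule sum.cong[OF refl])
      fix f assume "f \<in> S"
      then have "f \<in> LUC" using S by auto
      then show "z (\<lambda>x. complex_of_real ((cmod (f x - z0 f))\<^sup>2)) = complex_of_real ((cmod (z f - z0 f))\<^sup>2)"
        by (intro pointlike_comp[OF character_pointlike[OF z], of f f "\<lambda>a b. complex_of_real ((cmod (a - z0 f))\<^sup>2)"])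
          (auto simp: case_prod_unfold intro!: continuous_intros)
    qed
    finally show ?thesis by (simp add: hat_def F_def)
  qed
  define b where "b = (\<lambda>x. max 0 (1 - F x / \<epsilon>\<^sup>2))"
  have c: "continuous_on UNIV (\<lambda>(a::real, b::real). max 0 (1 - a / \<epsilon>\<^sup>2))"
    using eps by (auto simp: case_prod_unfold intro!: continuous_intros)
  have bL: "b \<in> LUCR" unfolding b_def by (rule LUCR_comp[OF F F c])
  have hatb: "hat b z = max 0 (1 - hat F z / \<epsilon>\<^sup>2)" if "z \<in> LUC_characters" for z
    unfolding b_def by (rule hat_comp[OF that F F c])
  show ?thesis
  proof (intro bexI[OF _ bL] conjI ballI impI)
    show "hat b z0 = 1" using hatb[OF z0c] hatF[OF z0c] by simp
    fix z :: "('a \<Rightarrow> complex) \<Rightarrow> complex" assume z: "z \<in> LUC_characters"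
    show "0 \<le> hat b z" using hatb[OF z] by simp
    have "0 \<le> hat F z" using hatF[OF z] by (simp add: sum_nonneg)
    then show "hat b z \<le> 1" using hatb[OF z] eps by simp
    assume zU: "z \<notin> U"
    have "\<exists>f\<in>S. \<epsilon> \<le> cmod (z f - z0 f)"
    proof (rule ccontr)
      assume "\<not> ?thesis"
      then have near: "\<And>f. f \<in> S \<Longrightarrow> cmod (z f - z0 f) < \<epsilon>" by force
      have "z f \<in> W f" if f: "f \<in> LUC" for f
      proof (cases "f \<in> S")
        case True
        then have "dist (z0 f) (z f) < e f" using near[OF True] eps_le[OF True] by (simp add: dist_norm norm_minus_commute)
        then show ?thesis using e[OF True] by auto
      qed (use f in \<open>simp add: S_def\<close>)
      then have "z \<in> Pi\<^sub>E LUC W" using z by (auto simp: LUC_characters_def PiE_def)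
      then show False using zU V W(4) z by auto
    qed
    then obtain f where f: "f \<in> S" "\<epsilon> \<le> cmod (z f - z0 f)" by blast
    have "\<epsilon>\<^sup>2 \<le> (cmod (z f - z0 f))\<^sup>2" using f eps by (intro power_mono) auto
    also have "\<dots> \<le> hat F z" unfolding hatF[OF z] using f S by (intro member_le_sum) auto
    finally show "hat b z = 0" using hatb[OF z] eps by simp
  qed
qed

section \<open>Means and the measures that represent them\<close>

abbreviation (input) "cplx f \<equiv> (\<lambda>x. complex_of_real (f x))"

definition rmean :: "(('g::topological_group_mult \<Rightarrow> complex) \<Rightarrow> complex) \<Rightarrow> ('g \<Rightarrow> real) \<Rightarrow> real" where
  "rmean \<rho> f = Re (\<rho> (\<lambda>x. complex_of_real (f x)))"

context
  fixes \<rho> :: "('g::topological_group_mult \<Rightarrow> complex) \<Rightarrow> complex"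
  assumes mean: "is_mean \<rho>"
begin

lemma mean_add: "f \<in> LUC \<Longrightarrow> h \<in> LUC \<Longrightarrow> \<rho> (\<lambda>x. f x + h x) = \<rho> f + \<rho> h"
  and mean_scale: "f \<in> LUC \<Longrightarrow> \<rho> (\<lambda>x. c * f x) = c * \<rho> f"
  and mean_nonneg: "f \<in> LUC \<Longrightarrow> (\<And>x. f x \<in> \<real>\<^sub>\<ge>\<^sub>0) \<Longrightarrow> \<rho> f \<in> \<real>\<^sub>\<ge>\<^sub>0"
  and mean_one: "\<rho> (\<lambda>x. 1) = 1"
  using mean unfolding is_mean_def LUC_linear_def by blast+

lemma rmean_add: "f \<in> LUCR \<Longrightarrow> h \<in> LUCR \<Longrightarrow> rmean \<rho> (\<lambda>x. f x + h x) = rmean \<rho> f + rmean \<rho> h"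
  using mean_add[of "cplx f" "cplx h"] by (simp add: rmean_def LUCR_def)
lemma rmean_scale: "f \<in> LUCR \<Longrightarrow> rmean \<rho> (\<lambda>x. c * f x) = c * rmean \<rho> f"
  using mean_scale[of "cplx f" "complex_of_real c"] by (simp add: rmean_def LUCR_def)
lemma rmean_nonneg: "f \<in> LUCR \<Longrightarrow> (\<And>x. 0 \<le> f x) \<Longrightarrow> 0 \<le> rmean \<rho> f"
  using mean_nonneg[of "cplx f"] by (auto simp: rmean_def LUCR_def nonneg_Reals_def)
lemma rmean_one: "rmean \<rho> (\<lambda>_. 1) = 1" by (simp add: rmean_def mean_one)

lemma rmean_of_real: "f \<in> LUCR \<Longrightarrow> \<rho> (cplx f) = complex_of_real (rmean \<rho> f)"
proof -
  assume f: "f \<in> LUCR"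
  obtain B where B: "\<And>x. \<bar>f x\<bar> \<le> B" using LUC_bounded[of "cplx f"] f by (auto simp: LUCR_def)
  have "\<rho> (\<lambda>x. complex_of_real (f x) + complex_of_real B * 1) \<in> \<real>\<^sub>\<ge>\<^sub>0"
  proof (rule mean_nonneg)
    show "(\<lambda>x. complex_of_real (f x) + complex_of_real B * 1) \<in> LUC"
      using f by (intro LUC_add LUC_const) (simp add: LUCR_def)
    fix x show "complex_of_real (f x) + complex_of_real B * 1 \<in> \<real>\<^sub>\<ge>\<^sub>0"
      using B[of x] by (simp add: complex_nonneg_Reals_iff)
  qed
  also have "\<rho> (\<lambda>x. complex_of_real (f x) + complex_of_real B * 1) = \<rho> (cplx f) + complex_of_real B"
  proof -
    have fL: "cplx f \<in> LUC" using f by (simp add: LUCR_def)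
    have "\<rho> (\<lambda>_. complex_of_real B * 1) = complex_of_real B"
      unfolding mean_scale[OF LUC_const] mean_one by simp
    then show ?thesis unfolding mean_add[OF fL LUC_const] by simp
  qed
  finally have "Im (\<rho> (cplx f)) = 0" by (simp add: complex_nonneg_Reals_iff)
  then show ?thesis by (simp add: rmean_def complex_eq_iff)
qed

text \<open>Functions are only compared with Gelfand transforms on characters, since the sum of two transforms need
not be a transform at functionals that are not additive.\<close>

definition gelfand_lattice :: "((('g \<Rightarrow> complex) \<Rightarrow> complex) \<Rightarrow> real) set" where
  "gelfand_lattice = {a. \<exists>f\<in>LUCR. \<forall>z\<in>LUC_characters. a z = hat f z}"

text \<open>A function in the lattice is the transform of its own restriction to the points of the group, which is
why \<open>\<rho>\<close> can be evaluated on it.\<close>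

lemma gelfand_lattice_point: "a \<in> gelfand_lattice \<Longrightarrow> (\<lambda>g. a (point_character g)) \<in> LUCR \<and> (\<forall>z\<in>LUC_characters. a z = hat (\<lambda>g. a (point_character g)) z)"
proof -
  assume "a \<in> gelfand_lattice"
  then obtain f where f: "f \<in> LUCR" "\<forall>z\<in>LUC_characters. a z = hat f z" by (auto simp: gelfand_lattice_def)
  then have "(\<lambda>g. a (point_character g)) = f" by (auto simp: fun_eq_iff hat_point point_character_in)
  then show ?thesis using f by simp
qed

lemma gelfand_lattice_comp:
  assumes "a \<in> gelfand_lattice" "b \<in> gelfand_lattice" "continuous_on UNIV (\<lambda>(a, b). P a b)"
  shows "(\<lambda>z. P (a z) (b z)) \<in> gelfand_lattice"
proof -
  obtain f where f: "f \<in> LUCR" "\<forall>z\<in>LUC_characters. a z = hat f z"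
    using assms(1) by (auto simp: gelfand_lattice_def)
  obtain h where h: "h \<in> LUCR" "\<forall>z\<in>LUC_characters. b z = hat h z"
    using assms(2) by (auto simp: gelfand_lattice_def)
  show ?thesis unfolding gelfand_lattice_def mem_Collect_eq
  proof (intro bexI ballI)
    show "(\<lambda>x. P (f x) (h x)) \<in> LUCR" by (rule LUCR_comp[OF f(1) h(1) assms(3)])
    show "P (a z) (b z) = hat (\<lambda>x. P (f x) (h x)) z" if "z \<in> LUC_characters" for z
      using hat_comp[OF that f(1) h(1) assms(3)] f(2) h(2) that by simp
  qed
qed

lemma gelfand_functional:
  "positive_functional gelfand_topology gelfand_lattice (\<lambda>a. rmean \<rho> (\<lambda>g. a (point_character g)))"
proof
  show "compact_space (gelfand_topology :: (('g \<Rightarrow> complex) \<Rightarrow> complex) topology)" by (rule compact_gelfand)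
  show "continuous_map gelfand_topology euclideanreal a" if "a \<in> gelfand_lattice" for a
  proof (rule continuous_map_eq[OF continuous_map_hat])
    show "(\<lambda>g. a (point_character g)) \<in> LUCR" by (rule conjunct1[OF gelfand_lattice_point[OF that]])
    show "hat (\<lambda>g. a (point_character g)) z = a z" if "z \<in> topspace gelfand_topology" for z
      using bspec[OF conjunct2[OF gelfand_lattice_point[OF \<open>a \<in> gelfand_lattice\<close>]], of z] that by (simp only: topspace_gelfand)
  qed
  show "(\<lambda>x. f x + g x) \<in> gelfand_lattice" if "f \<in> gelfand_lattice" "g \<in> gelfand_lattice" for f g
    by (rule gelfand_lattice_comp[OF that]) (auto simp: case_prod_unfold intro!: continuous_intros)
  show "(\<lambda>x. c * f x) \<in> gelfand_lattice" if "f \<in> gelfand_lattice" for f c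
    by (rule gelfand_lattice_comp[OF that that, of "\<lambda>a b. c * a"]) (auto simp: case_prod_unfold intro!: continuous_intros)
  show "(\<lambda>x. \<bar>f x\<bar>) \<in> gelfand_lattice" if "f \<in> gelfand_lattice" for f
    by (rule gelfand_lattice_comp[OF that that, of "\<lambda>a b. \<bar>a\<bar>"]) (auto simp: case_prod_unfold intro!: continuous_intros)
  have "hat (\<lambda>_. 1) z = 1" if "z \<in> LUC_characters" for z :: "('g \<Rightarrow> complex) \<Rightarrow> complex"
    using hat_comp[OF that LUCR_const LUCR_const, where P = "\<lambda>a b. 1"] by simp
  then show "(\<lambda>_. 1) \<in> gelfand_lattice" unfolding gelfand_lattice_def mem_Collect_eq
    by (intro bexI[of _ "\<lambda>_. 1"] ballI LUCR_const) simp
  show "\<exists>f\<in>gelfand_lattice. (\<forall>y\<in>topspace gelfand_topology. 0 \<le> f y \<and> f y \<le> 1 \<and> (y \<notin> U \<longrightarrow> f y = 0)) \<and> f x = 1"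
    if U: "openin gelfand_topology U" "x \<in> U" for U and x :: "('g \<Rightarrow> complex) \<Rightarrow> complex"
  proof -
    obtain f where "f \<in> LUCR" "(\<forall>z\<in>LUC_characters. 0 \<le> hat f z \<and> hat f z \<le> 1 \<and> (z \<notin> U \<longrightarrow> hat f z = 0)) \<and> hat f x = 1"
      using gelfand_bump[OF U] by blast
    then show ?thesis by (intro bexI[of _ "hat f"]) (auto simp: topspace_gelfand gelfand_lattice_def)
  qed
  show "rmean \<rho> (\<lambda>x. f (point_character x) + g (point_character x)) =
    rmean \<rho> (\<lambda>g. f (point_character g)) + rmean \<rho> (\<lambda>x. g (point_character x))" if "f \<in> gelfand_lattice" "g \<in> gelfand_lattice" for f g
    by (rule rmean_add[OF conjunct1[OF gelfand_lattice_point[OF that(1)]] conjunct1[OF gelfand_lattice_point[OF that(2)]]])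
  show "rmean \<rho> (\<lambda>g. c * f (point_character g)) = c * rmean \<rho> (\<lambda>g. f (point_character g))" if "f \<in> gelfand_lattice" for f c
    by (rule rmean_scale[OF conjunct1[OF gelfand_lattice_point[OF that]]])
  show "0 \<le> rmean \<rho> (\<lambda>g. f (point_character g))" if "f \<in> gelfand_lattice" "\<And>x. x \<in> topspace gelfand_topology \<Longrightarrow> 0 \<le> f x" for f
    by (rule rmean_nonneg[OF conjunct1[OF gelfand_lattice_point[OF that(1)]]]) (simp add: that(2) topspace_gelfand point_character_in)
  show "rmean \<rho> (\<lambda>_. 1) = 1" by (rule rmean_one)
qed

text \<open>The representation of \<open>\<rho>\<close> on complex functions, through which \<^const>\<open>mean_measure\<close> is defined, is
equivalent to the real representation that \<open>positive_functional.Riesz_representation\<close> provides.\<close>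

lemma representing_iff:
  assumes M: "regular_borel_prob gelfand_topology M"
  shows "(\<forall>f\<in>LUC. \<rho> f = (\<integral>z. z f \<partial>M)) \<longleftrightarrow> (\<forall>a\<in>gelfand_lattice. rmean \<rho> (\<lambda>g. a (point_character g)) = (\<integral>z. a z \<partial>M))"
proof -
  interpret G: positive_functional gelfand_topology gelfand_lattice "\<lambda>a. rmean \<rho> (\<lambda>g. a (point_character g))"
    by (rule gelfand_functional)
  have sp: "space M = LUC_characters" using M by (simp add: regular_borel_prob_def topspace_gelfand)
  have int: "integrable M (hat f)" if "f \<in> LUCR" for f
    by (rule G.integrable_A) (use M that in \<open>auto simp: regular_borel_prob_def gelfand_lattice_def\<close>)
  have real: "(\<integral>z. z (cplx f) \<partial>M) = complex_of_real (\<integral>z. hat f z \<partial>M)" if "f \<in> LUCR" for f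
  proof -
    have "(\<integral>z. z (cplx f) \<partial>M) = (\<integral>z. complex_of_real (hat f z) \<partial>M)"
      by (rule Bochner_Integration.integral_cong) (use that in \<open>auto simp: sp of_real_hat\<close>)
    then show ?thesis by simp
  qed
  have pt: "(\<lambda>g. hat f (point_character g)) = f" if "f \<in> LUCR" for f
    using hat_point[OF that] by (simp add: fun_eq_iff)
  show ?thesis
  proof
    assume L: "\<forall>f\<in>LUC. \<rho> f = (\<integral>z. z f \<partial>M)"
    show "\<forall>a\<in>gelfand_lattice. rmean \<rho> (\<lambda>g. a (point_character g)) = (\<integral>z. a z \<partial>M)"
    proof
      fix a assume a: "a \<in> gelfand_lattice"
      define f where "f = (\<lambda>g. a (point_character g))"
      have f: "f \<in> LUCR" "\<forall>z\<in>LUC_characters. a z = hat f z"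
        unfolding f_def by (rule conjunct1[OF gelfand_lattice_point[OF a]], rule conjunct2[OF gelfand_lattice_point[OF a]])
      have "complex_of_real (rmean \<rho> f) = complex_of_real (\<integral>z. hat f z \<partial>M)"
        using rmean_of_real[OF f(1)] L f real by (simp add: LUCR_def)
      moreover have "(\<integral>z. a z \<partial>M) = (\<integral>z. hat f z \<partial>M)"
        by (rule Bochner_Integration.integral_cong) (use f in \<open>auto simp: sp\<close>)
      ultimately show "rmean \<rho> (\<lambda>g. a (point_character g)) = (\<integral>z. a z \<partial>M)" by (simp add: f_def)
    qed
  next
    assume L: "\<forall>a\<in>gelfand_lattice. rmean \<rho> (\<lambda>g. a (point_character g)) = (\<integral>z. a z \<partial>M)"
    have Lr: "\<rho> (cplx f) = complex_of_real (\<integral>z. hat f z \<partial>M)" if f: "f \<in> LUCR" for f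
      using L[rule_format, of "hat f"] f by (auto simp: gelfand_lattice_def pt rmean_of_real)
    show "\<forall>f\<in>LUC. \<rho> f = (\<integral>z. z f \<partial>M)"
    proof
      fix f :: "'g \<Rightarrow> complex" assume f: "f \<in> LUC"
      define u v where "u = (\<lambda>x. Re (f x))" and "v = (\<lambda>x. Im (f x))"
      have uv: "u \<in> LUCR" "v \<in> LUCR" using LUCR_Re[OF f] LUCR_Im[OF f] by (auto simp: u_def v_def)
      have uvL: "cplx u \<in> LUC" "cplx v \<in> LUC" using uv by (auto simp: LUCR_def)
      have fe: "f = (\<lambda>x. complex_of_real (u x) + \<i> * complex_of_real (v x))"
        by (simp add: u_def v_def fun_eq_iff complex_eq_iff)
      have iv: "(\<lambda>x. \<i> * complex_of_real (v x)) \<in> LUC" by (rule LUC_mult[OF LUC_const uvL(2)])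
      have "\<rho> f = \<rho> (cplx u) + \<i> * \<rho> (cplx v)"
        unfolding fe mean_add[OF uvL(1) iv] mean_scale[OF uvL(2)] ..
      also have "\<dots> = complex_of_real (\<integral>z. hat u z \<partial>M) + \<i> * complex_of_real (\<integral>z. hat v z \<partial>M)"
        using Lr uv by simp
      also have "\<dots> = (\<integral>z. complex_of_real (hat u z) + \<i> * complex_of_real (hat v z) \<partial>M)"
        using int uv by simp
      also have "\<dots> = (\<integral>z. z f \<partial>M)"
      proof (rule Bochner_Integration.integral_cong[OF refl])
        fix z assume "z \<in> space M"
        then have z: "z \<in> LUC_characters" by (simp add: sp)
        have "z f = z (cplx u) + \<i> * z (cplx v)"
          unfolding fe using pointlike_comp[OF character_pointlike[OF z] uvL, of "\<lambda>a b. a + \<i> * b"]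
          by (simp add: case_prod_unfold continuous_intros)
        then show "complex_of_real (hat u z) + \<i> * complex_of_real (hat v z) = z f" using of_real_hat[OF z] uv by simp
      qed
      finally show "\<rho> f = (\<integral>z. z f \<partial>M)" .
    qed
  qed
qed

lemma mean_measure:
  "regular_borel_prob gelfand_topology (mean_measure \<rho>)" "\<And>f. f \<in> LUCR \<Longrightarrow> rmean \<rho> f = (\<integral>z. hat f z \<partial>mean_measure \<rho>)"
proof -
  interpret G: positive_functional gelfand_topology gelfand_lattice "\<lambda>a. rmean \<rho> (\<lambda>g. a (point_character g))"
    by (rule gelfand_functional)
  have "\<exists>!M. regular_borel_prob gelfand_topology M \<and> (\<forall>f\<in>LUC. \<rho> f = (\<integral>z. z f \<partial>M))"
    using G.Riesz_representation representing_iff by (simp cong: conj_cong)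
  from theI'[OF this] have r: "regular_borel_prob gelfand_topology (mean_measure \<rho>)"
    "\<forall>f\<in>LUC. \<rho> f = (\<integral>z. z f \<partial>mean_measure \<rho>)" by (auto simp: mean_measure_def)
  show "regular_borel_prob gelfand_topology (mean_measure \<rho>)" by (rule r(1))
  have "\<forall>a\<in>gelfand_lattice. rmean \<rho> (\<lambda>g. a (point_character g)) = (\<integral>z. a z \<partial>mean_measure \<rho>)"
    using representing_iff[OF r(1)] r(2) by simp
  then show "rmean \<rho> f = (\<integral>z. hat f z \<partial>mean_measure \<rho>)" if "f \<in> LUCR" for f
    using that hat_point[OF that] by (auto simp: gelfand_lattice_def dest!: bspec[of _ _ "hat f"])
qed

text \<open>The transform of \<open>f\<close> is at least \<open>1\<close> on the points of \<open>L\<close>, hence on their closure.\<close>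

lemma mean_of_set_le:
  assumes f: "f \<in> LUCR" and nn: "\<And>x. 0 \<le> f x" and L: "\<And>x. x \<in> L \<Longrightarrow> f x = 1"
  shows "mean_of_set \<rho> L \<le> rmean \<rho> f"
proof -
  interpret G: positive_functional gelfand_topology gelfand_lattice "\<lambda>a. rmean \<rho> (\<lambda>g. a (point_character g))"
    by (rule gelfand_functional)
  define M where "M = mean_measure \<rho>"
  have M: "regular_borel_prob gelfand_topology M" "rmean \<rho> f = (\<integral>z. hat f z \<partial>M)"
    using mean_measure f by (auto simp: M_def)
  have Mp: "prob_space M" "space M = LUC_characters" "sets M = sigma_sets (topspace gelfand_topology) {U. openin gelfand_topology U}"
    using M(1) by (auto simp: regular_borel_prob_def topspace_gelfand)
  interpret prob_space M by fact
  define C where "C = gelfand_topology closure_of (point_character ` L)"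
  have Cc: "closedin gelfand_topology C" by (simp add: C_def)
  have "topspace gelfand_topology - (topspace gelfand_topology - C) = C"
    using Cc closedin_subset by blast
  moreover have "topspace gelfand_topology - (topspace gelfand_topology - C) \<in> sets M"
    unfolding Mp(3) using Cc by (intro sigma_sets.Compl sigma_sets.Basic) (simp add: openin_diff)
  ultimately have CM: "C \<in> sets M" by simp
  have "C \<subseteq> {z \<in> topspace gelfand_topology. 1 \<le> hat f z}"
    unfolding C_def
  proof (rule closure_of_minimal)
    show "closedin gelfand_topology {z \<in> topspace gelfand_topology. 1 \<le> hat f z}"
      using closedin_continuous_map_preimage[OF continuous_map_hat[OF f], of "{1..}"] by simp
    show "point_character ` L \<subseteq> {z \<in> topspace gelfand_topology. 1 \<le> hat f z}"
      using L hat_point[OF f] by (auto simp: topspace_gelfand point_character_in)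
  qed
  then have C1: "\<And>z. z \<in> C \<Longrightarrow> 1 \<le> hat f z" by auto
  have pos: "0 \<le> hat f z" if "z \<in> LUC_characters" for z
  proof -
    have "hat (\<lambda>x. \<bar>f x\<bar>) z = \<bar>hat f z\<bar>"
      by (rule hat_comp[OF that f f, of "\<lambda>a b. \<bar>a\<bar>"]) (auto simp: case_prod_unfold intro!: continuous_intros)
    moreover have "(\<lambda>x. \<bar>f x\<bar>) = f" using nn by auto
    ultimately show ?thesis by simp
  qed
  have "mean_of_set \<rho> L = (\<integral>z. indicator C z \<partial>M)" using CM by (simp add: mean_of_set_def C_def M_def)
  also have "\<dots> \<le> (\<integral>z. hat f z \<partial>M)"
  proof (rule integral_mono)
    show "integrable M (indicat_real C)" using CM by (simp add: integrable_real_indicator emeasure_eq_measure)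
    show "integrable M (hat f)" by (rule G.integrable_A) (use M Mp f in \<open>auto simp: topspace_gelfand gelfand_lattice_def\<close>)
    show "indicator C z \<le> hat f z" if "z \<in> space M" for z
      using C1[of z] pos[of z] that Mp(2) by (auto simp: indicator_def)
  qed
  finally show ?thesis using M(2) by simp
qed

end

section \<open>Translates of a mean\<close>

lemma right_inverse_G: "a * inverse a = (1::'g::topological_group_mult)"
proof -
  let ?b = "inverse a" and ?c = "inverse (inverse a)"
  have "a * ?b = (?c * ?b) * (a * ?b)" by (simp add: left_inverse_mult)
  also have "\<dots> = ?c * (?b * a) * ?b" by (simp add: mult.assoc)
  also have "\<dots> = 1" by (simp add: left_inverse_mult)
  finally show ?thesis .
qed

lemma inv_cancel: "inverse a * (a * b) = (b::'g::topological_group_mult)" "a * (inverse a * b) = b"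
  "b * a * inverse a = b" "b * inverse a * a = b"
  by (simp_all add: mult.assoc[symmetric] left_inverse_mult right_inverse_G)
    (simp_all add: mult.assoc left_inverse_mult right_inverse_G)

lemma inverse_one_G: "inverse 1 = (1::'g::topological_group_mult)"
  using left_inverse_mult[of 1] by simp

lemma tendsto_mult_G:
  fixes a b :: "'g::topological_group_mult"
  assumes "(f \<longlongrightarrow> a) F" "(h \<longlongrightarrow> b) F"
  shows "((\<lambda>x. f x * h x) \<longlongrightarrow> a * b) F"
  using filterlim_compose[OF tendsto_mult_nhds filterlim_Pair[OF assms]] by simp

lemma tendsto_inverse_G:
  fixes a :: "'g::topological_group_mult"
  assumes "(f \<longlongrightarrow> a) F"
  shows "((\<lambda>x. inverse (f x)) \<longlongrightarrow> inverse a) F"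
  by (rule filterlim_compose[OF tendsto_inverse_nhds assms])

lemma continuous_on_mult_G [continuous_intros]:
  fixes f h :: "'a::topological_space \<Rightarrow> 'g::topological_group_mult"
  shows "continuous_on S f \<Longrightarrow> continuous_on S h \<Longrightarrow> continuous_on S (\<lambda>x. f x * h x)"
  unfolding continuous_on_def by (auto intro: tendsto_mult_G)

lemma LUC_translate:
  assumes f: "f \<in> LUC"
  shows "(\<lambda>x. f (g * x)) \<in> LUC"
  unfolding LUC_iff
proof (intro conjI allI impI)
  have "bounded (range f)" using f by (simp add: LUC_iff)
  then show "bounded (range (\<lambda>x. f (g * x)))" by (rule bounded_subset) auto
  fix \<epsilon> :: real assume "\<epsilon> > 0"
  then have "\<forall>\<^sub>F v in nhds 1. \<forall>x. cmod (f (v * x) - f x) < \<epsilon>" using f by (simp add: LUC_iff)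
  moreover have "((\<lambda>v. g * v * inverse g) \<longlongrightarrow> g * 1 * inverse g) (nhds 1)"
    by (intro tendsto_mult_G tendsto_const filterlim_ident)
  ultimately have "\<forall>\<^sub>F v in nhds 1. \<forall>x. cmod (f (g * v * inverse g * x) - f x) < \<epsilon>"
    by (auto simp: right_inverse_G dest: eventually_compose_filterlim)
  then show "\<forall>\<^sub>F v in nhds 1. \<forall>x. cmod (f (g * (v * x)) - f (g * x)) < \<epsilon>"
  proof (rule eventually_mono)
    fix v assume *: "\<forall>x. cmod (f (g * v * inverse g * x) - f x) < \<epsilon>"
    show "\<forall>x. cmod (f (g * (v * x)) - f (g * x)) < \<epsilon>"
    proof
      fix x
      have "g * v * inverse g * (g * x) = g * (v * x)" by (simp add: mult.assoc inv_cancel)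
      then show "cmod (f (g * (v * x)) - f (g * x)) < \<epsilon>" using *[rule_format, of "g * x"] by simp
    qed
  qed
qed

lemma LUCR_translate: "f \<in> LUCR \<Longrightarrow> (\<lambda>x. f (g * x)) \<in> LUCR"
  unfolding LUCR_def using LUC_translate[of "\<lambda>x. complex_of_real (f x)"] by simp

lemma rmean_mono:
  assumes "is_mean \<rho>" "f \<in> LUCR" "h \<in> LUCR" "\<And>x. f x \<le> h x"
  shows "rmean \<rho> f \<le> rmean \<rho> h"
proof -
  have d: "(\<lambda>x. (-1) * f x) \<in> LUCR"
    by (rule LUCR_comp[OF assms(2,2), of "\<lambda>a b. (-1) * a"]) (auto simp: case_prod_unfold intro!: continuous_intros)
  have "(\<lambda>x. h x + (-1) * f x) \<in> LUCR"
    by (rule LUCR_comp[OF assms(3) d]) (auto simp: case_prod_unfold intro!: continuous_intros)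
  then have "0 \<le> rmean \<rho> (\<lambda>x. h x + (-1) * f x)" by (rule rmean_nonneg[OF assms(1)]) (simp add: assms(4))
  then show ?thesis
    unfolding rmean_add[OF assms(1,3) d] rmean_scale[OF assms(1,2)] by simp
qed

lemma rmean_const: "is_mean \<rho> \<Longrightarrow> rmean \<rho> (\<lambda>_. c) = c"
  using rmean_scale[of \<rho> "\<lambda>_. 1" c] rmean_one[of \<rho>] LUCR_const[of 1] by simp

lemma rmean_bounds:
  assumes "is_mean \<rho>" "f \<in> LUCR" "\<And>x. a \<le> f x" "\<And>x. f x \<le> b"
  shows "a \<le> rmean \<rho> f" "rmean \<rho> f \<le> b"
  using rmean_mono[OF assms(1) LUCR_const assms(2), of a] rmean_mono[OF assms(1,2) LUCR_const, of b]
    rmean_const[OF assms(1)] assms(3,4) by auto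

lemma rmean_sum:
  assumes "is_mean \<rho>" "finite S" "\<And>s. s \<in> S \<Longrightarrow> F s \<in> LUCR"
  shows "rmean \<rho> (\<lambda>x. \<Sum>s\<in>S. F s x) = (\<Sum>s\<in>S. rmean \<rho> (F s))"
  using assms(2,3)
proof (induction S rule: finite_induct)
  case empty then show ?case using rmean_const[OF assms(1), of 0] by simp
next
  case (insert s S)
  then show ?case using rmean_add[OF assms(1), of "F s" "\<lambda>x. \<Sum>s\<in>S. F s x"] LUCR_sum[of S F] by simp
qed

text \<open>The function \<open>\<phi>\<close> of the introduction: the value at \<open>f\<close> of the translate of \<open>\<rho>\<close> by \<open>g\<close>. It does not
change when \<open>g\<close> is multiplied on the right by an element that leaves \<open>\<rho>\<close> invariant.\<close>

definition orbit_mean :: "(('g::topological_group_mult \<Rightarrow> complex) \<Rightarrow> complex) \<Rightarrow> ('g \<Rightarrow> real) \<Rightarrow> 'g \<Rightarrow> real" where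
  "orbit_mean \<rho> f g = rmean \<rho> (\<lambda>x. f (g * x))"

text \<open>Left uniform continuity of \<open>f\<close> compares \<open>f (y * x)\<close> and \<open>f (g * x)\<close> uniformly in \<open>x\<close>, because
\<open>y * x\<close> is \<open>g * x\<close> multiplied from the left by \<open>y * inverse g\<close>.\<close>

lemma orbit_mean_cont:
  assumes \<rho>: "is_mean \<rho>" and f: "f \<in> LUCR"
  shows "continuous_on UNIV (orbit_mean \<rho> f)"
  unfolding continuous_on_def
proof
  fix g :: 'a
  have "(orbit_mean \<rho> f \<longlongrightarrow> orbit_mean \<rho> f g) (nhds g)"
  proof (rule tendstoI)
    fix e :: real assume e: "e > 0"
    have "\<forall>\<^sub>F v in nhds 1. \<forall>x. cmod (complex_of_real (f (v * x)) - complex_of_real (f x)) < e / 2"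
      using f half_gt_zero[OF e] unfolding LUCR_def LUC_iff mem_Collect_eq by (simp only: simp_thms)
    moreover have "((\<lambda>y. y * inverse g) \<longlongrightarrow> g * inverse g) (nhds g)"
      by (intro tendsto_mult_G tendsto_const filterlim_ident)
    ultimately have "\<forall>\<^sub>F y in nhds g. \<forall>x. cmod (complex_of_real (f (y * inverse g * x)) - complex_of_real (f x)) < e / 2"
      unfolding right_inverse_G by (rule eventually_compose_filterlim)
    then show "\<forall>\<^sub>F y in nhds g. dist (orbit_mean \<rho> f y) (orbit_mean \<rho> f g) < e"
    proof (rule eventually_mono)
      fix y assume y: "\<forall>x. cmod (complex_of_real (f (y * inverse g * x)) - complex_of_real (f x)) < e / 2"
      have close: "\<bar>f (y * x) - f (g * x)\<bar> < e / 2" for x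
      proof -
        have "y * inverse g * (g * x) = y * x" by (simp add: mult.assoc inv_cancel)
        then have "cmod (complex_of_real (f (y * x)) - complex_of_real (f (g * x))) < e / 2"
          using y[rule_format, of "g * x"] by simp
        then show ?thesis by (simp flip: of_real_diff)
      qed
      have d: "(\<lambda>x. (-1) * f (g * x)) \<in> LUCR"
        by (rule LUCR_comp[OF LUCR_translate[OF f] LUCR_translate[OF f], of "\<lambda>a b. (-1) * a"]) (auto simp: case_prod_unfold intro!: continuous_intros)
      have s: "(\<lambda>x. f (y * x) + (-1) * f (g * x)) \<in> LUCR"
        by (rule LUCR_comp[OF LUCR_translate[OF f] d]) (auto simp: case_prod_unfold intro!: continuous_intros)
      have "orbit_mean \<rho> f y - orbit_mean \<rho> f g = rmean \<rho> (\<lambda>x. f (y * x) + (-1) * f (g * x))"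
        unfolding rmean_add[OF \<rho> LUCR_translate[OF f] d] rmean_scale[OF \<rho> LUCR_translate[OF f]] orbit_mean_def by simp
      moreover have "-(e/2) \<le> rmean \<rho> (\<lambda>x. f (y * x) + (-1) * f (g * x))" "rmean \<rho> (\<lambda>x. f (y * x) + (-1) * f (g * x)) \<le> e/2"
      proof -
        have "-(e/2) \<le> f (y * x) + (-1) * f (g * x)" "f (y * x) + (-1) * f (g * x) \<le> e/2" for x
          using close[of x] by linarith+
        then show "-(e/2) \<le> rmean \<rho> (\<lambda>x. f (y * x) + (-1) * f (g * x))" "rmean \<rho> (\<lambda>x. f (y * x) + (-1) * f (g * x)) \<le> e/2"
          by (rule rmean_bounds[OF \<rho> s])+
      qed
      ultimately show "dist (orbit_mean \<rho> f y) (orbit_mean \<rho> f g) < e" using e by (simp add: dist_real_def abs_less_iff)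
    qed
  qed
  then show "(orbit_mean \<rho> f \<longlongrightarrow> orbit_mean \<rho> f g) (at g within UNIV)"
    by (rule tendsto_mono[rotated]) (simp add: at_within_def)
qed

lemma orbit_mean_harmonic:
  assumes \<rho>: "is_mean \<rho>" and f: "f \<in> LUCR" and st: "stationary_mean m \<rho>"
  shows "(\<integral>x. orbit_mean \<rho> f (g * x) \<partial>m) = orbit_mean \<rho> f g"
proof -
  let ?F = "\<lambda>x. complex_of_real (f (g * x))"
  have "?F \<in> LUC" using LUCR_translate[OF f] by (simp add: LUCR_def)
  then have "(\<integral>y. \<rho> (ltranslate y ?F) \<partial>m) = \<rho> ?F" using st by (simp add: stationary_mean_def)
  moreover have "\<rho> ?F = complex_of_real (orbit_mean \<rho> f g)"
    using rmean_of_real[OF \<rho> LUCR_translate[OF f]] by (simp add: orbit_mean_def)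
  moreover have "\<rho> (ltranslate y ?F) = complex_of_real (orbit_mean \<rho> f (g * y))" for y
    using rmean_of_real[OF \<rho> LUCR_translate[OF f, of "g * y"]] by (simp add: orbit_mean_def ltranslate_def mult.assoc)
  ultimately have "complex_of_real (\<integral>x. orbit_mean \<rho> f (g * x) \<partial>m) = complex_of_real (orbit_mean \<rho> f g)" by simp
  then show ?thesis by (simp only: of_real_eq_iff)
qed

section \<open>Harmonic functions are not small at infinity\<close>

text \<open>A maximum principle. If \<open>\<phi>\<close> is less than \<open>\<phi> 1\<close> off a compact set, the set \<open>S\<close> of its maxima is compact
and nonempty. A maximum is an average of values, so it is attained at \<open>s * x\<close> for \<open>s \<in> S\<close> and all \<open>x\<close> in
the support of \<open>m\<close>. Thus the support lies in \<open>H = {x. S x \<subseteq> S}\<close>, a closed semigroup contained in a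
translate of \<open>S\<close>. A compact semigroup \<open>H\<close> in a group is a group, and then \<open>H\<close> is everything.\<close>

lemma harmonic_off_compact:
  fixes \<phi> :: "'g::{topological_group_mult, metric_space} \<Rightarrow> real"
  assumes m: "prob_space m" "sets m = sets borel"
    and adapted: "\<Inter> {H. closed_subgroup H \<and> measure_support m \<subseteq> H} = UNIV"
    and nc: "\<not> compact (UNIV :: 'g set)"
    and cont: "continuous_on UNIV \<phi>" and bdd: "\<And>x. \<bar>\<phi> x\<bar> \<le> B"
    and harm: "\<And>g. (\<integral>x. \<phi> (g * x) \<partial>m) = \<phi> g"
    and C: "compact C"
  shows "\<exists>g. g \<notin> C \<and> \<phi> 1 \<le> \<phi> g"
proof (rule ccontr)
  assume "\<not> ?thesis"
  then have off: "\<And>g. g \<notin> C \<Longrightarrow> \<phi> g < \<phi> 1" by (meson not_le)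
  interpret prob_space m by fact
  define C' where "C' = insert 1 C"
  have C': "compact C'" "C' \<noteq> {}" using C by (auto simp: C'_def)
  obtain g0 where g0: "g0 \<in> C'" "\<forall>y\<in>C'. \<phi> y \<le> \<phi> g0"
    using continuous_attains_sup[OF C' continuous_on_subset[OF cont]] by auto
  define M where "M = \<phi> g0"
  have M1: "\<phi> 1 \<le> M" using g0 by (simp add: M_def C'_def)
  have Mmax: "\<phi> g \<le> M" for g
    using off[of g] g0 M1 by (cases "g \<in> C'") (auto simp: M_def C'_def)
  define S where "S = {g. \<phi> g = M}"
  have SC: "S \<subseteq> C'"
  proof
    fix g assume "g \<in> S"
    then show "g \<in> C'" using off[of g] M1 by (cases "g \<in> C") (auto simp: S_def C'_def)
  qed
  have Scl: "closed S"
    unfolding S_def using continuous_closed_preimage_constant[OF cont, of M] by simp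
  have S: "compact S" using compact_Int_closed[OF C'(1) Scl] SC by (simp add: Int_absorb1)
  define H where "H = {x. \<forall>s\<in>S. s * x \<in> S}"
  have Hcl: "closed H"
  proof -
    have "closed {x. s * x \<in> S}" for s
    proof -
      have "continuous_on UNIV (\<lambda>x. s * x)" by (intro continuous_intros)
      then have "closed ((\<lambda>x. s * x) -` S)" using Scl by (intro closed_vimage)
      then show ?thesis by (simp add: vimage_def)
    qed
    then have "closed (\<Inter>s\<in>S. {x. s * x \<in> S})" by (intro closed_INT) auto
    moreover have "H = (\<Inter>s\<in>S. {x. s * x \<in> S})" by (auto simp: H_def)
    ultimately show ?thesis by simp
  qed
  have g0S: "g0 \<in> S" by (simp add: S_def M_def)
  have Hc: "compact H"
  proof -
    have "compact ((\<lambda>y. inverse g0 * y) ` S)"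
      by (intro compact_continuous_image S continuous_intros)
    moreover have "H \<subseteq> (\<lambda>y. inverse g0 * y) ` S"
    proof
      fix x assume "x \<in> H"
      then have "g0 * x \<in> S" using g0S by (simp add: H_def)
      then show "x \<in> (\<lambda>y. inverse g0 * y) ` S" by (intro image_eqI[of _ _ "g0 * x"]) (auto simp: inv_cancel)
    qed
    ultimately show ?thesis using compact_Int_closed[OF _ Hcl] by (metis Int_absorb1)
  qed
  have Hmult: "x * y \<in> H" if "x \<in> H" "y \<in> H" for x y
    using that by (auto simp: H_def mult.assoc[symmetric])
  have H1: "1 \<in> H" by (simp add: H_def)
  \<comment> \<open>If a subsequence of the powers of \<open>x\<close> converges, quotients of consecutive terms tend to \<open>1\<close>; dividing
    once more by \<open>x\<close> leaves nonnegative powers of \<open>x\<close> that tend to \<open>inverse x\<close>.\<close>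
  have Hinv: "inverse x \<in> H" if x: "x \<in> H" for x
  proof -
    have pow: "x ^ n \<in> H" for n by (induction n) (auto simp: H1 x Hmult)
    have "\<forall>n. x ^ n \<in> H" using pow by simp
    then obtain y r where y: "y \<in> H" "strict_mono (r :: nat \<Rightarrow> nat)" "((\<lambda>n. x ^ n) \<circ> r) \<longlonglongrightarrow> y"
      using Hc unfolding compact_def by metis
    have lim: "(\<lambda>n. x ^ r n) \<longlonglongrightarrow> y" using y(3) by (simp add: o_def)
    have "(\<lambda>n. x ^ r (Suc n) * inverse (x ^ r n) * inverse x) \<longlonglongrightarrow> y * inverse y * inverse x"
      by (intro tendsto_mult_G tendsto_inverse_G LIMSEQ_Suc[OF lim] lim tendsto_const)
    moreover have "x ^ r (Suc n) * inverse (x ^ r n) * inverse x = x ^ (r (Suc n) - Suc (r n))" for n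
    proof -
      have "r n < r (Suc n)" using y(2) by (simp add: strict_mono_Suc_iff)
      then have "r (Suc n) = (r (Suc n) - Suc (r n)) + Suc (r n)" by simp
      then have "x ^ r (Suc n) = x ^ (r (Suc n) - Suc (r n)) * x ^ Suc (r n)" by (metis power_add)
      also have "\<dots> = x ^ (r (Suc n) - Suc (r n)) * x * x ^ r n" by (simp add: mult.assoc)
      finally show ?thesis by (simp add: inv_cancel)
    qed
    ultimately have "(\<lambda>n. x ^ (r (Suc n) - Suc (r n))) \<longlonglongrightarrow> inverse x" by (simp add: right_inverse_G)
    then show ?thesis by (rule closed_sequentially[OF Hcl pow])
  qed
  have supp: "measure_support m \<subseteq> H"
  proof
    fix x assume x: "x \<in> measure_support m"
    show "x \<in> H" unfolding H_def mem_Collect_eq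
    proof
      fix s assume s: "s \<in> S"
      define u where "u y = M - \<phi> (s * y)" for y
      have uc: "continuous_on UNIV u"
        unfolding u_def by (intro continuous_intros continuous_on_compose2[OF cont]) auto
      have um: "u \<in> borel_measurable m"
        using borel_measurable_continuous_onI[OF uc] m(2) by (simp cong: measurable_cong_sets)
      have u0: "0 \<le> u y" for y using Mmax by (simp add: u_def)
      have phm: "(\<lambda>y. \<phi> (s * y)) \<in> borel_measurable m"
      proof -
        have "(\<lambda>y. \<phi> (s * y)) = (\<lambda>y. M - u y)" by (simp add: u_def)
        then show ?thesis using um by simp
      qed
      have phi: "integrable m (\<lambda>y. \<phi> (s * y))"
        by (rule integrable_const_bound[of _ B]) (use phm bdd in auto)
      have ui: "integrable m u" unfolding u_def using phi by simp
      have "(\<integral>y. u y \<partial>m) = 0" unfolding u_def using phi harm[of s] s by (simp add: S_def prob_space)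
      then have "AE y in m. u y = 0" using integral_nonneg_eq_0_iff_AE[OF ui] u0 by simp
      then have AE: "AE y in m. \<not> 0 < u y" by (rule AE_mp) simp
      have op: "open {y. 0 < u y}" using open_Collect_less[OF continuous_on_const uc, of 0] by simp
      have "{y \<in> space m. 0 < u y} \<in> sets m" using um by measurable
      then have "emeasure m {y \<in> space m. 0 < u y} = 0"
        using AE by (simp add: AE_iff_measurable[OF _ refl])
      moreover have "space m = UNIV" using sets_eq_imp_space_eq[OF m(2)] by simp
      ultimately have z: "emeasure m {y. 0 < u y} = 0" by simp
      have "\<not> 0 < u x"
      proof
        assume "0 < u x"
        then have "emeasure m {y. 0 < u y} > 0" using x op by (simp add: measure_support_def)
        then show False using z by simp
      qed
      then show "s * x \<in> S" using Mmax[of "s * x"] by (simp add: u_def S_def)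
    qed
  qed
  have "closed_subgroup H" unfolding closed_subgroup_def using Hcl H1 Hmult Hinv by simp
  then have "\<Inter> {H. closed_subgroup H \<and> measure_support m \<subseteq> H} \<subseteq> H" using supp by (intro Inter_lower) simp
  then have "H = UNIV" using adapted by auto
  then show False using Hc nc by simp
qed

section \<open>Harmonicity under convolution powers\<close>

lemma borel_measurable_mult_G:
  "(\<lambda>(x, y). x * y) \<in> borel_measurable (borel \<Otimes>\<^sub>M (borel :: 'g::{topological_group_mult, second_countable_topology} measure))"
proof -
  have "continuous_on UNIV (\<lambda>p :: 'g \<times> 'g. fst p * snd p)" by (intro continuous_intros)
  then have "(\<lambda>p :: 'g \<times> 'g. fst p * snd p) \<in> borel_measurable borel" by (rule borel_measurable_continuous_onI)
  then show ?thesis by (simp add: borel_prod case_prod_unfold)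
qed

lemma convolution_power_prob:
  fixes m :: "'g::{topological_group_mult, second_countable_topology} measure"
  assumes m: "prob_space m" "sets m = sets borel"
  shows "prob_space (mconvolution_power m k) \<and> sets (mconvolution_power m k) = sets borel"
proof (induction k)
  case 0 then show ?case by (simp add: prob_space_return)
next
  case (Suc k)
  interpret A: prob_space m by fact
  interpret P: prob_space "mconvolution_power m k" using Suc by simp
  interpret AP: pair_prob_space m "mconvolution_power m k" ..
  have "(\<lambda>(x, y). x * y) \<in> borel_measurable (m \<Otimes>\<^sub>M mconvolution_power m k)"
    using borel_measurable_mult_G Suc m(2) by (simp cong: measurable_cong_sets sets_pair_measure_cong)
  then show ?case by (simp add: mconvolution_def AP.prob_space_distr)
qed

lemma harmonic_convolution_power:
  fixes m :: "'g::{topological_group_mult, second_countable_topology} measure"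
  assumes m: "prob_space m" "sets m = sets borel"
    and cont: "continuous_on UNIV \<phi>" and bdd: "\<And>x. \<bar>\<phi> x\<bar> \<le> (B::real)"
    and harm: "\<And>g. (\<integral>x. \<phi> (g * x) \<partial>m) = \<phi> g"
  shows "(\<integral>x. \<phi> (g * x) \<partial>mconvolution_power m k) = \<phi> g"
proof (induction k arbitrary: g)
  have cg: "continuous_on UNIV (\<lambda>x. \<phi> (g * x))" for g
    by (rule continuous_on_compose2[OF cont]) (auto intro!: continuous_intros)
  have bm: "(\<lambda>x. \<phi> (g * x)) \<in> borel_measurable borel" for g by (rule borel_measurable_continuous_onI[OF cg])
  {
    case 0
    show ?case using bm[of g] by (simp add: integral_return)
  next
    case (Suc k)
    let ?P = "mconvolution_power m k"
    have P: "prob_space ?P" "sets ?P = sets borel" using convolution_power_prob[OF m] by auto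
    interpret A: prob_space m by fact
    interpret P: prob_space ?P by fact
    interpret AP: pair_prob_space m ?P ..
    have mm: "(\<lambda>(x, y). x * y) \<in> borel_measurable (m \<Otimes>\<^sub>M ?P)"
      using borel_measurable_mult_G P m(2) by (simp cong: measurable_cong_sets sets_pair_measure_cong)
    have mm2: "(\<lambda>p. \<phi> (g * (\<lambda>(x, y). x * y) p)) \<in> borel_measurable (m \<Otimes>\<^sub>M ?P)"
      using measurable_compose[OF mm bm[of g]] .
    have "(\<integral>x. \<phi> (g * x) \<partial>mconvolution_power m (Suc k)) = (\<integral>p. \<phi> (g * (\<lambda>(x, y). x * y) p) \<partial>(m \<Otimes>\<^sub>M ?P))"
      unfolding mconvolution_power.simps mconvolution_def by (rule integral_distr[OF mm bm])
    also have "\<dots> = (\<integral>x. (\<integral>y. \<phi> (g * (x * y)) \<partial>?P) \<partial>m)"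
    proof -
      have "integrable (m \<Otimes>\<^sub>M ?P) (\<lambda>p. \<phi> (g * (\<lambda>(x, y). x * y) p))"
        by (rule AP.integrable_const_bound[of _ B]) (use mm2 bdd in auto)
      from AP.integral_fst'[OF this] show ?thesis by simp
    qed
    also have "\<dots> = (\<integral>x. \<phi> (g * x) \<partial>m)" using Suc.IH by (simp add: mult.assoc[symmetric])
    also have "\<dots> = \<phi> g" by (rule harm)
    finally show ?case .
  }
qed

section \<open>Haar measure and continuity of translation\<close>

text \<open>Multiplication is continuous at \<open>(1, x)\<close> for each \<open>x \<in> C\<close>; finitely many of the neighbourhoods of \<open>x\<close>
obtained in this way cover \<open>C\<close>.\<close>

lemma translate_compact_in_open:
  fixes C U :: "'g::topological_group_mult set"
  assumes C: "compact C" and U: "open U" "C \<subseteq> U"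
  shows "\<forall>\<^sub>F u in nhds 1. \<forall>x\<in>C. u * x \<in> U"
proof -
  have "\<exists>P W. eventually P (nhds 1) \<and> open W \<and> x \<in> W \<and> (\<forall>u y. P u \<longrightarrow> y \<in> W \<longrightarrow> u * y \<in> U)" if x: "x \<in> C" for x
  proof -
    have "\<forall>\<^sub>F y in nhds (1 * x). y \<in> U" using x U by (auto intro: eventually_nhds_in_open)
    then have "\<forall>\<^sub>F p in nhds 1 \<times>\<^sub>F nhds x. fst p * snd p \<in> U"
      using tendsto_mult_nhds[of 1 x] by (rule eventually_compose_filterlim)
    then obtain P Q where PQ: "eventually P (nhds 1)" "eventually Q (nhds x)" "\<And>u y. P u \<Longrightarrow> Q y \<Longrightarrow> u * y \<in> U"
      unfolding eventually_prod_filter by auto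
    obtain W where "open W" "x \<in> W" "\<And>y. y \<in> W \<Longrightarrow> Q y" using PQ(2) unfolding eventually_nhds by auto
    then show ?thesis using PQ by (intro exI[of _ P] exI[of _ W]) auto
  qed
  then obtain P W where PW: "\<And>x. x \<in> C \<Longrightarrow> eventually (P x) (nhds 1)" "\<And>x. x \<in> C \<Longrightarrow> open (W x)" "\<And>x. x \<in> C \<Longrightarrow> x \<in> W x"
    "\<And>x u y. x \<in> C \<Longrightarrow> P x u \<Longrightarrow> y \<in> W x \<Longrightarrow> u * y \<in> U" by metis
  obtain F where F: "F \<subseteq> C" "finite F" "C \<subseteq> (\<Union>x\<in>F. W x)"
    by (rule compactE_image[OF C, of C W]) (use PW in auto)
  have "\<forall>\<^sub>F u in nhds 1. \<forall>x\<in>F. P x u" using F PW(1) by (intro eventually_ball_finite) auto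
  then show ?thesis
  proof (rule eventually_mono)
    fix u assume u: "\<forall>x\<in>F. P x u"
    show "\<forall>x\<in>C. u * x \<in> U"
    proof
      fix y assume "y \<in> C"
      then obtain x where "x \<in> F" "y \<in> W x" using F by auto
      then show "u * y \<in> U" using PW(4)[of x u y] u F by auto
    qed
  qed
qed

text \<open>Haar measure on a group exhausted by compact sets \<open>K n\<close>. The exhaustion makes the measure
\<open>\<sigma>\<close>-finite and every set of finite measure approximable by compact sets.\<close>

locale haar =
  fixes \<eta> :: "'g::{topological_group_mult, metric_space} measure" and K :: "nat \<Rightarrow> 'g set"
  assumes haar: "haar_measure \<eta>"
    and K: "\<And>n. compact (K n)" "incseq K" "(\<Union>n. K n) = UNIV"
begin

lemma sets_\<eta> [simp, measurable_cong]: "sets \<eta> = sets borel" and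
  finite_compact: "compact C \<Longrightarrow> emeasure \<eta> C < \<infinity>" and
  left_inv: "A \<in> sets borel \<Longrightarrow> emeasure \<eta> ((\<lambda>x. g * x) ` A) = emeasure \<eta> A" and
  outer_reg: "A \<in> sets borel \<Longrightarrow> emeasure \<eta> A = (INF U\<in>{U. open U \<and> A \<subseteq> U}. emeasure \<eta> U)"
  using haar unfolding haar_measure_def by simp_all

lemma space_\<eta> [simp]: "space \<eta> = UNIV" using sets_eq_imp_space_eq[OF sets_\<eta>] by simp

lemma K_borel: "K n \<in> sets borel" using K(1) compact_imp_closed by (intro borel_closed) auto

sublocale sigma_finite_measure \<eta>
proof
  show "\<exists>A. countable A \<and> A \<subseteq> sets \<eta> \<and> \<Union> A = space \<eta> \<and> (\<forall>a\<in>A. emeasure \<eta> a \<noteq> \<infinity>)"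
  proof (intro exI[of _ "range K"] conjI ballI)
    show "range K \<subseteq> sets \<eta>" using K_borel by auto
    fix a assume "a \<in> range K"
    then show "emeasure \<eta> a \<noteq> \<infinity>" using finite_compact K(1) by (auto simp: less_top)
  qed (use K in auto)
qed

lemma translate_measurable [measurable]: "(\<lambda>x. (g :: 'g) * x) \<in> borel_measurable borel"
proof (rule borel_measurable_continuous_onI)
  show "continuous_on UNIV (\<lambda>x. g * x)" by (rule continuous_on_mult_G[OF continuous_on_const continuous_on_id])
qed

lemma distr_translate: "distr \<eta> borel (\<lambda>x. g * x) = \<eta>"
proof (rule measure_eqI)
  fix A assume "A \<in> sets (distr \<eta> borel (\<lambda>x. g * x))"
  then have A: "A \<in> sets borel" by simp
  have "(\<lambda>x. g * x) -` A = (\<lambda>x. inverse g * x) ` A"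
    by (auto simp: inv_cancel intro: image_eqI[of _ _ "g * _"])
  then show "emeasure (distr \<eta> borel (\<lambda>x. g * x)) A = emeasure \<eta> A"
    using A by (simp add: emeasure_distr left_inv)
qed simp

lemma open_approx:
  assumes A: "A \<in> sets borel" "emeasure \<eta> A < \<infinity>" and e: "0 < e"
  shows "\<exists>U. open U \<and> A \<subseteq> U \<and> emeasure \<eta> U < emeasure \<eta> A + ennreal e"
proof -
  have "emeasure \<eta> A < emeasure \<eta> A + ennreal e"
    using A(2) e by (cases "emeasure \<eta> A") (auto simp flip: ennreal_plus simp: ennreal_less_iff)
  then have "\<exists>U\<in>{U. open U \<and> A \<subseteq> U}. emeasure \<eta> U < emeasure \<eta> A + ennreal e"
    unfolding outer_reg[OF A(1)] INF_less_iff .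
  then show ?thesis by auto
qed

lemma open_approx_diff:
  assumes A: "A \<in> sets borel" "emeasure \<eta> A < \<infinity>" and e: "0 < e"
  shows "\<exists>U. open U \<and> A \<subseteq> U \<and> emeasure \<eta> (U - A) < ennreal e"
proof -
  obtain U where U: "open U" "A \<subseteq> U" "emeasure \<eta> U < emeasure \<eta> A + ennreal e" using open_approx[OF assms] by auto
  have "emeasure \<eta> U = emeasure \<eta> A + emeasure \<eta> (U - A)"
    using A U plus_emeasure[of A \<eta> "U - A"] by (simp add: Un_absorb1)
  then have "emeasure \<eta> (U - A) < ennreal e"
    using U(3) by (simp add: ennreal_add_left_cancel_less)
  then show ?thesis using U by auto
qed

text \<open>Inside a large compact \<open>K n\<close>, remove an open set that tightly contains the complement of \<open>A\<close>.\<close>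

lemma compact_approx_diff:
  assumes A: "A \<in> sets borel" "emeasure \<eta> A < \<infinity>" and e: "0 < e"
  shows "\<exists>C. compact C \<and> C \<subseteq> A \<and> emeasure \<eta> (A - C) < ennreal e"
proof -
  have "(\<lambda>n. emeasure \<eta> (A - K n)) \<longlonglongrightarrow> emeasure \<eta> (\<Inter>n. A - K n)"
  proof (rule Lim_emeasure_decseq)
    show "decseq (\<lambda>n. A - K n)" using K(2) by (auto simp: decseq_def incseq_def)
    have "emeasure \<eta> (A - K i) \<le> emeasure \<eta> A" for i using A by (intro emeasure_mono) auto
    then show "emeasure \<eta> (A - K i) \<noteq> \<infinity>" for i using A(2) by (metis infinity_ennreal_def less_top top_unique)
  qed (use A K_borel in auto)
  moreover have "(\<Inter>n. A - K n) = {}" using K(3) by auto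
  ultimately have "(\<lambda>n. emeasure \<eta> (A - K n)) \<longlonglongrightarrow> 0" by (simp only: emeasure_empty)
  then have "\<forall>\<^sub>F n in sequentially. emeasure \<eta> (A - K n) < ennreal (e / 2)"
    by (rule order_tendstoD(2)) (use e in simp)
  then obtain n where n: "emeasure \<eta> (A - K n) < ennreal (e / 2)" by (auto simp: eventually_sequentially)
  have KA: "K n - A \<in> sets borel" "emeasure \<eta> (K n - A) < \<infinity>"
    using A K_borel le_less_trans[OF emeasure_mono[of "K n - A" "K n" \<eta>] finite_compact[OF K(1)]] by auto
  obtain W where W: "open W" "K n - A \<subseteq> W" "emeasure \<eta> (W - (K n - A)) < ennreal (e / 2)"
    using open_approx_diff[OF KA half_gt_zero[OF e]] by auto
  define C where "C = K n - W"
  have "compact C" unfolding C_def by (rule compact_diff[OF K(1) W(1)])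
  moreover have "C \<subseteq> A" using W by (auto simp: C_def)
  moreover have "emeasure \<eta> (A - C) < ennreal e"
  proof -
    have "emeasure \<eta> (A - C) \<le> emeasure \<eta> ((A - K n) \<union> (W - (K n - A)))"
      using A K_borel W by (intro emeasure_mono) (auto simp: C_def)
    also have "\<dots> \<le> emeasure \<eta> (A - K n) + emeasure \<eta> (W - (K n - A))"
      using A K_borel W by (intro emeasure_subadditive) auto
    also have "\<dots> < ennreal (e / 2) + ennreal (e / 2)" using n W(3) by (rule add_strict_mono)
    also have "\<dots> = ennreal e" using e by (simp flip: ennreal_plus)
    finally show ?thesis .
  qed
  ultimately show ?thesis by auto
qed

lemma translate_emeasure: "A \<in> sets borel \<Longrightarrow> emeasure \<eta> {x. u * x \<in> A} = emeasure \<eta> A"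
  using emeasure_distr[of "\<lambda>x. u * x" \<eta> borel A] by (simp add: distr_translate vimage_def)

text \<open>Squeeze \<open>A\<close> between a compact \<open>C\<close> and an open \<open>U\<close> of almost the same measure. For \<open>u\<close> near \<open>1\<close> the translate
of \<open>C\<close> stays in \<open>U\<close>, which bounds one half of the symmetric difference; the other half has the same
measure, as translation preserves the measure of \<open>A\<close>.\<close>

lemma L1_translation_indicator:
  assumes A: "A \<in> sets borel" "emeasure \<eta> A < \<infinity>" and e: "0 < e"
  shows "\<forall>\<^sub>F u in nhds 1. (\<integral>x. \<bar>indicat_real A (u * x) - indicator A x\<bar> \<partial>\<eta>) < e"
proof -
  have e4: "e / 4 > 0" using e by simp
  obtain U where U: "open U" "A \<subseteq> U" "emeasure \<eta> (U - A) < ennreal (e / 4)" using open_approx_diff[OF A e4] by auto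
  obtain C where C: "compact C" "C \<subseteq> A" "emeasure \<eta> (A - C) < ennreal (e / 4)" using compact_approx_diff[OF A e4] by auto
  have Cb: "C \<in> sets borel" using C(1) compact_imp_closed by (intro borel_closed) auto
  have "\<forall>\<^sub>F u in nhds 1. \<forall>x\<in>C. u * x \<in> U" using C U by (intro translate_compact_in_open) auto
  then show ?thesis
  proof (rule eventually_mono)
    fix u assume u: "\<forall>x\<in>C. u * x \<in> U"
    define T where "T = {x. u * x \<in> A}"
    have Tb: "T \<in> sets borel"
      using measurable_sets[OF translate_measurable[of u] A(1)] by (simp add: T_def vimage_def)
    have Ub: "{x. u * x \<in> U - A} \<in> sets borel"
      using measurable_sets[OF translate_measurable[of u], of "U - A"] A(1) U(1) by (simp add: vimage_def)
    have eT: "emeasure \<eta> T = emeasure \<eta> A" unfolding T_def by (rule translate_emeasure[OF A(1)])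
    have "emeasure \<eta> (A - T) \<le> emeasure \<eta> ((A - C) \<union> {x. u * x \<in> U - A})"
      using u A(1) Cb Ub by (intro emeasure_mono) (auto simp: T_def)
    also have "\<dots> \<le> emeasure \<eta> (A - C) + emeasure \<eta> {x. u * x \<in> U - A}"
      using A(1) Cb Ub by (intro emeasure_subadditive) auto
    also have "emeasure \<eta> {x. u * x \<in> U - A} = emeasure \<eta> (U - A)"
      using A(1) U(1) by (intro translate_emeasure) auto
    also have "emeasure \<eta> (A - C) + emeasure \<eta> (U - A) < ennreal (e / 4) + ennreal (e / 4)"
      using C(3) U(3) by (rule add_strict_mono)
    also have "\<dots> = ennreal (e / 2)" using e by (simp flip: ennreal_plus)
    finally have AT: "emeasure \<eta> (A - T) < ennreal (e / 2)" .
    have fm: "A \<in> fmeasurable \<eta>" "T \<in> fmeasurable \<eta>" using A Tb eT by (auto simp: fmeasurable_def)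
    have mAT: "measure \<eta> (A - T) < e / 2"
    proof -
      have "emeasure \<eta> (A - T) = ennreal (measure \<eta> (A - T))"
        using less_trans[OF AT ennreal_less_top] by (intro emeasure_eq_ennreal_measure) (simp add: less_top)
      then show ?thesis using AT e by (simp only:) (simp add: ennreal_less_iff)
    qed
    have "measure \<eta> (T - A) = measure \<eta> T - measure \<eta> (T \<inter> A)"
    proof -
      have "T - A = T - (T \<inter> A)" by auto
      then show ?thesis using measure_Diff[of \<eta> T "T \<inter> A"] A Tb eT by simp
    qed
    moreover have "measure \<eta> (A - T) = measure \<eta> A - measure \<eta> (T \<inter> A)"
    proof -
      have "A - T = A - (T \<inter> A)" by auto
      then show ?thesis using measure_Diff[of \<eta> A "T \<inter> A"] A Tb by simp
    qed
    moreover have "measure \<eta> T = measure \<eta> A" using eT by (simp add: measure_def)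
    ultimately have mTA: "measure \<eta> (T - A) < e / 2" using mAT by simp
    have "(\<integral>x. \<bar>indicat_real A (u * x) - indicator A x\<bar> \<partial>\<eta>) = (\<integral>x. indicator (A - T) x + indicator (T - A) x \<partial>\<eta>)"
      by (rule Bochner_Integration.integral_cong) (auto simp: T_def indicator_def)
    also have "\<dots> = measure \<eta> (A - T) + measure \<eta> (T - A)"
    proof -
      have "integrable \<eta> (indicat_real (A - T))" "integrable \<eta> (indicat_real (T - A))"
        using fm by (auto intro!: integrable_real_indicator simp: fmeasurable_def less_top[symmetric] fmeasurable_Diff intro: le_less_trans[OF emeasure_mono])
      then show ?thesis by simp
    qed
    finally show "(\<integral>x. \<bar>indicat_real A (u * x) - indicator A x\<bar> \<partial>\<eta>) < e" using mAT mTA by simp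
  qed
qed

lemma integrable_translate: "integrable \<eta> (D :: 'g \<Rightarrow> real) \<Longrightarrow> integrable \<eta> (\<lambda>x. D (u * x))"
  using integrable_distr[of "\<lambda>x. u * x" \<eta> borel D] by (simp add: distr_translate)

lemma integral_translate: "(D :: 'g \<Rightarrow> real) \<in> borel_measurable borel \<Longrightarrow> (\<integral>x. D (u * x) \<partial>\<eta>) = (\<integral>x. D x \<partial>\<eta>)"
  using integral_distr[of "\<lambda>x. u * x" \<eta> borel D] by (simp add: distr_translate)

text \<open>From indicators the claim passes to sums, and to dominated limits because translation preserves the
\<open>L\<^sup>1\<close> norm.\<close>

lemma L1_translation_continuous:
  fixes D :: "'g \<Rightarrow> real"
  assumes "integrable \<eta> D"
  shows "\<forall>e>0. \<forall>\<^sub>F u in nhds 1. (\<integral>x. \<bar>D (u * x) - D x\<bar> \<partial>\<eta>) < e"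
  using assms
proof (induction D rule: integrable_induct)
  case (base A c)
  show ?case
  proof (intro allI impI)
    fix e :: real assume e: "e > 0"
    have "\<forall>\<^sub>F u in nhds 1. (\<integral>x. \<bar>indicat_real A (u * x) - indicator A x\<bar> \<partial>\<eta>) < e / (\<bar>c\<bar> + 1)"
      using base e by (intro L1_translation_indicator) (auto simp: less_top)
    then show "\<forall>\<^sub>F u in nhds 1. (\<integral>x. \<bar>indicat_real A (u * x) *\<^sub>R c - indicator A x *\<^sub>R c\<bar> \<partial>\<eta>) < e"
    proof (rule eventually_mono)
      fix u assume u: "(\<integral>x. \<bar>indicat_real A (u * x) - indicator A x\<bar> \<partial>\<eta>) < e / (\<bar>c\<bar> + 1)"
      have "(\<integral>x. \<bar>indicat_real A (u * x) *\<^sub>R c - indicator A x *\<^sub>R c\<bar> \<partial>\<eta>) = (\<integral>x. \<bar>indicat_real A (u * x) - indicator A x\<bar> \<partial>\<eta>) * \<bar>c\<bar>"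
        by (simp add: left_diff_distrib[symmetric] abs_mult)
      also have "\<dots> \<le> (\<integral>x. \<bar>indicat_real A (u * x) - indicator A x\<bar> \<partial>\<eta>) * (\<bar>c\<bar> + 1)"
        by (intro mult_left_mono integral_nonneg) auto
      also have "\<dots> < e" using u by (simp add: pos_less_divide_eq)
      finally show "(\<integral>x. \<bar>indicat_real A (u * x) *\<^sub>R c - indicator A x *\<^sub>R c\<bar> \<partial>\<eta>) < e" .
    qed
  qed
next
  case (add f g)
  show ?case
  proof (intro allI impI)
    fix e :: real assume e: "e > 0"
    have "\<forall>\<^sub>F u in nhds 1. (\<integral>x. \<bar>f (u * x) - f x\<bar> \<partial>\<eta>) < e / 2" "\<forall>\<^sub>F u in nhds 1. (\<integral>x. \<bar>g (u * x) - g x\<bar> \<partial>\<eta>) < e / 2"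
      using add(3)[rule_format, OF half_gt_zero[OF e]] add(4)[rule_format, OF half_gt_zero[OF e]] .
    then show "\<forall>\<^sub>F u in nhds 1. (\<integral>x. \<bar>(f (u * x) + g (u * x)) - (f x + g x)\<bar> \<partial>\<eta>) < e"
    proof eventually_elim
      case (elim u)
      have i: "integrable \<eta> (\<lambda>x. \<bar>f (u * x) - f x\<bar>)" "integrable \<eta> (\<lambda>x. \<bar>g (u * x) - g x\<bar>)"
        "integrable \<eta> (\<lambda>x. \<bar>(f (u * x) + g (u * x)) - (f x + g x)\<bar>)"
        using add(1,2) by (auto intro!: integrable_abs Bochner_Integration.integrable_diff Bochner_Integration.integrable_add integrable_translate)
      have "(\<integral>x. \<bar>(f (u * x) + g (u * x)) - (f x + g x)\<bar> \<partial>\<eta>) \<le> (\<integral>x. \<bar>f (u * x) - f x\<bar> + \<bar>g (u * x) - g x\<bar> \<partial>\<eta>)"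
        using i by (intro integral_mono) auto
      also have "\<dots> = (\<integral>x. \<bar>f (u * x) - f x\<bar> \<partial>\<eta>) + (\<integral>x. \<bar>g (u * x) - g x\<bar> \<partial>\<eta>)" using i by simp
      also have "\<dots> < e" using elim by simp
      finally show ?case .
    qed
  qed
next
  case (lim f s)
  show ?case
  proof (intro allI impI)
    fix e :: real assume e: "e > 0"
    have fb: "f \<in> borel_measurable borel" using borel_measurable_integrable[OF lim(4)] by (simp cong: measurable_cong_sets)
    have "(\<lambda>i. \<integral>x. \<bar>s i x - f x\<bar> \<partial>\<eta>) \<longlonglongrightarrow> (\<integral>x. 0 \<partial>\<eta>)"
    proof (rule integral_dominated_convergence[where w = "\<lambda>x. 3 * \<bar>f x\<bar>"])
      show "AE x in \<eta>. (\<lambda>i. \<bar>s i x - f x\<bar>) \<longlonglongrightarrow> 0"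
        using lim(2) by (intro AE_I2 tendsto_rabs_zero LIM_zero) auto
      show "AE x in \<eta>. norm \<bar>s i x - f x\<bar> \<le> 3 * \<bar>f x\<bar>" for i
      proof (rule AE_I2)
        fix x assume "x \<in> space \<eta>"
        then have "\<bar>s i x\<bar> \<le> 2 * \<bar>f x\<bar>" using lim(3)[of x i] by simp
        then show "norm \<bar>s i x - f x\<bar> \<le> 3 * \<bar>f x\<bar>" by simp
      qed
      show "(\<lambda>x. \<bar>s i x - f x\<bar>) \<in> borel_measurable \<eta>" for i
        using borel_measurable_integrable[OF lim(1)[of i]] borel_measurable_integrable[OF lim(4)] by measurable
    qed (use lim(4) in auto)
    then have "\<forall>\<^sub>F i in sequentially. (\<integral>x. \<bar>s i x - f x\<bar> \<partial>\<eta>) < e / 3"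
      by (rule order_tendstoD(2)) (use e in simp)
    then obtain i where i: "(\<integral>x. \<bar>s i x - f x\<bar> \<partial>\<eta>) < e / 3" by (auto simp: eventually_sequentially)
    have "e / 3 > 0" using e by simp
    then have "\<forall>\<^sub>F u in nhds 1. (\<integral>x. \<bar>s i (u * x) - s i x\<bar> \<partial>\<eta>) < e / 3" by (rule lim(5)[of i, rule_format])
    then show "\<forall>\<^sub>F u in nhds 1. (\<integral>x. \<bar>f (u * x) - f x\<bar> \<partial>\<eta>) < e"
    proof (rule eventually_mono)
      fix u assume u: "(\<integral>x. \<bar>s i (u * x) - s i x\<bar> \<partial>\<eta>) < e / 3"
      have ii: "integrable \<eta> (\<lambda>x. \<bar>s i x - f x\<bar>)" using lim(1)[of i] lim(4) by auto
      have i1: "integrable \<eta> (\<lambda>x. \<bar>s i (u * x) - f (u * x)\<bar>)" by (rule integrable_translate[OF ii])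
      have i2: "integrable \<eta> (\<lambda>x. \<bar>s i (u * x) - s i x\<bar>)" "integrable \<eta> (\<lambda>x. \<bar>f (u * x) - f x\<bar>)"
        using lim(1)[of i] lim(4) integrable_translate by auto
      have tr: "(\<integral>x. \<bar>s i (u * x) - f (u * x)\<bar> \<partial>\<eta>) = (\<integral>x. \<bar>s i x - f x\<bar> \<partial>\<eta>)"
        using borel_measurable_integrable[OF ii] by (intro integral_translate) (simp cong: measurable_cong_sets)
      have "(\<integral>x. \<bar>f (u * x) - f x\<bar> \<partial>\<eta>) \<le> (\<integral>x. \<bar>s i (u * x) - f (u * x)\<bar> + \<bar>s i (u * x) - s i x\<bar> + \<bar>s i x - f x\<bar> \<partial>\<eta>)"
        using ii i1 i2 by (intro integral_mono) auto
      also have "\<dots> = (\<integral>x. \<bar>s i (u * x) - f (u * x)\<bar> \<partial>\<eta>) + (\<integral>x. \<bar>s i (u * x) - s i x\<bar> \<partial>\<eta>) + (\<integral>x. \<bar>s i x - f x\<bar> \<partial>\<eta>)"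
        using ii i1 i2 by simp
      also have "\<dots> < e" using tr i u by simp
      finally show "(\<integral>x. \<bar>f (u * x) - f x\<bar> \<partial>\<eta>) < e" .
    qed
  qed
qed

text \<open>In terms of the density \<open>D\<close> of \<open>P\<close>, moving \<open>\<psi>\<close> by \<open>u\<close> amounts to moving \<open>D\<close> by \<open>inverse u\<close>. The bound is
uniform in \<open>\<psi>\<close>, which is what makes \<open>right_uniformly_continuous\<close> uniform in \<open>g\<close>.\<close>

lemma total_variation_continuous:
  assumes P: "prob_space P" "sets P = sets borel" and ac: "absolutely_continuous \<eta> P" and e: "e > 0"
  shows "\<forall>\<^sub>F u in nhds 1. \<forall>\<psi>\<in>borel_measurable borel. (\<forall>x. \<bar>\<psi> x\<bar> \<le> 1) \<longrightarrow>
    \<bar>(\<integral>x. \<psi> (u * x) \<partial>P) - (\<integral>x. \<psi> x \<partial>P)\<bar> \<le> (e::real)"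
proof -
  interpret P: prob_space P by fact
  have s: "sets P = sets \<eta>" using P(2) by simp
  obtain D where D: "D \<in> borel_measurable \<eta>" "AE x in \<eta>. RN_deriv \<eta> P x = ennreal (D x)" "\<And>x. 0 \<le> D x"
    by (rule real_RN_deriv[OF P.finite_measure_axioms ac s]) auto
  have Db: "D \<in> borel_measurable borel" using D(1) by (simp cong: measurable_cong_sets)
  have dP: "P = density \<eta> (\<lambda>x. ennreal (D x))"
  proof -
    have "density \<eta> (RN_deriv \<eta> P) = P" by (rule density_RN_deriv[OF ac]) (simp add: P(2))
    moreover have "density \<eta> (RN_deriv \<eta> P) = density \<eta> (\<lambda>x. ennreal (D x))"
      by (rule density_cong) (use D in auto)
    ultimately show ?thesis by simp
  qed
  have "integrable P (\<lambda>_. 1 :: real)" by simp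
  then have Di: "integrable \<eta> D"
    unfolding dP using D integrable_density[of "\<lambda>_. 1::real" \<eta> D] by simp
  have intP: "(\<integral>x. \<psi> x \<partial>P) = (\<integral>x. D x * \<psi> x \<partial>\<eta>)" if "\<psi> \<in> borel_measurable borel" for \<psi> :: "'g \<Rightarrow> real"
    unfolding dP using that D by (subst integral_density) (auto cong: measurable_cong_sets)
  have "\<forall>\<^sub>F u in nhds 1. (\<integral>x. \<bar>D (u * x) - D x\<bar> \<partial>\<eta>) < e" using L1_translation_continuous[OF Di] e by simp
  moreover have "(inverse \<longlongrightarrow> (1::'g)) (nhds 1)" using tendsto_inverse_nhds[of "1::'g"] by (simp add: inverse_one_G)
  ultimately have "\<forall>\<^sub>F u in nhds 1. (\<integral>x. \<bar>D (inverse u * x) - D x\<bar> \<partial>\<eta>) < e" by (rule eventually_compose_filterlim)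
  then show ?thesis
  proof (rule eventually_mono, intro ballI impI)
    fix u and \<psi> :: "'g \<Rightarrow> real" assume u: "(\<integral>x. \<bar>D (inverse u * x) - D x\<bar> \<partial>\<eta>) < e"
      and \<psi>: "\<psi> \<in> borel_measurable borel" "\<forall>x. \<bar>\<psi> x\<bar> \<le> 1"
    have \<psi>u: "(\<lambda>x. \<psi> (u * x)) \<in> borel_measurable borel" by (rule measurable_compose[OF translate_measurable \<psi>(1)])
    have Du: "(\<lambda>x. D (inverse u * x)) \<in> borel_measurable borel" by (rule measurable_compose[OF translate_measurable Db])
    have i1: "integrable \<eta> (\<lambda>x. D (inverse u * x))" by (rule integrable_translate[OF Di])
    have mul: "integrable \<eta> (\<lambda>x. G x * \<psi> x)" if "integrable \<eta> G" for G :: "'g \<Rightarrow> real"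
    proof (rule Bochner_Integration.integrable_bound[OF that])
      show "(\<lambda>x. G x * \<psi> x) \<in> borel_measurable \<eta>"
        using borel_measurable_integrable[OF that] \<psi>(1) by (simp cong: measurable_cong_sets)
      show "AE x in \<eta>. norm (G x * \<psi> x) \<le> norm (G x)"
        using \<psi>(2) by (intro AE_I2) (simp add: abs_mult mult_left_le)
    qed
    have "(\<integral>x. \<psi> (u * x) \<partial>P) = (\<integral>x. D (inverse u * (u * x)) * \<psi> (u * x) \<partial>\<eta>)"
      using intP[OF \<psi>u] by (simp add: inv_cancel)
    also have "\<dots> = (\<integral>x. D (inverse u * x) * \<psi> x \<partial>\<eta>)"
      by (rule integral_translate[of "\<lambda>y. D (inverse u * y) * \<psi> y"]) (use Du \<psi> in simp)
    finally have "(\<integral>x. \<psi> (u * x) \<partial>P) - (\<integral>x. \<psi> x \<partial>P) = (\<integral>x. D (inverse u * x) * \<psi> x \<partial>\<eta>) - (\<integral>x. D x * \<psi> x \<partial>\<eta>)"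
      using intP[OF \<psi>(1)] by simp
    also have "\<dots> = (\<integral>x. (D (inverse u * x) - D x) * \<psi> x \<partial>\<eta>)"
      using mul[OF i1] mul[OF Di] by (simp add: left_diff_distrib)
    finally have "\<bar>(\<integral>x. \<psi> (u * x) \<partial>P) - (\<integral>x. \<psi> x \<partial>P)\<bar> \<le> (\<integral>x. \<bar>(D (inverse u * x) - D x) * \<psi> x\<bar> \<partial>\<eta>)"
      by (simp add: integral_abs_bound)
    also have "\<dots> \<le> (\<integral>x. \<bar>D (inverse u * x) - D x\<bar> \<partial>\<eta>)"
    proof (rule integral_mono)
      show "integrable \<eta> (\<lambda>x. \<bar>(D (inverse u * x) - D x) * \<psi> x\<bar>)"
        using i1 Di by (intro integrable_abs mul) auto
      show "integrable \<eta> (\<lambda>x. \<bar>D (inverse u * x) - D x\<bar>)" using i1 Di by auto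
      show "\<bar>(D (inverse u * x) - D x) * \<psi> x\<bar> \<le> \<bar>D (inverse u * x) - D x\<bar>" for x
        using \<psi>(2) by (simp add: abs_mult mult_left_le)
    qed
    finally show "\<bar>(\<integral>x. \<psi> (u * x) \<partial>P) - (\<integral>x. \<psi> x \<partial>P)\<bar> \<le> e" using u by simp
  qed
qed

end

section \<open>Matrices of determinant one\<close>

lemma continuous_mat_of: "continuous_on S mat_of"
  unfolding continuous_on_iff dist_SL2R.rep_eq by auto

text \<open>Countability of a base identifies the Borel sets of the product with the product of the Borel sets,
which makes multiplication measurable for the product of two measures.\<close>

instance SL2R :: second_countable_topology
proof
  obtain B :: "(real^2^2) set set" where B: "countable B" "topological_basis B"
    using ex_countable_basis by auto
  have "topological_basis ((\<lambda>V. mat_of -` V) ` B)"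
  proof (rule topological_basisI)
    fix U assume "U \<in> (\<lambda>V. mat_of -` V) ` B"
    then show "open U" using topological_basis_open[OF B(2)] continuous_mat_of
      by (auto intro: open_vimage)
  next
    fix U and x :: SL2R assume U: "open U" "x \<in> U"
    then obtain e where e: "e > 0" "\<And>y. dist y x < e \<Longrightarrow> y \<in> U" by (auto simp: open_dist)
    have "open (ball (mat_of x) e)" "mat_of x \<in> ball (mat_of x) e" using e by auto
    then obtain V where V: "V \<in> B" "mat_of x \<in> V" "V \<subseteq> ball (mat_of x) e"
      by (rule topological_basisE[OF B(2)])
    have "mat_of -` V \<subseteq> U" using V(3) e(2) by (auto simp: dist_SL2R.rep_eq dist_commute subset_iff)
    then show "\<exists>B'\<in>(\<lambda>V. mat_of -` V) ` B. x \<in> B' \<and> B' \<subseteq> U" using V by auto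
  qed
  then have "open = generate_topology ((\<lambda>V. mat_of -` V) ` B)" by (rule topological_basis_imp_subbasis)
  then show "\<exists>B::SL2R set set. countable B \<and> open = generate_topology B" using B(1) by blast
qed

lemma compact_norm_ball: "compact {g. norm (mat_of g) \<le> r}"
proof -
  let ?D = "{A :: real^2^2. det A = 1}"
  have "closed ?D" unfolding det_2
    by (intro closed_Collect_eq continuous_intros)
  then have "compact (cball 0 r \<inter> ?D)" by (intro compact_Int_closed compact_cball)
  moreover have "continuous_on (cball 0 r \<inter> ?D) SL2R_of"
    unfolding continuous_on_iff dist_SL2R.rep_eq by (auto simp: SL2R_of_inverse)
  ultimately have "compact (SL2R_of ` (cball 0 r \<inter> ?D))" by (intro compact_continuous_image)
  moreover have "SL2R_of ` (cball 0 r \<inter> ?D) = {g. norm (mat_of g) \<le> r}"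
  proof
    show "SL2R_of ` (cball 0 r \<inter> ?D) \<subseteq> {g. norm (mat_of g) \<le> r}" by (auto simp: SL2R_of_inverse)
    show "{g. norm (mat_of g) \<le> r} \<subseteq> SL2R_of ` (cball 0 r \<inter> ?D)"
    proof
      fix g assume "g \<in> {g. norm (mat_of g) \<le> r}"
      then show "g \<in> SL2R_of ` (cball 0 r \<inter> ?D)"
        using mat_of[of g] by (intro image_eqI[of _ _ "mat_of g"]) (auto simp: mat_of_inverse)
    qed
  qed
  ultimately show ?thesis by simp
qed

definition m11 :: "SL2R \<Rightarrow> real" where "m11 g = mat_of g $ 1 $ 1"
definition m12 :: "SL2R \<Rightarrow> real" where "m12 g = mat_of g $ 1 $ 2"
definition m21 :: "SL2R \<Rightarrow> real" where "m21 g = mat_of g $ 2 $ 1"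
definition m22 :: "SL2R \<Rightarrow> real" where "m22 g = mat_of g $ 2 $ 2"

lemmas entry_defs = m11_def m12_def m21_def m22_def

lemma SL2R_eqI: "m11 g = m11 h \<Longrightarrow> m12 g = m12 h \<Longrightarrow> m21 g = m21 h \<Longrightarrow> m22 g = m22 h \<Longrightarrow> g = h"
  by (rule mat_of_inject[THEN iffD1]) (simp add: vec_eq_iff forall_2 entry_defs)

lemma entries_mult:
  "m11 (g * h) = m11 g * m11 h + m12 g * m21 h" "m12 (g * h) = m11 g * m12 h + m12 g * m22 h"
  "m21 (g * h) = m21 g * m11 h + m22 g * m21 h" "m22 (g * h) = m21 g * m12 h + m22 g * m22 h"
  by (simp_all add: entry_defs times_SL2R.rep_eq matrix_matrix_mult_def sum_2)

lemma entries_one: "m11 1 = 1" "m12 1 = 0" "m21 1 = 0" "m22 1 = 1"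
  by (simp_all add: entry_defs one_SL2R.rep_eq mat_def)

lemma entries_inverse: "m11 (inverse g) = m22 g" "m12 (inverse g) = - m12 g" "m21 (inverse g) = - m21 g" "m22 (inverse g) = m11 g"
  using mat_of[of g] by (simp_all add: entry_defs inverse_SL2R.rep_eq matrix_inv_SL2)

lemma norm_entries: "(norm (mat_of g))\<^sup>2 = (m11 g)\<^sup>2 + (m12 g)\<^sup>2 + (m21 g)\<^sup>2 + (m22 g)\<^sup>2"
  unfolding power2_norm_eq_inner by (simp add: inner_vec_def sum_2 entry_defs power2_eq_square)

lemma entry_le_norm: "\<bar>m12 g\<bar> \<le> norm (mat_of g)" "\<bar>m21 g\<bar> \<le> norm (mat_of g)"
  by (rule power2_le_imp_le; simp add: norm_entries)+

definition SL2R_mat :: "real \<Rightarrow> real \<Rightarrow> real \<Rightarrow> real \<Rightarrow> SL2R" where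
  "SL2R_mat a b c d = SL2R_of (vector [vector [a, b], vector [c, d]])"

lemma entries_SL2R_mat: "a * d - b * c = 1 \<Longrightarrow> m11 (SL2R_mat a b c d) = a \<and> m12 (SL2R_mat a b c d) = b \<and> m21 (SL2R_mat a b c d) = c \<and> m22 (SL2R_mat a b c d) = d"
  by (simp add: entry_defs SL2R_mat_def SL2R_of_inverse det_2)

definition unipotent :: "real \<Rightarrow> SL2R" where "unipotent s = SL2R_mat 1 s 0 1"
definition quarter_turn :: SL2R where "quarter_turn = SL2R_mat 0 (-1) 1 0"

lemma entries_unipotent: "m11 (unipotent s) = 1" "m12 (unipotent s) = s" "m21 (unipotent s) = 0" "m22 (unipotent s) = 1"
  using entries_SL2R_mat[of 1 1 s 0] by (simp_all add: unipotent_def)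
lemma entries_quarter_turn: "m11 quarter_turn = 0" "m12 quarter_turn = -1" "m21 quarter_turn = 1" "m22 quarter_turn = 0"
  using entries_SL2R_mat[of 0 0 "-1" 1] by (simp_all add: quarter_turn_def)

lemma unipotent_add: "unipotent s * unipotent t = unipotent (s + t)"
  by (rule SL2R_eqI) (simp_all add: entries_mult entries_unipotent)
lemma unipotent_0: "unipotent 0 = 1" by (rule SL2R_eqI) (simp_all add: entries_unipotent entries_one)

lemma tendsto_unipotent: "(unipotent \<longlongrightarrow> 1) (at 0)"
proof -
  have "((\<lambda>s. mat_of (unipotent s)) \<longlongrightarrow> mat_of (unipotent 0)) (at 0)"
  proof (intro vec_tendstoI)
    fix i j :: 2
    have e: "mat_of (unipotent s) $ i $ j = (if i = 1 then (if j = 1 then 1 else s) else (if j = 1 then 0 else 1))" for s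
      using entries_unipotent[of s] exhaust_2[of i] exhaust_2[of j] by (auto simp: entry_defs)
    show "((\<lambda>s. mat_of (unipotent s) $ i $ j) \<longlongrightarrow> mat_of (unipotent 0) $ i $ j) (at 0)"
    proof (cases "i = 1 \<and> j \<noteq> 1")
      case True
      then have "mat_of (unipotent s) $ i $ j = s" for s using e[of s] by simp
      then show ?thesis by (simp add: tendsto_ident_at)
    next
      case False
      then have "(\<lambda>s. mat_of (unipotent s) $ i $ j) = (\<lambda>_. mat_of (unipotent 0) $ i $ j)"
        unfolding e by auto
      then show ?thesis by (simp only: tendsto_const)
    qed
  qed
  then show ?thesis by (simp add: tendsto_SL2R_iff unipotent_0)
qed

lemma quarter_turn_SO2: "quarter_turn \<in> SO2"
  using entries_quarter_turn by (simp add: SO2_def orthogonal_matrix_def vec_eq_iff forall_2 matrix_matrix_mult_def transpose_def mat_def sum_2 entry_defs)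

lemma not_compact_SL2R: "\<not> compact (UNIV :: SL2R set)"
proof
  assume "compact (UNIV :: SL2R set)"
  then have "bounded (mat_of ` UNIV)" by (intro compact_imp_bounded compact_continuous_image continuous_mat_of)
  then obtain B where B: "\<And>g. norm (mat_of g) \<le> B" by (auto simp: bounded_iff)
  show False using entry_le_norm(1)[of "unipotent (B + 1)"] B[of "unipotent (B + 1)"] by (simp add: entries_unipotent)
qed

lemma conj_power: "(g * u * inverse g) ^ j = g * u ^ j * inverse (g :: SL2R)"
  by (induction j) (simp_all add: right_inverse_G mult.assoc inv_cancel)

lemma unipotent_power: "unipotent s ^ j = unipotent (real j * s)"
  by (induction j) (simp_all add: unipotent_0 unipotent_add algebra_simps)

text \<open>Conjugation by \<open>g\<close> multiplies the size of a unipotent matrix by the squared length of the first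
column of \<open>g\<close>: the corner entries of the product are \<open>t\<close> times the squares of its two entries, up to
sign.\<close>

lemma norm_conj_unipotent:
  "norm (mat_of (g * unipotent t * inverse g)) \<ge> \<bar>t\<bar> * ((m11 g)\<^sup>2 + (m21 g)\<^sup>2) / 2"
proof -
  have e: "m12 (g * unipotent t * inverse g) = t * (m11 g)\<^sup>2" "m21 (g * unipotent t * inverse g) = - t * (m21 g)\<^sup>2"
    by (simp_all add: entries_mult entries_unipotent entries_inverse algebra_simps power2_eq_square)
  have "\<bar>t\<bar> * (m11 g)\<^sup>2 \<le> norm (mat_of (g * unipotent t * inverse g))" "\<bar>t\<bar> * (m21 g)\<^sup>2 \<le> norm (mat_of (g * unipotent t * inverse g))"
    using entry_le_norm[of "g * unipotent t * inverse g"] unfolding e by (simp_all add: abs_mult)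
  then show ?thesis by (simp add: distrib_left)
qed

text \<open>Apply \<open>total_variation_continuous\<close> to an absolutely continuous convolution power, for which
\<open>\<phi>\<close> is harmonic too, and to the functions \<open>\<lambda>x. \<phi> (g * x)\<close>.\<close>

lemma right_uniformly_continuous:
  fixes \<phi> :: "SL2R \<Rightarrow> real"
  assumes m: "prob_space m" "sets m = sets borel" and adm: "admissible m"
    and cont: "continuous_on UNIV \<phi>" and bdd: "\<And>x. \<bar>\<phi> x\<bar> \<le> 1"
    and harm: "\<And>g. (\<integral>x. \<phi> (g * x) \<partial>m) = \<phi> g" and e: "e > 0"
  shows "\<forall>\<^sub>F u in nhds (1 :: SL2R). \<forall>g. \<bar>\<phi> (g * u) - \<phi> g\<bar> \<le> e"
proof -
  obtain k \<eta> where \<eta>: "haar_measure \<eta>" "absolutely_continuous \<eta> (mconvolution_power m k)"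
    using adm by (auto simp: admissible_def)
  interpret haar \<eta> "\<lambda>n. {g. norm (mat_of g) \<le> real n}"
  proof
    show "haar_measure \<eta>" by fact
    show "compact {g. norm (mat_of g) \<le> real n}" for n by (rule compact_norm_ball)
    show "incseq (\<lambda>n. {g. norm (mat_of g) \<le> real n})" by (auto simp: incseq_def)
    show "(\<Union>n. {g. norm (mat_of g) \<le> real n}) = UNIV" using real_arch_simple by auto
  qed
  let ?P = "mconvolution_power m k"
  have P: "prob_space ?P" "sets ?P = sets borel" using convolution_power_prob[OF m] by auto
  have hp: "(\<integral>x. \<phi> (g * x) \<partial>?P) = \<phi> g" for g using m cont bdd harm by (rule harmonic_convolution_power)
  have "\<forall>\<^sub>F u in nhds 1. \<forall>\<psi>\<in>borel_measurable borel. (\<forall>x. \<bar>\<psi> x\<bar> \<le> 1) \<longrightarrow> \<bar>(\<integral>x. \<psi> (u * x) \<partial>?P) - (\<integral>x. \<psi> x \<partial>?P)\<bar> \<le> e"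
    using P \<eta>(2) e by (rule total_variation_continuous)
  then show ?thesis
  proof (rule eventually_mono, intro allI)
    fix u g assume u: "\<forall>\<psi>\<in>borel_measurable borel. (\<forall>x. \<bar>\<psi> x\<bar> \<le> 1) \<longrightarrow> \<bar>(\<integral>x. \<psi> (u * x) \<partial>?P) - (\<integral>x. \<psi> x \<partial>?P)\<bar> \<le> e"
    have "continuous_on UNIV (\<lambda>x. \<phi> (g * x))"
      by (rule continuous_on_compose2[OF cont]) (auto intro!: continuous_intros)
    then have "(\<lambda>x. \<phi> (g * x)) \<in> borel_measurable borel" by (rule borel_measurable_continuous_onI)
    then have "\<bar>(\<integral>x. \<phi> (g * (u * x)) \<partial>?P) - (\<integral>x. \<phi> (g * x) \<partial>?P)\<bar> \<le> e"
      by (rule u[rule_format]) (rule bdd)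
    then show "\<bar>\<phi> (g * u) - \<phi> g\<bar> \<le> e" using hp[of "g * u"] hp[of g] by (simp add: mult.assoc)
  qed
qed

section \<open>Progressions in the thickening\<close>

text \<open>The distance to \<open>L\<close> is left uniformly continuous because the metric is right invariant:
\<open>d (v * g) g = d v 1\<close> for all \<open>g\<close>.\<close>

lemma thickening_bump:
  fixes d :: "'g::topological_group_mult \<Rightarrow> 'g \<Rightarrow> real"
  assumes d: "compatible_right_invariant_metric d" and L: "L \<noteq> {}" and e: "\<epsilon> > 0"
  shows "\<exists>f\<in>LUCR. (\<forall>x. 0 \<le> f x \<and> f x \<le> 1) \<and> (\<forall>x\<in>L. f x = 1) \<and> (\<forall>x. 0 < f x \<longrightarrow> x \<in> thickening d L \<epsilon>)"
proof -
  interpret M: Metric_space UNIV d using d by (simp add: compatible_right_invariant_metric_def)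
  have top: "M.mtopology = euclidean" and inv: "\<And>x y g. d (x * g) (y * g) = d x y"
    using d by (auto simp: compatible_right_invariant_metric_def)
  define \<delta> where "\<delta> x = (INF l\<in>L. d x l)" for x
  have bb: "bdd_below ((\<lambda>l. d x l) ` L)" for x by (rule bdd_belowI[of _ 0]) auto
  have d0: "0 \<le> \<delta> x" for x unfolding \<delta>_def using L by (intro cINF_greatest) auto
  have dL: "\<delta> x \<le> d x l" if "l \<in> L" for x l unfolding \<delta>_def by (rule cINF_lower[OF bb that])
  have lip1: "\<delta> x \<le> d x y + \<delta> y" for x y
  proof -
    have "\<delta> x - d x y \<le> \<delta> y" unfolding \<delta>_def[of y]
    proof (rule cINF_greatest[OF L])
      fix l assume "l \<in> L"
      then show "\<delta> x - d x y \<le> d y l" using dL[of l x] M.triangle[of x y l] by simp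
    qed
    then show ?thesis by simp
  qed
  have lip: "\<bar>\<delta> x - \<delta> y\<bar> \<le> d x y" for x y using lip1[of x y] lip1[of y x] M.commute[of x y] by simp
  define f where "f x = max 0 (1 - \<delta> x / \<epsilon>)" for x
  have f01: "0 \<le> f x \<and> f x \<le> 1" for x using d0[of x] e by (simp add: f_def)
  have flip: "\<bar>f x - f y\<bar> \<le> d x y / \<epsilon>" for x y
  proof -
    have "\<bar>f x - f y\<bar> \<le> \<bar>\<delta> x / \<epsilon> - \<delta> y / \<epsilon>\<bar>" by (simp add: f_def)
    also have "\<dots> = \<bar>\<delta> x - \<delta> y\<bar> / \<epsilon>" using e by (simp add: diff_divide_distrib[symmetric])
    also have "\<dots> \<le> d x y / \<epsilon>" using lip e by (intro divide_right_mono) auto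
    finally show ?thesis .
  qed
  have "f \<in> LUCR" unfolding LUCR_def mem_Collect_eq LUC_iff
  proof (intro conjI allI impI)
    show "bounded (range (\<lambda>x. complex_of_real (f x)))"
      using f01 by (intro boundedI[of _ 1]) auto
    fix e' :: real assume e': "e' > 0"
    have "openin M.mtopology (M.mball 1 (e' * \<epsilon>))" by (rule M.openin_mball)
    then have "open (M.mball 1 (e' * \<epsilon>))" by (simp add: top)
    moreover have "1 \<in> M.mball 1 (e' * \<epsilon>)" using e e' by simp
    ultimately have "\<forall>\<^sub>F v in nhds 1. v \<in> M.mball 1 (e' * \<epsilon>)" by (rule eventually_nhds_in_open)
    then show "\<forall>\<^sub>F v in nhds 1. \<forall>g. cmod (complex_of_real (f (v * g)) - complex_of_real (f g)) < e'"
    proof (rule eventually_mono, intro allI)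
      fix v g assume "v \<in> M.mball 1 (e' * \<epsilon>)"
      then have "d v 1 < e' * \<epsilon>" by (simp add: M.commute)
      then have "d v 1 / \<epsilon> < e'" using e by (simp add: pos_divide_less_eq)
      moreover have "d (v * g) g = d v 1" using inv[of v g 1] by simp
      ultimately have "\<bar>f (v * g) - f g\<bar> < e'" using flip[of "v * g" g] by simp
      then show "cmod (complex_of_real (f (v * g)) - complex_of_real (f g)) < e'" by (simp flip: of_real_diff)
    qed
  qed
  moreover have "f x = 1" if "x \<in> L" for x
  proof -
    have "\<delta> x \<le> 0" using dL[OF that, of x] M.mdist_zero[of x] by simp
    then have "\<delta> x = 0" using d0[of x] by simp
    then show ?thesis by (simp add: f_def)
  qed
  moreover have "x \<in> thickening d L \<epsilon>" if "0 < f x" for x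
  proof -
    have "\<delta> x < \<epsilon>" using that e by (simp add: f_def max_def field_simps split: if_splits)
    then obtain l where "l \<in> L" "d x l < \<epsilon>" unfolding \<delta>_def using cINF_less_iff[OF L bb] by auto
    then show ?thesis by (auto simp: thickening_def INF_less_iff)
  qed
  ultimately show ?thesis using f01 by (intro bexI[of _ f]) auto
qed

lemma sum_list_fill: "sum_list (fill k i w) = sum_list (fill k 0 w) + i * count_list w k"
  by (induction w) (auto simp: fill_def)

lemma sum_list_words: "w \<in> words k n \<Longrightarrow> sum_list w \<le> n * k"
proof (induction n arbitrary: w)
  case (Suc n)
  then obtain a v where "w = a # v" "a < k" "v \<in> words k n" by (auto simp: words_def length_Suc_conv)
  then show ?case using Suc.IH[of v] by simp
qed (simp add: words_def)

theorem theorem6p1: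
  fixes m :: "SL2R measure"
    and \<rho> :: "(SL2R \<Rightarrow> complex) \<Rightarrow> complex"
    and d :: "SL2R \<Rightarrow> SL2R \<Rightarrow> real"
    and L :: "SL2R set"
  assumes "compatible_right_invariant_metric d"
    and "prob_space m" and "sets m = sets borel"
    and "admissible m"
    and "is_mean \<rho>" and "invariant_mean SO2 \<rho>" and "stationary_mean m \<rho>"
    and "mean_of_set \<rho> L > 0"
  shows "\<forall>\<epsilon>>0. \<forall>k::nat. k \<ge> 1 \<longrightarrow> (\<forall>Q. compact Q \<longrightarrow>
           (\<exists>a\<^sub>0 h. a\<^sub>0 \<notin> Q \<and> h \<notin> Q \<and> (\<forall>j\<le>k. h ^ j * a\<^sub>0 \<in> thickening d L \<epsilon>)))"
proof (intro allI impI)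
  fix \<epsilon> :: real and k :: nat and Q :: "SL2R set"
  assume \<epsilon>: "\<epsilon> > 0" and Q: "compact Q"
  note \<rho> = assms(5)
  have "L \<noteq> {}"
  proof
    assume "L = {}"
    then show False using assms(8) by (simp add: mean_of_set_def)
  qed
  from thickening_bump[OF assms(1) this \<epsilon>] obtain f where fL: "f \<in> LUCR"
    and fp: "(\<forall>x. 0 \<le> f x \<and> f x \<le> 1) \<and> (\<forall>x\<in>L. f x = 1) \<and> (\<forall>x. 0 < f x \<longrightarrow> x \<in> thickening d L \<epsilon>)"
    by (rule bexE)
  have f: "f \<in> LUCR" "\<And>x. 0 \<le> f x \<and> f x \<le> 1" "\<And>x. x \<in> L \<Longrightarrow> f x = 1"
    "\<And>x. 0 < f x \<Longrightarrow> x \<in> thickening d L \<epsilon>"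
    using fL fp by simp_all
  define \<phi> where "\<phi> = orbit_mean \<rho> f"
  define c where "c = \<phi> 1"
  have c: "c > 0"
    using mean_of_set_le[OF \<rho> f(1), of L] f assms(8) by (simp add: c_def \<phi>_def orbit_mean_def)
  have cont: "continuous_on UNIV \<phi>" unfolding \<phi>_def by (rule orbit_mean_cont[OF \<rho> f(1)])
  have \<phi>01: "0 \<le> \<phi> g" "\<phi> g \<le> 1" for g
    unfolding \<phi>_def orbit_mean_def using f(2) by (auto intro!: rmean_bounds[OF \<rho> LUCR_translate[OF f(1)], of 0 _ 1])
  have bdd: "\<bar>\<phi> g\<bar> \<le> 1" for g using \<phi>01[of g] by simp
  have harm: "(\<integral>x. \<phi> (g * x) \<partial>m) = \<phi> g" for g
    unfolding \<phi>_def by (rule orbit_mean_harmonic[OF \<rho> f(1) assms(7)])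
  \<comment> \<open>A line in \<open>K\<close> letters yields a progression of \<open>k + 2\<close> terms, one more than required.\<close>
  define K where "K = k + 2"
  have "DHJ K (c / 4)" using c by (intro density_Hales_Jewett) (auto simp: K_def)
  then obtain n where n: "\<forall>D. c / 4 \<le> dens K n D \<longrightarrow> (\<exists>w\<in>words (Suc K) n. K \<in> set w \<and> (\<forall>i<K. fill K i w \<in> D))"
    unfolding DHJ_def by auto
  define T where "T = n * K"
  have "\<forall>\<^sub>F u in nhds 1. \<forall>g. \<bar>\<phi> (g * u) - \<phi> g\<bar> \<le> c / 2"
    using right_uniformly_continuous[OF assms(2,3,4) cont bdd harm half_gt_zero[OF c]] .
  then have "\<forall>\<^sub>F s in at 0. \<forall>g. \<bar>\<phi> (g * unipotent s) - \<phi> g\<bar> \<le> c / 2"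
    using tendsto_unipotent by (rule eventually_compose_filterlim)
  then obtain \<sigma> where \<sigma>: "\<sigma> > 0" "\<And>s. s \<noteq> 0 \<Longrightarrow> \<bar>s\<bar> < \<sigma> \<Longrightarrow> \<forall>g. \<bar>\<phi> (g * unipotent s) - \<phi> g\<bar> \<le> c / 2"
    unfolding eventually_at by (auto simp: dist_real_def)
  have \<sigma>': "\<bar>\<phi> (g * unipotent s) - \<phi> g\<bar> \<le> c / 2" if "\<bar>s\<bar> < \<sigma>" for g s
    using \<sigma>(2)[of s] that c by (cases "s = 0") (auto simp: unipotent_0)
  define QQ where "QQ = (\<lambda>p. fst p * inverse (snd p)) ` (Q \<times> Q)"
  have "continuous_on (Q \<times> Q) (\<lambda>p. fst p * inverse (snd p))"
    unfolding continuous_on_def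
    by (intro ballI tendsto_mult_G tendsto_inverse_G tendsto_fst tendsto_snd tendsto_ident_at)
  then have "compact QQ" unfolding QQ_def by (intro compact_continuous_image compact_Times Q)
  then have "compact (Q \<union> QQ)" using Q by (rule compact_Un[rotated])
  then have "bounded (mat_of ` (Q \<union> QQ))" by (intro compact_imp_bounded compact_continuous_image continuous_mat_of)
  then obtain R where R: "R > 0" "\<And>q. q \<in> Q \<union> QQ \<Longrightarrow> norm (mat_of q) \<le> R"
    unfolding bounded_pos by auto
  \<comment> \<open>The norm of \<open>h ^ j\<close> will be at least \<open>j * C0 / 2\<close>, hence larger than \<open>R\<close> for \<open>j \<ge> 1\<close>.\<close>
  define C0 where "C0 = 2 * (R + 1)"
  have C0: "C0 > 0" using R by (simp add: C0_def)
  \<comment> \<open>One of the two columns carries half of the squared norm, and a squared column length above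
    \<open>T * C0 / \<sigma>\<close> makes \<open>j * s < \<sigma>\<close> for all \<open>j \<le> T\<close>.\<close>
  define r where "r = sqrt (2 * (T * C0 / \<sigma> + 1))"
  have r2: "r\<^sup>2 = 2 * (T * C0 / \<sigma> + 1)" using C0 \<sigma>(1) by (simp add: r_def)
  have r0: "0 \<le> r" using C0 \<sigma>(1) by (simp add: r_def)
  have "\<Inter> {H. closed_subgroup H \<and> measure_support m \<subseteq> H} = UNIV" using assms(4) by (simp add: admissible_def)
  then obtain g0 where "g0 \<notin> {g. norm (mat_of g) \<le> r}" "c \<le> \<phi> g0"
    using harmonic_off_compact[OF assms(2,3) _ not_compact_SL2R cont bdd harm compact_norm_ball] by (auto simp: c_def)
  then have g0: "r < norm (mat_of g0)" "c \<le> \<phi> g0" by auto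
  have "\<exists>g. T * C0 / \<sigma> + 1 < (m11 g)\<^sup>2 + (m21 g)\<^sup>2 \<and> c \<le> \<phi> g"
  proof (cases "T * C0 / \<sigma> + 1 < (m11 g0)\<^sup>2 + (m21 g0)\<^sup>2")
    case False
    have "r\<^sup>2 < (norm (mat_of g0))\<^sup>2" using g0(1) r0 by (intro power_strict_mono) auto
    moreover have "B < q + s" if "2 * B < p + q + p' + s" "\<not> B < p + p'" for B p q p' s :: real
      using that by linarith
    ultimately have "T * C0 / \<sigma> + 1 < (m12 g0)\<^sup>2 + (m22 g0)\<^sup>2"
      using False unfolding r2 norm_entries by blast
    moreover have "m11 (g0 * quarter_turn) = m12 g0" "m21 (g0 * quarter_turn) = m22 g0" by (simp_all add: entries_mult entries_quarter_turn)
    moreover have "\<phi> (g0 * quarter_turn) = \<phi> g0"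
    proof -
      have "(\<lambda>x. complex_of_real (f (g0 * x))) \<in> LUC" using LUCR_translate[OF f(1)] by (simp add: LUCR_def)
      then have "\<rho> (ltranslate quarter_turn (\<lambda>x. complex_of_real (f (g0 * x)))) = \<rho> (\<lambda>x. complex_of_real (f (g0 * x)))"
        using assms(6) quarter_turn_SO2 by (simp add: invariant_mean_def)
      then show ?thesis by (simp add: \<phi>_def orbit_mean_def rmean_def ltranslate_def mult.assoc)
    qed
    ultimately show ?thesis using g0(2) by (intro exI[of _ "g0 * quarter_turn"]) simp
  qed (use g0 in auto)
  then obtain g where g: "T * C0 / \<sigma> + 1 < (m11 g)\<^sup>2 + (m21 g)\<^sup>2" "c \<le> \<phi> g" by blast
  define N where "N = (m11 g)\<^sup>2 + (m21 g)\<^sup>2"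
  have N: "T * C0 / \<sigma> < N" "N > 0"
  proof -
    have "0 \<le> T * C0 / \<sigma>" using C0 \<sigma>(1) by simp
    then show "T * C0 / \<sigma> < N" "N > 0" using g(1) by (auto simp: N_def)
  qed
  define s where "s = C0 / N"
  define h where "h = g * unipotent s * inverse g"
  have hp: "h ^ j = g * unipotent (real j * s) * inverse g" for j by (simp add: h_def conj_power unipotent_power)
  have hg: "h ^ j * g = g * unipotent (real j * s)" for j by (simp add: hp inv_cancel)
  have big: "norm (mat_of (h ^ j)) > R" if "j \<ge> 1" for j
  proof -
    have "norm (mat_of (h ^ j)) \<ge> \<bar>real j * s\<bar> * N / 2" unfolding hp N_def by (rule norm_conj_unipotent)
    moreover have "\<bar>real j * s\<bar> * N / 2 = real j * (R + 1)" using N C0 by (simp add: s_def C0_def)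
    moreover have "real j * (R + 1) \<ge> 1 * (R + 1)" using that R by (intro mult_right_mono) auto
    ultimately show ?thesis by simp
  qed
  have low: "c / 2 \<le> \<phi> (h ^ j * g)" if "j \<le> T" for j
  proof -
    have "\<bar>real j * s\<bar> \<le> real T * s" using that C0 N by (simp add: s_def abs_mult mult_right_mono divide_right_mono)
    also have "\<dots> < \<sigma>" using N C0 \<sigma>(1) by (simp add: s_def field_simps)
    finally show ?thesis using \<sigma>'[of "real j * s" g] g(2) unfolding hg by linarith
  qed
  define S where "S x = (\<Sum>w\<in>words K n. f (h ^ sum_list w * g * x))" for x
  have Kn: "real (K ^ n) > 0" by (simp add: K_def)
  have "\<exists>x. K ^ n * (c / 4) < S x"
  proof (rule ccontr)
    assume "\<not> ?thesis"
    then have ub: "\<And>x. S x \<le> K ^ n * (c / 4)" by (simp add: not_less)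
    have S: "S \<in> LUCR" unfolding S_def by (intro LUCR_sum LUCR_translate f) auto
    have "rmean \<rho> S = (\<Sum>w\<in>words K n. \<phi> (h ^ sum_list w * g))"
      unfolding S_def \<phi>_def orbit_mean_def by (intro rmean_sum[OF \<rho>] LUCR_translate f) auto
    also have "\<dots> \<ge> (\<Sum>w\<in>words K n. c / 2)"
      by (intro sum_mono low) (use sum_list_words in \<open>auto simp: T_def\<close>)
    finally have "K ^ n * (c / 2) \<le> rmean \<rho> S" by simp
    moreover have "rmean \<rho> S \<le> K ^ n * (c / 4)"
      using rmean_mono[OF \<rho> S LUCR_const ub] rmean_const[OF \<rho>] by simp
    ultimately have "real (K ^ n) * (c / 2) \<le> real (K ^ n) * (c / 4)" by linarith
    then have "c / 2 \<le> c / 4" by (simp only: mult_le_cancel_left_pos[OF Kn])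
    then show False using c by simp
  qed
  then obtain x where x: "K ^ n * (c / 4) < S x" by blast
  define D where "D = {w. 0 < f (h ^ sum_list w * g * x)}"
  have "S x \<le> (\<Sum>w\<in>words K n. indicator D w)"
    unfolding S_def using f(2) by (intro sum_mono) (auto simp: D_def indicator_def not_less)
  then have "K ^ n * (c / 4) \<le> (\<Sum>w\<in>words K n. indicator D w)" using x by simp
  then have "c / 4 \<le> dens K n D" unfolding avg_def using Kn by (simp add: pos_le_divide_eq mult.commute)
  then obtain w where w: "w \<in> words (Suc K) n" "K \<in> set w" "\<forall>i<K. fill K i w \<in> D" using n by blast
  define s0 where "s0 = sum_list (fill K 0 w)"
  define e where "e = count_list w K"
  have "e \<noteq> 0" using w(2) count_list_0_iff[of w K] by (simp add: e_def)
  then have e: "e \<ge> 1" by simp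
  define b where "b = h ^ s0 * g * x"
  define h' where "h' = h ^ e"
  have inL: "h' ^ i * b \<in> thickening d L \<epsilon>" if "i < K" for i
  proof -
    have "0 < f (h ^ sum_list (fill K i w) * g * x)" using w(3) that by (auto simp: D_def)
    moreover have "h ^ sum_list (fill K i w) * g * x = h' ^ i * b"
      unfolding sum_list_fill[of K i w] b_def h'_def s0_def[symmetric] e_def[symmetric]
      by (simp add: power_mult[symmetric] power_add mult.assoc[symmetric] add.commute[of s0] mult.commute[of i])
    ultimately show ?thesis using f(4) by simp
  qed
  have h'R: "norm (mat_of h') > R" unfolding h'_def by (rule big[OF e])
  have h'Q: "h' \<notin> Q" "h' \<notin> QQ" using R(2)[of h'] h'R by auto
  show "\<exists>a\<^sub>0 h. a\<^sub>0 \<notin> Q \<and> h \<notin> Q \<and> (\<forall>j\<le>k. h ^ j * a\<^sub>0 \<in> thickening d L \<epsilon>)"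
  proof (cases "b \<in> Q")
    case False
    then show ?thesis using h'Q inL by (intro exI[of _ b] exI[of _ h']) (auto simp: K_def)
  next
    case True
    have "h' * b \<notin> Q"
    proof
      assume "h' * b \<in> Q"
      then have "h' * b * inverse b \<in> QQ" unfolding QQ_def using True by force
      then show False using h'Q by (simp add: inv_cancel)
    qed
    moreover have "h' ^ j * (h' * b) \<in> thickening d L \<epsilon>" if "j \<le> k" for j
      using inL[of "Suc j"] that by (simp add: K_def mult.assoc power_Suc2 del: power_Suc)
    ultimately show ?thesis using h'Q by (intro exI[of _ "h' * b"] exI[of _ h']) auto
  qed
qed

end
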